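(* Let $\Sigma$ be a compact (immersed) minimal surface in $B^n$, with nonempty boundary $\partial\Sigma\subset\partial B^n$, meeting $\partial B^n$ orthogonally along $\partial\Sigma$. Then $$2A(\Sigma)=L(\partial\Sigma)\ge 2\pi .$$
   Context: $B^n$ is the unit ball in $\mathbb{R}^n$. $A(\Sigma)$ and $L(\partial\Sigma)$ are the area of $\Sigma$ and the length of $\partial\Sigma$ in the metric induced from $\mathbb{R}^n$. Meeting $\partial B^n$ orthogonally means that the outward unit conormal of $\Sigma$ along $\partial\Sigma$ equals the position vector. *)

theory Defs
  imports "HOL-Analysis.Analysis"
begin

primrec C_k_on :: "nat \<Rightarrow> 'a::euclidean_space set \<Rightarrow> ('a \<Rightarrow> 'b::real_normed_vector) \<Rightarrow> bool" where
  "C_k_on 0 T g \<longleftrightarrow> continuous_on T g"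
| "C_k_on (Suc k) T g \<longleftrightarrow>
     (\<forall>x\<in>T. g differentiable (at x)) \<and>
     (\<forall>b\<in>Basis. C_k_on k T (\<lambda>x. frechet_derivative g (at x) b))"

text \<open>Smoothness on an arbitrary set (used for relatively open subsets of a closed half-plane):
  locally, the map is the restriction of a smooth map defined on an open set.\<close>

definition smooth_on :: "'a::euclidean_space set \<Rightarrow> ('a \<Rightarrow> 'b::real_normed_vector) \<Rightarrow> bool" where
  "smooth_on S g \<longleftrightarrow>
     (\<forall>x\<in>S. \<exists>T h. open T \<and> x \<in> T \<and> (\<forall>k. C_k_on k T h) \<and> (\<forall>y\<in>S \<inter> T. h y = g y))"

section \<open>Abstract surfaces with boundary\<close>

definition half_plane :: "(real^2) set" where
  "half_plane = {x. 0 \<le> x $ 2}"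

text \<open>A chart is a pair \<open>(U, \<phi>)\<close> of a domain and a coordinate map; \<open>\<phi>\<close> is only relevant on \<open>U\<close>.\<close>

type_synonym 'm chart = "'m set \<times> ('m \<Rightarrow> real^2)"

abbreviation dom_of :: "'m chart \<Rightarrow> 'm set" where "dom_of c \<equiv> fst c"
abbreviation coord :: "'m chart \<Rightarrow> 'm \<Rightarrow> real^2" where "coord c \<equiv> snd c"
abbreviation cod_of :: "'m chart \<Rightarrow> (real^2) set" where "cod_of c \<equiv> coord c ` dom_of c"

definition coord_inv :: "'m chart \<Rightarrow> real^2 \<Rightarrow> 'm" where
  "coord_inv c = inv_into (dom_of c) (coord c)"

definition chart_on :: "'m::topological_space set \<Rightarrow> 'm chart \<Rightarrow> bool" where
  "chart_on M c \<longleftrightarrow>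
     openin (top_of_set M) (dom_of c) \<and>
     openin (top_of_set half_plane) (cod_of c) \<and>
     homeomorphism (dom_of c) (cod_of c) (coord c) (coord_inv c)"

definition smooth_surface :: "'m::topological_space set \<Rightarrow> 'm chart set \<Rightarrow> bool" where
  "smooth_surface M A \<longleftrightarrow>
     (\<forall>c\<in>A. chart_on M c) \<and>
     (\<Union>c\<in>A. dom_of c) = M \<and>
     (\<forall>c\<in>A. \<forall>d\<in>A. smooth_on (coord c ` (dom_of c \<inter> dom_of d)) (coord d \<circ> coord_inv c))"

definition surface_boundary :: "'m chart set \<Rightarrow> 'm set" where
  "surface_boundary A = {p. \<exists>c\<in>A. p \<in> dom_of c \<and> coord c p $ 2 = 0}"

section \<open>Immersions into Euclidean space\<close>

definition local_rep :: "'m chart \<Rightarrow> ('m \<Rightarrow> 'v) \<Rightarrow> real^2 \<Rightarrow> 'v" where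
  "local_rep c f = f \<circ> coord_inv c"

definition immersion :: "'m chart set \<Rightarrow> ('m \<Rightarrow> 'v::euclidean_space) \<Rightarrow> bool" where
  "immersion A f \<longleftrightarrow>
     (\<forall>c\<in>A. smooth_on (cod_of c) (local_rep c f) \<and>
       (\<forall>x\<in>cod_of c. inj (frechet_derivative (local_rep c f) (at x within cod_of c))))"

text \<open>In the following, \<open>F\<close> is a map on a relatively open subset \<open>S\<close> of the half-plane, such as a
  local representation; derivatives at points of the boundary line are thus taken within \<open>S\<close>.\<close>

definition partial :: "(real^2) set \<Rightarrow> (real^2 \<Rightarrow> 'v::euclidean_space) \<Rightarrow> 2 \<Rightarrow> real^2 \<Rightarrow> 'v" where
  "partial S F i x = frechet_derivative F (at x within S) (axis i 1)"

definition tangent_plane :: "(real^2) set \<Rightarrow> (real^2 \<Rightarrow> 'v::euclidean_space) \<Rightarrow> real^2 \<Rightarrow> 'v set" where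
  "tangent_plane S F x = range (frechet_derivative F (at x within S))"

definition first_form :: "(real^2) set \<Rightarrow> (real^2 \<Rightarrow> 'v::euclidean_space) \<Rightarrow> real^2 \<Rightarrow> real^2^2" where
  "first_form S F x = (\<chi> i j. partial S F i x \<bullet> partial S F j x)"

definition normal_part :: "'v::euclidean_space set \<Rightarrow> 'v \<Rightarrow> 'v" where
  "normal_part T v = (THE w. w \<in> orthogonal_comp T \<and> v - w \<in> T)"

definition second_form ::
  "(real^2) set \<Rightarrow> (real^2 \<Rightarrow> 'v::euclidean_space) \<Rightarrow> real^2 \<Rightarrow> 2 \<Rightarrow> 2 \<Rightarrow> 'v" where
  "second_form S F x i j =
     normal_part (tangent_plane S F x) (partial S (partial S F j) i x)"

text \<open>The mean curvature vector is the trace of the second fundamental form with respect to the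
  induced metric; it does not depend on the chart.\<close>

definition mean_curvature :: "(real^2) set \<Rightarrow> (real^2 \<Rightarrow> 'v::euclidean_space) \<Rightarrow> real^2 \<Rightarrow> 'v" where
  "mean_curvature S F x =
     (\<Sum>i\<in>UNIV. \<Sum>j\<in>UNIV. matrix_inv (first_form S F x) $ i $ j *\<^sub>R second_form S F x i j)"

definition minimal_immersion :: "'m chart set \<Rightarrow> ('m \<Rightarrow> 'v::euclidean_space) \<Rightarrow> bool" where
  "minimal_immersion A f \<longleftrightarrow>
     immersion A f \<and>
     (\<forall>c\<in>A. \<forall>x\<in>cod_of c. mean_curvature (cod_of c) (local_rep c f) x = 0)"

text \<open>The outward unit conormal at \<open>x\<close> with \<open>x $ 2 = 0\<close>: the unit tangent vector to the surface
  that is orthogonal to the boundary (whose tangent is spanned by the first partial derivative)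
  and points out of the surface, i.e. is the image of a vector pointing out of the half-plane.\<close>

definition outward_conormal ::
  "(real^2) set \<Rightarrow> (real^2 \<Rightarrow> 'v::euclidean_space) \<Rightarrow> real^2 \<Rightarrow> 'v" where
  "outward_conormal S F x =
     (THE w. (\<exists>v. v $ 2 < 0 \<and> w = frechet_derivative F (at x within S) v) \<and>
             norm w = 1 \<and> orthogonal w (partial S F 1 x))"

definition meets_unit_sphere_orthogonally ::
  "'m chart set \<Rightarrow> ('m \<Rightarrow> 'v::euclidean_space) \<Rightarrow> bool" where
  "meets_unit_sphere_orthogonally A f \<longleftrightarrow>
     (\<forall>c\<in>A. \<forall>p\<in>dom_of c \<inter> surface_boundary A.
        outward_conormal (cod_of c) (local_rep c f) (coord c p) = f p)"

section \<open>Area and boundary length\<close>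

text \<open>A partition of \<open>M\<close> into finitely many Borel pieces, each inside the domain of a chart.\<close>

definition chart_partition ::
  "'m set \<Rightarrow> 'm chart set \<Rightarrow> 'm chart set \<Rightarrow> ('m chart \<Rightarrow> 'm set) \<Rightarrow> bool" where
  "chart_partition M A D E \<longleftrightarrow>
     finite D \<and> D \<subseteq> A \<and> disjoint_family_on E D \<and> (\<Union>c\<in>D. E c) = M \<and>
     (\<forall>c\<in>D. E c \<subseteq> dom_of c \<and> coord c ` E c \<in> sets borel)"

text \<open>The value obtained by adding up the contributions \<open>I c (E c)\<close> of the pieces of a chart
  partition.  For area and length below it is the same for all chart partitions of a compact
  surface (by the change of variables formula), and there always is one.\<close>

definition total_over_charts ::
  "'m set \<Rightarrow> 'm chart set \<Rightarrow> ('m chart \<Rightarrow> 'm set \<Rightarrow> real) \<Rightarrow> real" where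
  "total_over_charts M A I =
     (THE a. \<forall>D E. chart_partition M A D E \<longrightarrow> a = (\<Sum>c\<in>D. I c (E c)))"

definition surface_area :: "'m set \<Rightarrow> 'm chart set \<Rightarrow> ('m \<Rightarrow> 'v::euclidean_space) \<Rightarrow> real" where
  "surface_area M A f =
     total_over_charts M A (\<lambda>c E.
       integral (coord c ` E) (\<lambda>x. sqrt (det (first_form (cod_of c) (local_rep c f) x))))"

definition boundary_length :: "'m set \<Rightarrow> 'm chart set \<Rightarrow> ('m \<Rightarrow> 'v::euclidean_space) \<Rightarrow> real" where
  "boundary_length M A f =
     total_over_charts M A (\<lambda>c E.
       integral {t. vector [t, 0] \<in> coord c ` E}
         (\<lambda>t. norm (partial (cod_of c) (local_rep c f) 1 (vector [t, 0]))))"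

end

(*
In local coordinates the flux sqrt g g^{ij} d_j F of a minimal immersion F is divergence free, and
  by orthogonality its boundary value is the position vector times the length element.  A partition of
  unity gives Green's formula: the integral over the surface of the trace of <dU, dF> equals the integral
  of <U, F> over the boundary, for every C^1 map U from the surface to the ambient space.

  U = F yields 2 A = L.  For |y| = 1 and R > 1 put z = F - R y and U = F - 2 z / |z|^2.  The trace of
  <dU, dF> is at most 2, and <U, F> = (R^2 - 1) / |z|^2 on the unit sphere.  Hence L = 2 A is at least the
  boundary integral of this Poisson kernel.  When y lies on the boundary curve and R tends to 1, the part
  of the integral over a small arc through y tends to 2 pi.
*)

theory Submission
  imports Defs
begin

section \<open>Calculus on relatively open subsets of the half-plane\<close>

text \<open>Area and length are definite descriptions over all chart partitions, so nothing can be
  said about them before some partition exists and all partitions give the same value. Both facts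
  are settled once, for densities that transform by the absolute Jacobian, and serve every integrand
  on the surface and on its boundary. Cut-offs of class C^1 are enough, since Green's formula
  differentiates U only once.

  Derivatives at boundary points are one-sided. They are still unique in the half-plane; symmetry of
  the second derivatives comes from a smooth extension across the boundary line.

  The field in the lower bound is F minus the gradient of log |F - R y|^2. With the pole R y outside
  the ball it is C^1 on the whole surface, so no neighbourhood of y has to be cut out. Along an arc
  through y with parameter s close to arc length, the kernel is compared with (R^2 - 1) / ((R - 1)^2
  + R s^2). Its integral is 2 (R + 1) / sqrt R times an arctangent that tends to pi / 2, which is
  where 2 pi comes from.\<close>

lemma vector_2_collapse: "vector [x $ 1, x $ 2] = (x::real^2)"
  by (simp add: vec_eq_iff forall_2)

lemma real2_decompose: "v = v $ 1 *\<^sub>R axis 1 1 + v $ 2 *\<^sub>R (axis 2 1 :: real^2)"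
  by (simp add: vec_eq_iff forall_2 axis_def)

lemma axis_2_nth [simp]:
  "(axis 1 a :: 'a::zero^2) $ 1 = a" "(axis 1 a :: 'a::zero^2) $ 2 = 0"
  "(axis 2 a :: 'a::zero^2) $ 1 = 0" "(axis 2 a :: 'a::zero^2) $ 2 = a"
  by (simp_all add: axis_def)

lemma vector2_axis: "vector [a, b] = a *\<^sub>R axis 1 1 + b *\<^sub>R (axis 2 1 :: real^2)"
  by (simp add: vec_eq_iff forall_2)

lemma has_derivative_vector2:
  assumes "(f has_derivative f') F" "(g has_derivative g') F"
  shows "((\<lambda>x. vector [f x, g x] :: real^2) has_derivative (\<lambda>v. vector [f' v, g' v])) F"
  unfolding vector2_axis by (intro has_derivative_add has_derivative_scaleR_left assms)

lemma continuous_on_vector2: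
  assumes "continuous_on S f" "continuous_on S g"
  shows "continuous_on S (\<lambda>x. vector [f x, g x] :: real^2)"
  unfolding vector2_axis by (intro continuous_intros assms)

lemma closed_half_plane: "closed half_plane"
  unfolding half_plane_def by (intro closed_Collect_le continuous_intros)

lemma borel_openin_half_plane:
  assumes "openin (top_of_set half_plane) S"
  shows "S \<in> sets borel"
proof -
  obtain T where "open T" "S = half_plane \<inter> T" using assms by (auto simp: openin_open)
  then show ?thesis using closed_half_plane by auto
qed

section \<open>One-sided derivatives and explicit partial derivatives\<close>

lemma at_within_openin_subset:
  assumes "openin (top_of_set T) W" "W \<subseteq> S" "S \<subseteq> T" "x \<in> W"
  shows "at x within S = at x within W"
proof -
  obtain G where "open G" "W = T \<inter> G" using assms(1) by (auto simp: openin_open)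
  then show ?thesis
    using assms by (intro at_within_nhd[of x G]) auto
qed

text \<open>A small positive step along either axis never leaves the half-plane, and two independent
  directions determine a linear map; hence one-sided derivatives at boundary points are unique
  too.\<close>

lemma half_plane_derivative_unique:
  fixes g :: "real^2 \<Rightarrow> 'b::real_normed_vector"
  assumes S: "openin (top_of_set half_plane) S" and x: "x \<in> S"
    and g: "(g has_derivative g') (at x within S)" "(g has_derivative g'') (at x within S)"
  shows "g' = g''"
proof (rule frechet_derivative_unique_within[OF g])
  fix i :: "real^2" and e :: real assume i: "i \<in> Basis" and e: "e > 0"
  obtain G where G: "open G" "S = half_plane \<inter> G" using S by (auto simp: openin_open)
  then obtain r where r: "r > 0" "ball x r \<subseteq> G" using x by (auto elim: openE)
  define d where "d = min e r / 2"
  have d: "0 < d" "d < e" "d < r" using e r by (auto simp: d_def)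
  have "x + d *\<^sub>R i \<in> ball x r" using d i by (simp add: dist_norm)
  moreover have "x + d *\<^sub>R i \<in> half_plane"
    using i d x G by (auto simp: half_plane_def Basis_vec_def axis_def)
  ultimately have "x + d *\<^sub>R i \<in> S" using G r by auto
  then show "\<exists>d. 0 < \<bar>d\<bar> \<and> \<bar>d\<bar> < e \<and> x + d *\<^sub>R i \<in> S" using d by (intro exI[of _ d]) auto
qed

lemma frechet_derivative_half_plane:
  fixes g :: "real^2 \<Rightarrow> 'b::real_normed_vector"
  assumes "openin (top_of_set half_plane) S" "x \<in> S" "(g has_derivative g') (at x within S)"
  shows "frechet_derivative g (at x within S) = g'"
  by (metis assms differentiable_def frechet_derivative_works half_plane_derivative_unique)

text \<open>Class C^1 relative to \<open>S\<close>, with the two partial derivatives as explicit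
  arguments: the calculus rules then produce formulas for them, which
  \<open>has_partials_unique\<close> can compare.\<close>

definition has_partials ::
  "(real^2) set \<Rightarrow> (real^2 \<Rightarrow> 'b::real_normed_vector) \<Rightarrow> (real^2 \<Rightarrow> 'b) \<Rightarrow> (real^2 \<Rightarrow> 'b) \<Rightarrow> bool" where
  "has_partials S g g1 g2 \<longleftrightarrow> continuous_on S g1 \<and> continuous_on S g2 \<and>
     (\<forall>x\<in>S. (g has_derivative (\<lambda>v. v $ 1 *\<^sub>R g1 x + v $ 2 *\<^sub>R g2 x)) (at x within S))"

lemma has_partialsI:
  assumes "continuous_on S g1" "continuous_on S g2"
    "\<And>x. x \<in> S \<Longrightarrow> (g has_derivative (\<lambda>v. v $ 1 *\<^sub>R g1 x + v $ 2 *\<^sub>R g2 x)) (at x within S)"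
  shows "has_partials S g g1 g2"
  using assms by (simp add: has_partials_def)

lemma has_partialsD:
  assumes "has_partials S g g1 g2"
  shows "continuous_on S g" "continuous_on S g1" "continuous_on S g2"
    "\<And>x. x \<in> S \<Longrightarrow> (g has_derivative (\<lambda>v. v $ 1 *\<^sub>R g1 x + v $ 2 *\<^sub>R g2 x)) (at x within S)"
proof -
  have "continuous (at x within S) g" if "x \<in> S" for x
    using assms that unfolding has_partials_def by (auto intro: has_derivative_continuous)
  then show "continuous_on S g" by (simp add: continuous_on_eq_continuous_within)
qed (use assms in \<open>auto simp: has_partials_def\<close>)

lemma has_partials_cong:
  assumes "has_partials S g g1 g2"
    "\<And>x. x \<in> S \<Longrightarrow> g x = h x" "\<And>x. x \<in> S \<Longrightarrow> g1 x = h1 x" "\<And>x. x \<in> S \<Longrightarrow> g2 x = h2 x"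
  shows "has_partials S h h1 h2"
proof (rule has_partialsI)
  show "continuous_on S h1" "continuous_on S h2"
    by (rule continuous_on_eq[OF has_partialsD(2)[OF assms(1)] assms(3)]
        continuous_on_eq[OF has_partialsD(3)[OF assms(1)] assms(4)]; assumption)+
  fix x assume x: "x \<in> S"
  show "(h has_derivative (\<lambda>v. v $ 1 *\<^sub>R h1 x + v $ 2 *\<^sub>R h2 x)) (at x within S)"
    using has_derivative_transform[OF x _ has_partialsD(4)[OF assms(1) x]] assms x by auto
qed

lemma has_partials_subset:
  assumes "has_partials S g g1 g2" "T \<subseteq> S"
  shows "has_partials T g g1 g2"
  using assms by (auto simp: has_partials_def intro: continuous_on_subset has_derivative_subset)

lemma has_partials_derivative:
  assumes "has_partials S g g1 g2" "openin (top_of_set half_plane) S" "x \<in> S"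
  shows "frechet_derivative g (at x within S) = (\<lambda>v. v $ 1 *\<^sub>R g1 x + v $ 2 *\<^sub>R g2 x)"
  using assms by (intro frechet_derivative_half_plane has_partialsD(4))

lemma has_partials_partial:
  assumes "has_partials S g g1 g2" "openin (top_of_set half_plane) S" "x \<in> S"
  shows "partial S g 1 x = g1 x" "partial S g 2 x = g2 x"
  using has_partials_derivative[OF assms] by (simp_all add: partial_def)

text \<open>Turns two computations of the same function into an equation between partial
  derivatives; most derivative identities below arise this way.\<close>

lemma has_partials_unique:
  assumes "openin (top_of_set half_plane) S" "x \<in> S"
    and "has_partials S g g1 g2" "has_partials S g h1 h2"
  shows "g1 x = h1 x" "g2 x = h2 x"
proof -
  have eq: "(\<lambda>v::real^2. v $ 1 *\<^sub>R g1 x + v $ 2 *\<^sub>R g2 x) = (\<lambda>v. v $ 1 *\<^sub>R h1 x + v $ 2 *\<^sub>R h2 x)"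
    by (rule half_plane_derivative_unique[OF assms(1,2) has_partialsD(4)[OF assms(3,2)]
          has_partialsD(4)[OF assms(4,2)]])
  show "g1 x = h1 x" using fun_cong[OF eq, of "axis 1 1"] by simp
  show "g2 x = h2 x" using fun_cong[OF eq, of "axis 2 1"] by simp
qed

lemma has_partials_const: "has_partials S (\<lambda>x. c) (\<lambda>x. 0) (\<lambda>x. 0)"
  by (intro has_partialsI) auto

lemma has_partials_ident: "has_partials S (\<lambda>x. x) (\<lambda>x. axis 1 1) (\<lambda>x. axis 2 1)"
proof (rule has_partialsI)
  show "((\<lambda>x. x) has_derivative (\<lambda>v::real^2. v $ 1 *\<^sub>R axis 1 1 + v $ 2 *\<^sub>R axis 2 1)) (at x within S)" for x
    by (rule has_derivative_eq_rhs[OF has_derivative_ident], rule ext, rule real2_decompose)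
qed (intro continuous_intros)+

lemma has_partials_add:
  assumes "has_partials S g g1 g2" "has_partials S h h1 h2"
  shows "has_partials S (\<lambda>x. g x + h x) (\<lambda>x. g1 x + h1 x) (\<lambda>x. g2 x + h2 x)"
proof (rule has_partialsI)
  fix x assume "x \<in> S"
  then show "((\<lambda>x. g x + h x) has_derivative
      (\<lambda>v. v $ 1 *\<^sub>R (g1 x + h1 x) + v $ 2 *\<^sub>R (g2 x + h2 x))) (at x within S)"
    by (intro has_derivative_eq_rhs[OF has_derivative_add[OF has_partialsD(4)[OF assms(1)] has_partialsD(4)[OF assms(2)]]])
      (auto simp: algebra_simps)
qed (intro continuous_intros has_partialsD[OF assms(1)] has_partialsD[OF assms(2)])+

lemma has_partials_sum:
  assumes "\<And>i. i \<in> I \<Longrightarrow> has_partials S (u i) (u1 i) (u2 i)"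
  shows "has_partials S (\<lambda>x. \<Sum>i\<in>I. u i x) (\<lambda>x. \<Sum>i\<in>I. u1 i x) (\<lambda>x. \<Sum>i\<in>I. u2 i x)"
  using assms
  by (induction I rule: infinite_finite_induct) (auto intro: has_partials_const has_partials_add)

lemma has_partials_bilinear:
  assumes bl: "bounded_bilinear pr"
    and g: "has_partials S g g1 g2" and h: "has_partials S h h1 h2"
  shows "has_partials S (\<lambda>x. pr (g x) (h x)) (\<lambda>x. pr (g1 x) (h x) + pr (g x) (h1 x))
    (\<lambda>x. pr (g2 x) (h x) + pr (g x) (h2 x))"
proof (rule has_partialsI)
  interpret bounded_bilinear pr by (rule bl)
  fix x assume "x \<in> S"
  then show "((\<lambda>x. pr (g x) (h x)) has_derivative
      (\<lambda>v. v $ 1 *\<^sub>R (pr (g1 x) (h x) + pr (g x) (h1 x)) + v $ 2 *\<^sub>R (pr (g2 x) (h x) + pr (g x) (h2 x))))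
      (at x within S)"
    by (intro has_derivative_eq_rhs[OF FDERIV[OF has_partialsD(4)[OF g] has_partialsD(4)[OF h]]])
      (auto simp: algebra_simps add_left add_right scaleR_left scaleR_right)
qed (intro continuous_intros bounded_bilinear.continuous_on[OF bl] has_partialsD[OF g] has_partialsD[OF h])+

lemmas has_partials_inner = has_partials_bilinear[OF bounded_bilinear_inner]
lemmas has_partials_mult = has_partials_bilinear[OF bounded_bilinear_mult]
lemmas has_partials_scaleR = has_partials_bilinear[OF bounded_bilinear_scaleR]

section \<open>The class of C^1 functions and its closure properties\<close>

definition C1_on :: "(real^2) set \<Rightarrow> (real^2 \<Rightarrow> 'b::real_normed_vector) \<Rightarrow> bool" where
  "C1_on S g \<longleftrightarrow> (\<exists>g1 g2. has_partials S g g1 g2)"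

lemma C1_onI: "has_partials S g g1 g2 \<Longrightarrow> C1_on S g"
  unfolding C1_on_def by (intro exI)

lemma C1_on_cong: "C1_on S g \<Longrightarrow> (\<And>x. x \<in> S \<Longrightarrow> g x = h x) \<Longrightarrow> C1_on S h"
  unfolding C1_on_def by (elim exE) (intro exI, rule has_partials_cong[OF _ _ refl refl])

lemma C1_on_has_partials:
  fixes g :: "real^2 \<Rightarrow> 'b::euclidean_space"
  assumes "C1_on S g" "openin (top_of_set half_plane) S"
  shows "has_partials S g (partial S g 1) (partial S g 2)"
proof -
  obtain g1 g2 where g: "has_partials S g g1 g2" using assms(1) by (auto simp: C1_on_def)
  show ?thesis by (rule has_partials_cong[OF g]) (simp_all add: has_partials_partial[OF g assms(2)])
qed

lemma C1_on_imp_continuous_on: "C1_on S g \<Longrightarrow> continuous_on S g"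
  by (auto simp: C1_on_def dest: has_partialsD)

lemma C1_on_const: "C1_on S (\<lambda>x. c)"
  by (rule C1_onI[OF has_partials_const])

lemma C1_on_add: "C1_on S g \<Longrightarrow> C1_on S h \<Longrightarrow> C1_on S (\<lambda>x. g x + h x)"
  unfolding C1_on_def by (elim exE) (intro exI, rule has_partials_add)

lemma C1_on_sum: "(\<And>i. i \<in> I \<Longrightarrow> C1_on S (g i)) \<Longrightarrow> C1_on S (\<lambda>x. \<Sum>i\<in>I. g i x)"
  by (induction I rule: infinite_finite_induct) (auto intro: C1_on_const C1_on_add)

lemma C1_on_bilinear:
  "bounded_bilinear pr \<Longrightarrow> C1_on S g \<Longrightarrow> C1_on S h \<Longrightarrow> C1_on S (\<lambda>x. pr (g x) (h x))"
  unfolding C1_on_def by (elim exE) (intro exI, rule has_partials_bilinear)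

lemmas C1_on_inner = C1_on_bilinear[OF bounded_bilinear_inner]
lemmas C1_on_mult = C1_on_bilinear[OF bounded_bilinear_mult]
lemmas C1_on_scaleR = C1_on_bilinear[OF bounded_bilinear_scaleR]

text \<open>\<open>h\<close> is differentiated only within the image of \<open>g\<close>, so one
  rule serves both transition maps between half-plane domains and fields that have a pole.\<close>

lemma has_partials_compose:
  assumes g: "has_partials S g g1 g2"
    and h: "\<And>x. x \<in> S \<Longrightarrow> (h has_derivative h' (g x)) (at (g x) within g ` S)"
    and c: "continuous_on S (\<lambda>x. h' (g x) (g1 x))" "continuous_on S (\<lambda>x. h' (g x) (g2 x))"
  shows "has_partials S (\<lambda>x. h (g x)) (\<lambda>x. h' (g x) (g1 x)) (\<lambda>x. h' (g x) (g2 x))"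
proof (rule has_partialsI[OF c])
  fix x assume x: "x \<in> S"
  interpret bounded_linear "h' (g x)" using h[OF x] by (rule has_derivative_bounded_linear)
  show "((\<lambda>x. h (g x)) has_derivative
      (\<lambda>v. v $ 1 *\<^sub>R h' (g x) (g1 x) + v $ 2 *\<^sub>R h' (g x) (g2 x))) (at x within S)"
    by (rule has_derivative_eq_rhs[OF has_derivative_in_compose[OF has_partialsD(4)[OF g x] h[OF x]]])
      (simp add: add scaleR)
qed

lemma has_partials_chain:
  assumes g: "has_partials S g g1 g2" and h: "has_partials T h h1 h2" and sub: "g ` S \<subseteq> T"
  shows "has_partials S (\<lambda>x. h (g x)) (\<lambda>x. g1 x $ 1 *\<^sub>R h1 (g x) + g1 x $ 2 *\<^sub>R h2 (g x))
    (\<lambda>x. g2 x $ 1 *\<^sub>R h1 (g x) + g2 x $ 2 *\<^sub>R h2 (g x))"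
proof (rule has_partials_compose[OF g])
  fix x assume "x \<in> S"
  then show "(h has_derivative (\<lambda>v. v $ 1 *\<^sub>R h1 (g x) + v $ 2 *\<^sub>R h2 (g x))) (at (g x) within g ` S)"
    using has_partialsD(4)[OF h, of "g x"] sub by (auto intro: has_derivative_subset)
next
  have "continuous_on S (\<lambda>x. h1 (g x))" "continuous_on S (\<lambda>x. h2 (g x))"
    using continuous_on_compose2 has_partialsD(2,3)[OF h] has_partialsD(1)[OF g] sub by blast+
  then show "continuous_on S (\<lambda>x. g1 x $ 1 *\<^sub>R h1 (g x) + g1 x $ 2 *\<^sub>R h2 (g x))"
    "continuous_on S (\<lambda>x. g2 x $ 1 *\<^sub>R h1 (g x) + g2 x $ 2 *\<^sub>R h2 (g x))"
    by (intro continuous_intros has_partialsD(2,3)[OF g]; simp)+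
qed

lemma C1_on_chain: "C1_on S g \<Longrightarrow> C1_on T h \<Longrightarrow> g ` S \<subseteq> T \<Longrightarrow> C1_on S (\<lambda>x. h (g x))"
  unfolding C1_on_def by (elim exE) (intro exI, rule has_partials_chain)

lemma C1_on_compose_real:
  fixes h :: "real \<Rightarrow> real"
  assumes g: "C1_on S g" and h: "\<And>t. t \<in> T \<Longrightarrow> (h has_real_derivative h' t) (at t within T)"
    and c: "continuous_on T h'" and sub: "g ` S \<subseteq> T"
  shows "C1_on S (\<lambda>x. h (g x))"
proof -
  obtain g1 g2 where hp: "has_partials S g g1 g2" using g unfolding C1_on_def by (elim exE)
  have c': "continuous_on S (\<lambda>x. h' (g x))"
    using continuous_on_compose2 c has_partialsD(1)[OF hp] sub by blast
  have "has_partials S (\<lambda>x. h (g x)) (\<lambda>x. h' (g x) * g1 x) (\<lambda>x. h' (g x) * g2 x)"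
  proof (rule has_partials_compose[OF hp])
    fix x assume "x \<in> S"
    then show "(h has_derivative (*) (h' (g x))) (at (g x) within g ` S)"
      using h sub by (auto simp: has_field_derivative_def[symmetric] intro: DERIV_subset)
  qed (intro continuous_intros c' has_partialsD(2,3)[OF hp])+
  then show ?thesis by (rule C1_onI)
qed

lemma C1_on_inverse:
  fixes g :: "real^2 \<Rightarrow> real"
  assumes "C1_on S g" "\<And>x. x \<in> S \<Longrightarrow> g x \<noteq> 0"
  shows "C1_on S (\<lambda>x. inverse (g x))"
proof (rule C1_on_compose_real[OF assms(1)])
  show "(inverse has_real_derivative - (inverse t * inverse t)) (at t within - {0})" if "t \<in> - {0}" for t :: real
    using that by (auto intro!: derivative_eq_intros simp: power2_eq_square)
qed (use assms in \<open>auto intro!: continuous_intros\<close>)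

lemma C1_on_sqrt:
  assumes "C1_on S g" "\<And>x. x \<in> S \<Longrightarrow> g x > 0"
  shows "C1_on S (\<lambda>x. sqrt (g x))"
proof (rule C1_on_compose_real[OF assms(1)])
  show "(sqrt has_real_derivative inverse (sqrt t) / 2) (at t within {0<..})" if "t \<in> {0<..}" for t :: real
    using that by (auto intro!: derivative_eq_intros simp: field_simps)
qed (use assms in \<open>auto intro!: continuous_intros\<close>)

text \<open>A relatively open neighbourhood does not change the filter \<open>at x within S\<close>,
  so derivatives can be computed on it. This is how functions defined by cases, such as extensions
  by zero, are seen to be C^1.\<close>

lemma C1_on_local:
  fixes g :: "real^2 \<Rightarrow> 'b::euclidean_space"
  assumes S: "openin (top_of_set half_plane) S"
    and loc: "\<And>x. x \<in> S \<Longrightarrow> \<exists>W. openin (top_of_set half_plane) W \<and> x \<in> W \<and> W \<subseteq> S \<and> C1_on W g"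
  shows "C1_on S g"
proof -
  have hS: "S \<subseteq> half_plane" using S by (rule openin_imp_subset)
  have eq: "frechet_derivative g (at x within S) = frechet_derivative g (at x within W)"
    if "openin (top_of_set half_plane) W" "x \<in> W" "W \<subseteq> S" for x W
    using at_within_openin_subset[of half_plane W S x] that hS by simp
  have cont: "continuous_on S (partial S g i)" for i
    unfolding continuous_on_eq_continuous_within
  proof
    fix x assume x: "x \<in> S"
    then obtain W where W: "openin (top_of_set half_plane) W" "x \<in> W" "W \<subseteq> S" "C1_on W g"
      using loc by metis
    have "continuous_on W (partial W g i)"
      using C1_on_has_partials[OF W(4,1)] has_partialsD(2,3) exhaust_2[of i] by metis
    then have "continuous_on W (partial S g i)"
      by (rule continuous_on_eq) (simp add: partial_def eq[OF W(1) _ W(3)])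
    then have "continuous (at x within W) (partial S g i)"
      using W(2) by (simp add: continuous_on_eq_continuous_within)
    then show "continuous (at x within S) (partial S g i)"
      using at_within_openin_subset[of half_plane W S x] W hS by simp
  qed
  have "has_partials S g (partial S g 1) (partial S g 2)"
  proof (rule has_partialsI[OF cont cont])
    fix x assume x: "x \<in> S"
    then obtain W where W: "openin (top_of_set half_plane) W" "x \<in> W" "W \<subseteq> S" "C1_on W g"
      using loc by metis
    have "partial W g i x = partial S g i x" for i by (simp add: partial_def eq[OF W(1) _ W(3)] W(2))
    then show "(g has_derivative (\<lambda>v. v $ 1 *\<^sub>R partial S g 1 x + v $ 2 *\<^sub>R partial S g 2 x)) (at x within S)"
      using has_partialsD(4)[OF C1_on_has_partials[OF W(4,1)] W(2)]
        at_within_openin_subset[of half_plane W S x] W hS by simp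
  qed
  then show ?thesis by (rule C1_onI)
qed

subsection \<open>The divergence theorem on the half-plane\<close>

lemma content_real2:
  "measure lborel (cbox (vector [a, c]) (vector [b, d] :: real^2)) = measure lborel (cbox (a, c) (b, d :: real))"
proof -
  have ex2: "(\<exists>i::2. P i) \<longleftrightarrow> P 1 \<or> P 2" for P by (metis exhaust_2)
  have "measure lborel (cbox (vector [a, c]) (vector [b, d] :: real^2)) =
      (if a \<le> b \<and> c \<le> d then (b - a) * (d - c) else 0)"
    by (simp add: content_cbox_if_cart UNIV_2 interval_eq_empty_cart ex2 not_less)
  then show ?thesis by (simp add: content_Pair content_real_if)
qed

text \<open>The bijection between \<open>real^2\<close> and pairs preserves boxes and their
  contents, so the integral is carried over to the product, where it can be iterated.\<close>

lemma integral_real2: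
  fixes f :: "real^2 \<Rightarrow> real"
  assumes "continuous_on (cbox (vector [a, c]) (vector [b, d])) f"
  shows "integral (cbox (vector [a, c]) (vector [b, d])) f =
    integral {a..b} (\<lambda>s. integral {c..d} (\<lambda>t. f (vector [s, t])))"
proof -
  let ?g = "\<lambda>p. vector [fst p, snd p] :: real^2" and ?h = "\<lambda>x::real^2. (x $ 1, x $ 2)"
  have gbox: "?g ` cbox (u1, u2) (v1, v2) = cbox (vector [u1, u2]) (vector [v1, v2])" for u1 u2 v1 v2
  proof (intro set_eqI iffI)
    fix x :: "real^2" assume "x \<in> cbox (vector [u1, u2]) (vector [v1, v2])"
    then have "(x $ 1, x $ 2) \<in> cbox (u1, u2) (v1, v2)" by (auto simp: mem_box_cart forall_2 cbox_Pair_eq)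
    then show "x \<in> ?g ` cbox (u1, u2) (v1, v2)" by (rule image_eqI[rotated]) (simp add: vector_2_collapse)
  qed (auto simp: mem_box_cart forall_2 cbox_Pair_eq)
  have hbox: "?h ` cbox u v = cbox (?h u) (?h v)" for u v
  proof -
    have "?h ` cbox u v = ?h ` ?g ` cbox (?h u) (?h v)" by (simp add: gbox vector_2_collapse)
    then show ?thesis by (simp add: image_image)
  qed
  have "continuous_on UNIV ?g" by (intro continuous_on_vector2 continuous_intros)
  then have contg: "continuous (at x) ?g" for x
    using continuous_on_eq_continuous_at[OF open_UNIV] by blast
  have "((\<lambda>x. f (?g x)) has_integral (1 / 1) *\<^sub>R integral (cbox (vector [a, c]) (vector [b, d])) f)
      (?h ` cbox (vector [a, c]) (vector [b, d]))"
  proof (rule has_integral_twiddle)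
    show "\<exists>w z. ?g ` cbox u v = cbox w z" for u v
      using gbox[of "fst u" "snd u" "fst v" "snd v"] by auto
    show "\<exists>w z. ?h ` cbox u v = cbox w z" for u v using hbox by blast
    show "measure lborel (?g ` cbox u v) = 1 * measure lborel (cbox u v)" for u v
      using gbox[of "fst u" "snd u" "fst v" "snd v"] content_real2 by auto
    show "(f has_integral integral (cbox (vector [a, c]) (vector [b, d])) f) (cbox (vector [a, c]) (vector [b, d]))"
      using integrable_continuous[OF assms] by blast
  qed (auto simp: contg vector_2_collapse)
  then have "integral (cbox (vector [a, c]) (vector [b, d])) f = integral (cbox (a, c) (b, d)) (\<lambda>x. f (?g x))"
    by (simp add: hbox integral_unique)
  also have "\<dots> = integral (cbox a b) (\<lambda>s. integral (cbox c d) (\<lambda>t. f (?g (s, t))))"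
  proof (rule integral_prod_continuous)
    have "continuous_on (cbox (a, c) (b, d)) ?g" using contg continuous_at_imp_continuous_on by blast
    then show "continuous_on (cbox (a, c) (b, d)) (\<lambda>x. f (?g x))"
      by (rule continuous_on_compose2[OF assms]) (simp add: gbox)
  qed
  finally show ?thesis by simp
qed

lemma half_plane_partials_vanish:
  assumes V: "has_partials half_plane V V1 V2" and K: "closed K"
    and supp: "\<And>x. x \<in> half_plane \<Longrightarrow> x \<notin> K \<Longrightarrow> V x = 0"
    and x: "x \<in> half_plane" "x \<notin> K"
  shows "V1 x = 0" "V2 x = 0"
proof -
  have o: "openin (top_of_set half_plane) (half_plane \<inter> (- K))" using K by (intro openin_open_Int open_Compl)
  have V': "has_partials (half_plane \<inter> (- K)) V V1 V2" using has_partials_subset[OF V] by blast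
  have "has_partials (half_plane \<inter> (- K)) V (\<lambda>x. 0) (\<lambda>x. 0)"
    by (rule has_partials_cong[OF has_partials_const]) (use supp in auto)
  then show "V1 x = 0" "V2 x = 0"
    using has_partials_unique[OF o _ V'] x by auto
qed

lemma half_plane_integral_bounded:
  fixes g :: "real^2 \<Rightarrow> real"
  assumes g: "continuous_on half_plane g" and R: "R > 0" "K \<subseteq> box (vector [-R, -R]) (vector [R, R])"
    and supp: "\<And>x. x \<in> half_plane \<Longrightarrow> x \<notin> K \<Longrightarrow> g x = 0"
  shows "integral half_plane g = integral {-R..R} (\<lambda>s. integral {0..R} (\<lambda>t. g (vector [s, t])))"
    "g absolutely_integrable_on half_plane"
proof -
  let ?B = "cbox (vector [-R, 0]) (vector [R, R]) :: (real^2) set"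
  have sub: "?B \<subseteq> half_plane" by (auto simp: half_plane_def mem_box_cart forall_2)
  have zero: "g x = 0" if "x \<in> half_plane" "x \<notin> ?B" for x
  proof -
    have "x \<notin> box (vector [-R, -R]) (vector [R, R])"
      using that by (auto simp: half_plane_def mem_box_cart forall_2)
    then show ?thesis using supp that R by auto
  qed
  have eq: "(\<lambda>x. if x \<in> half_plane then g x else 0) = (\<lambda>x. if x \<in> ?B then g x else 0)"
  proof
    fix x show "(if x \<in> half_plane then g x else 0) = (if x \<in> ?B then g x else 0)"
      using zero[of x] subsetD[OF sub, of x] by presburger
  qed
  have "integral half_plane g = integral ?B g"
    using eq integral_restrict_UNIV[of half_plane g] integral_restrict_UNIV[of ?B g] by metis
  also have "\<dots> = integral {-R..R} (\<lambda>s. integral {0..R} (\<lambda>t. g (vector [s, t])))"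
    using integral_real2 continuous_on_subset[OF g sub] by blast
  finally show "integral half_plane g = integral {-R..R} (\<lambda>s. integral {0..R} (\<lambda>t. g (vector [s, t])))" .
  have "g absolutely_integrable_on ?B"
    by (intro absolutely_integrable_continuous continuous_on_subset[OF g sub])
  then show "g absolutely_integrable_on half_plane"
    using eq absolutely_integrable_restrict_UNIV[of half_plane g] absolutely_integrable_restrict_UNIV[of ?B g] by metis
qed

text \<open>On a rectangle around the support only the bottom side can carry nonzero values of
  \<open>V\<close>; its outward normal is minus the second axis, whence the sign.\<close>

lemma half_plane_divergence:
  fixes V :: "real^2 \<Rightarrow> real"
  assumes V: "has_partials half_plane V V1 V2" and K: "compact K"
    and supp: "\<And>x. x \<in> half_plane \<Longrightarrow> x \<notin> K \<Longrightarrow> V x = 0"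
  shows "V1 absolutely_integrable_on half_plane" "V2 absolutely_integrable_on half_plane"
    "integral half_plane V1 = 0" "integral half_plane V2 = - integral UNIV (\<lambda>t. V (vector [t, 0]))"
proof -
  obtain M where M: "\<And>x. x \<in> K \<Longrightarrow> norm x \<le> M" using compact_imp_bounded[OF K] bounded_iff by metis
  \<comment> \<open>Adding 1 puts \<open>K\<close> inside the open box, so \<open>V\<close> vanishes
    on the vertical and upper sides of the closed rectangle as well.\<close>
  define R where "R = \<bar>M\<bar> + 1"
  have R: "R > 0" by (simp add: R_def)
  have KR: "K \<subseteq> box (vector [-R, -R]) (vector [R, R])"
  proof
    fix x assume "x \<in> K"
    then have "\<bar>x $ 1\<bar> < R" "\<bar>x $ 2\<bar> < R"
      using M[of x] component_le_norm_cart[of x 1] component_le_norm_cart[of x 2] by (auto simp: R_def)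
    then show "x \<in> box (vector [-R, -R]) (vector [R, R])" by (auto simp: mem_box_cart forall_2)
  qed
  note van = half_plane_partials_vanish[OF V compact_imp_closed[OF K] supp]
  note int1 = half_plane_integral_bounded[OF has_partialsD(2)[OF V] R KR van(1)]
  note int2 = half_plane_integral_bounded[OF has_partialsD(3)[OF V] R KR van(2)]
  show "V1 absolutely_integrable_on half_plane" "V2 absolutely_integrable_on half_plane"
    using int1(2) int2(2) by blast+
  have line: "((\<lambda>t. V (vector [s, t])) has_vector_derivative V2 (vector [s, t])) (at t within {0..})"
    if "t \<ge> 0" for s t
  proof -
    let ?l = "\<lambda>t::real. vector [s, t] :: real^2"
    have dl: "(?l has_derivative (\<lambda>u. vector [0, u])) (at t within {0..})"
      by (intro has_derivative_vector2 has_derivative_const has_derivative_ident)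
    show ?thesis unfolding has_vector_derivative_def
      by (rule has_derivative_eq_rhs[OF has_derivative_in_compose2[OF has_partialsD(4)[OF V] _ _ dl]])
        (use that in \<open>auto simp: half_plane_def\<close>)
  qed
  have line1: "((\<lambda>s. V (vector [s, t])) has_vector_derivative V1 (vector [s, t])) (at s)"
    if "t \<ge> 0" for s t
  proof -
    let ?l = "\<lambda>s::real. vector [s, t] :: real^2"
    have dl: "(?l has_derivative (\<lambda>u. vector [u, 0])) (at s)"
      by (intro has_derivative_vector2 has_derivative_const has_derivative_ident)
    show ?thesis unfolding has_vector_derivative_def
      by (rule has_derivative_eq_rhs[OF has_derivative_in_compose2[OF has_partialsD(4)[OF V] _ _ dl]])
        (use that in \<open>auto simp: half_plane_def\<close>)
  qed
  have edge: "V (vector [s, t]) = 0" if "t \<ge> 0" "\<bar>s\<bar> \<ge> R \<or> t \<ge> R" for s t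
  proof (rule supp)
    show "vector [s, t] \<in> half_plane" using that by (simp add: half_plane_def)
    have "vector [s, t] \<notin> box (vector [-R, -R]) (vector [R, R] :: real^2)"
      using that by (auto simp: mem_box_cart forall_2)
    then show "vector [s, t] \<notin> K" using KR by blast
  qed
  have "integral {0..R} (\<lambda>t. V2 (vector [s, t])) = - V (vector [s, 0])" for s
  proof -
    have "((\<lambda>t. V2 (vector [s, t])) has_integral V (vector [s, R]) - V (vector [s, 0])) {0..R}"
      using R by (intro fundamental_theorem_of_calculus)
        (auto intro: has_vector_derivative_within_subset[OF line])
    then show ?thesis using edge[of R s] R by (simp add: integral_unique)
  qed
  then have "integral half_plane V2 = - integral {-R..R} (\<lambda>s. V (vector [s, 0]))"
    using int2(1) by simp
  also have "integral {-R..R} (\<lambda>s. V (vector [s, 0])) = integral UNIV (\<lambda>s. V (vector [s, 0]))"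
  proof -
    have "(\<lambda>s. if s \<in> {-R..R} then V (vector [s, 0]) else 0) = (\<lambda>s. V (vector [s, 0]))"
    proof
      fix s show "(if s \<in> {-R..R} then V (vector [s, 0]) else 0) = V (vector [s, 0])"
      proof (cases "s \<in> {-R..R}")
        case False
        then have "R \<le> \<bar>s\<bar>" by auto
        then show ?thesis using edge[of 0 s] by simp
      qed simp
    qed
    then show ?thesis using integral_restrict_UNIV[of "{-R..R}" "\<lambda>s. V (vector [s, 0])"] by simp
  qed
  finally show "integral half_plane V2 = - integral UNIV (\<lambda>t. V (vector [t, 0]))" .
  let ?Q = "cbox (vector [-R, 0]) (vector [R, R]) :: (real^2) set"
  have "integral half_plane V1 = integral {-R..R} (\<lambda>s. integral {0..R} (\<lambda>t. V1 (vector [s, t])))"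
    using int1(1) by blast
  \<comment> \<open>Exchanging the integrals puts the integration along the first axis inside, where
    the fundamental theorem applies.\<close>
  also have "\<dots> = integral {0..R} (\<lambda>t. integral {-R..R} (\<lambda>s. V1 (vector [s, t])))"
  proof -
    have "continuous_on (cbox (-R, 0) (R, R)) (\<lambda>(s, t). V1 (vector [s, t]))"
      unfolding split_beta
    proof (rule continuous_on_compose2[OF has_partialsD(2)[OF V]])
      show "continuous_on (cbox (-R, 0) (R, R)) (\<lambda>p. vector [fst p, snd p] :: real^2)"
        by (intro continuous_on_vector2 continuous_intros)
    qed (auto simp: half_plane_def cbox_Pair_eq)
    then show ?thesis using integral_swap_continuous[of "-R" 0 R R "\<lambda>s t. V1 (vector [s, t])"] by simp
  qed
  also have "\<dots> = integral {0..R} (\<lambda>t. 0)"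
  proof (rule integral_cong)
    fix t assume "t \<in> {0..R}"
    then have t: "t \<ge> 0" by simp
    have "((\<lambda>s. V1 (vector [s, t])) has_integral V (vector [R, t]) - V (vector [-R, t])) {-R..R}"
      using R by (intro fundamental_theorem_of_calculus)
        (auto intro: has_vector_derivative_at_within[OF line1[OF t]])
    then show "integral {-R..R} (\<lambda>s. V1 (vector [s, t])) = 0"
      using edge[OF t, of R] edge[OF t, of "-R"] R by (simp add: integral_unique)
  qed
  finally show "integral half_plane V1 = 0" by simp
qed

subsection \<open>Symmetry of second derivatives\<close>

text \<open>Two applications of the mean value theorem to the second difference over a square of
  side \<open>e\<close>: along the first axis for \<open>h\<close>, then along the second for
  \<open>h1\<close>. The bound on \<open>2 * e\<close> keeps the square inside the ball, because the
  norm is at most the sum of the coordinates.\<close>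

lemma mixed_difference_mvt:
  fixes h :: "real^2 \<Rightarrow> real"
  assumes h: "\<And>y. y \<in> ball x r \<Longrightarrow> (h has_derivative (\<lambda>v. v $ 1 * h1 y + v $ 2 * h2 y)) (at y)"
    and h1: "\<And>y. y \<in> ball x r \<Longrightarrow> (h1 has_derivative (\<lambda>v. v $ 1 * h11 y + v $ 2 * h12 y)) (at y)"
    and e: "0 < e" "2 * e < r"
  obtains s t where "0 < s" "s < e" "0 < t" "t < e"
    "h (x + vector [e, e]) - h (x + vector [e, 0]) - h (x + vector [0, e]) + h x = e * e * h12 (x + vector [s, t])"
proof -
  have inb: "x + vector [s, t] \<in> ball x r" if "0 \<le> s" "s \<le> e" "0 \<le> t" "t \<le> e" for s t
  proof -
    have "norm (vector [s, t] :: real^2) \<le> \<bar>s\<bar> + \<bar>t\<bar>"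
      using norm_le_l1_cart[of "vector [s, t] :: real^2"] by (simp add: sum_2)
    then show ?thesis using that e by (simp add: dist_norm)
  qed
  have l1: "((\<lambda>s. vector [s, t] :: real^2) has_derivative (\<lambda>u. vector [u, 0])) (at s)" for s t
    by (intro has_derivative_vector2 has_derivative_const has_derivative_ident)
  have l2: "((\<lambda>t. vector [s, t] :: real^2) has_derivative (\<lambda>u. vector [0, u])) (at t)" for s t
    by (intro has_derivative_vector2 has_derivative_const has_derivative_ident)
  let ?k = "\<lambda>s. h (x + vector [s, e]) - h (x + vector [s, 0])"
  have d: "((\<lambda>s. h (x + vector [s, t])) has_real_derivative h1 (x + vector [s, t])) (at s)"
    if "0 \<le> s" "s \<le> e" "0 \<le> t" "t \<le> e" for s t
    unfolding has_field_derivative_def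
    by (rule has_derivative_eq_rhs[OF has_derivative_compose[OF has_derivative_add[OF has_derivative_const l1] h[OF inb[OF that]]]])
      (auto simp: mult.commute)
  have "\<exists>s>0. s < e \<and> ?k e - ?k 0 = (e - 0) * (h1 (x + vector [s, e]) - h1 (x + vector [s, 0]))"
    using e by (intro MVT2) (auto intro!: DERIV_diff d)
  then obtain s where s: "0 < s" "s < e"
    "?k e - ?k 0 = e * (h1 (x + vector [s, e]) - h1 (x + vector [s, 0]))" by auto
  have d2: "((\<lambda>t. h1 (x + vector [s, t])) has_real_derivative h12 (x + vector [s, t])) (at t)"
    if "0 \<le> t" "t \<le> e" for t
    unfolding has_field_derivative_def
    by (rule has_derivative_eq_rhs[OF has_derivative_compose[OF has_derivative_add[OF has_derivative_const l2] h1[OF inb]]])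
      (use s that in \<open>auto simp: mult.commute\<close>)
  have "\<exists>t>0. t < e \<and> h1 (x + vector [s, e]) - h1 (x + vector [s, 0]) = (e - 0) * h12 (x + vector [s, t])"
    using e by (intro MVT2) (auto intro!: d2)
  then obtain t where t: "0 < t" "t < e"
    "h1 (x + vector [s, e]) - h1 (x + vector [s, 0]) = e * h12 (x + vector [s, t])" by auto
  have "vector [0, 0] = (0 :: real^2)" by (simp add: vec_eq_iff forall_2)
  then have "h (x + vector [e, e]) - h (x + vector [e, 0]) - h (x + vector [0, e]) + h x = e * e * h12 (x + vector [s, t])"
    using s(3) t(3) by (simp add: algebra_simps)
  then show thesis using that s t by blast
qed

text \<open>Exchanging the coordinates lets the same mean value lemma handle the opposite order of
  differentiation.\<close>

definition swap2 :: "real^2 \<Rightarrow> real^2" where "swap2 v = vector [v $ 2, v $ 1]"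

text \<open>The second difference over a square is symmetric in the axes. It is therefore the area
  of the square times a value of \<open>h12\<close>, and also times a value of \<open>h21\<close>,
  both at points that tend to \<open>x\<close>.\<close>

lemma symmetric_second_partials_real:
  fixes h :: "real^2 \<Rightarrow> real"
  assumes T: "open T" "x \<in> T"
    and h: "has_partials T h h1 h2" and h1: "has_partials T h1 h11 h12" and h2: "has_partials T h2 h21 h22"
  shows "h12 x = h21 x"
proof -
  obtain r where r: "r > 0" "ball x r \<subseteq> T" using T openE by metis
  have D: "(g has_derivative (\<lambda>v. v $ 1 * g1 y + v $ 2 * g2 y)) (at y)"
    if "has_partials T g g1 g2" "y \<in> ball x r" for g g1 g2 :: "real^2 \<Rightarrow> real" and y
    using has_partialsD(4)[OF that(1), of y] at_within_open[OF _ T(1)] r that(2) by auto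
  \<comment> \<open>Division by 4 keeps twice the side at most r / 2, hence strictly below
    r.\<close>
  let ?e = "\<lambda>n::nat. r / 4 / Suc n"
  have e: "0 < ?e n" "2 * ?e n < r" for n
  proof -
    show "0 < ?e n" using r by simp
    have "?e n \<le> r / 4" using r by (simp add: field_simps)
    then show "2 * ?e n < r" using r by linarith
  qed
  have small: "(\<lambda>n. x + vector [s n, t n]) \<longlonglongrightarrow> x"
    if "\<And>n. 0 < s n \<and> s n < ?e n \<and> 0 < t n \<and> t n < ?e n" for s t
  proof -
    have e0: "?e \<longlonglongrightarrow> 0"
      by (rule LIMSEQ_Suc[OF lim_const_over_n])
    have "s \<longlonglongrightarrow> 0" "t \<longlonglongrightarrow> 0"
      by (rule tendsto_sandwich[OF _ _ tendsto_const e0]; use that in \<open>auto intro!: eventuallyI less_imp_le\<close>)+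
    then have "(\<lambda>n. x + (s n *\<^sub>R axis 1 1 + t n *\<^sub>R axis 2 1)) \<longlonglongrightarrow> x + (0 *\<^sub>R axis 1 1 + 0 *\<^sub>R axis 2 1)"
      by (intro tendsto_intros)
    then show ?thesis by (simp add: vector2_axis)
  qed
  have lim: "(\<lambda>n. g (x + vector [s n, t n])) \<longlonglongrightarrow> g x"
    if "continuous_on T g" "\<And>n. 0 < s n \<and> s n < ?e n \<and> 0 < t n \<and> t n < ?e n" for s t and g :: "real^2 \<Rightarrow> real"
    by (rule continuous_on_tendsto_compose[OF that(1) small[OF that(2)] T(2)])
      (rule topological_tendstoD[OF small[OF that(2)] T])
  have "\<exists>s t. 0 < s \<and> s < ?e n \<and> 0 < t \<and> t < ?e n \<and>
    h (x + vector [?e n, ?e n]) - h (x + vector [?e n, 0]) - h (x + vector [0, ?e n]) + h x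
      = ?e n * ?e n * h12 (x + vector [s, t])" for n
    using mixed_difference_mvt[OF D[OF h] D[OF h1] e(1,2)[of n]] by metis
  then obtain s t where st: "\<And>n. 0 < s n \<and> s n < ?e n \<and> 0 < t n \<and> t n < ?e n"
    "\<And>n. h (x + vector [?e n, ?e n]) - h (x + vector [?e n, 0]) - h (x + vector [0, ?e n]) + h x
      = ?e n * ?e n * h12 (x + vector [s n, t n])" by metis
  have sw: "bounded_linear swap2" "swap2 (swap2 v) = v" "norm (swap2 v) = norm v" "swap2 (vector [a, b]) = vector [b, a]"
     "swap2 (u + v) = swap2 u + swap2 v" for u v a b
    by (auto simp: swap2_def linear_conv_bounded_linear[symmetric] vec_eq_iff forall_2 norm_vec_def L2_set_def sum_2 add.commute intro!: linearI)
  have Dsw: "((\<lambda>y. g (swap2 y)) has_derivative (\<lambda>v. v $ 1 * g2 (swap2 y) + v $ 2 * g1 (swap2 y))) (at y)"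
    if "has_partials T g g1 g2" "y \<in> ball (swap2 x) r" for g g1 g2 :: "real^2 \<Rightarrow> real" and y
  proof -
    have "norm (x - swap2 y) = norm (swap2 (swap2 x - y))"
      using sw(1,2) by (simp add: linear_diff bounded_linear.linear)
    then have "swap2 y \<in> ball x r" using that(2) by (simp add: dist_norm sw)
    from has_derivative_compose[OF bounded_linear_imp_has_derivative[OF sw(1)] D[OF that(1) this]]
    show ?thesis by (rule has_derivative_eq_rhs) (auto simp: swap2_def)
  qed
  have "\<exists>s t. 0 < s \<and> s < ?e n \<and> 0 < t \<and> t < ?e n \<and>
    h (x + vector [?e n, ?e n]) - h (x + vector [0, ?e n]) - h (x + vector [?e n, 0]) + h x
      = ?e n * ?e n * h21 (x + vector [t, s])" for n
  proof -
    obtain s t where st: "0 < s" "s < ?e n" "0 < t" "t < ?e n"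
      "h (swap2 (swap2 x + vector [?e n, ?e n])) - h (swap2 (swap2 x + vector [?e n, 0]))
        - h (swap2 (swap2 x + vector [0, ?e n])) + h (swap2 (swap2 x))
        = ?e n * ?e n * h21 (swap2 (swap2 x + vector [s, t]))"
      by (rule mixed_difference_mvt[OF Dsw[OF h] Dsw[OF h2] e(1,2)[of n]])
    then show ?thesis unfolding sw(2,4,5) by blast
  qed
  then obtain s' t' where st': "\<And>n. 0 < s' n \<and> s' n < ?e n \<and> 0 < t' n \<and> t' n < ?e n"
    "\<And>n. h (x + vector [?e n, ?e n]) - h (x + vector [0, ?e n]) - h (x + vector [?e n, 0]) + h x
      = ?e n * ?e n * h21 (x + vector [t' n, s' n])" by metis
  have eq: "h12 (x + vector [s n, t n]) = h21 (x + vector [t' n, s' n])" for n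
  proof -
    have "?e n * ?e n * h12 (x + vector [s n, t n]) = ?e n * ?e n * h21 (x + vector [t' n, s' n])"
      using st(2)[of n] st'(2)[of n] by linarith
    then show ?thesis using e(1)[of n] by (metis less_irrefl mult_left_cancel mult_pos_pos)
  qed
  have "(\<lambda>n. h12 (x + vector [s n, t n])) \<longlonglongrightarrow> h12 x"
    by (rule lim[OF has_partialsD(3)[OF h1] st(1)])
  moreover have "(\<lambda>n. h21 (x + vector [t' n, s' n])) \<longlonglongrightarrow> h21 x"
    by (rule lim[OF has_partialsD(2)[OF h2]]) (use st' in blast)
  ultimately show ?thesis using eq LIMSEQ_unique by simp
qed

lemma symmetric_second_partials:
  fixes h :: "real^2 \<Rightarrow> 'b::euclidean_space"
  assumes T: "open T" "x \<in> T"
    and h: "has_partials T h h1 h2" and h1: "has_partials T h1 h11 h12" and h2: "has_partials T h2 h21 h22"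
  shows "h12 x = h21 x"
proof (rule euclidean_eqI)
  fix b :: 'b
  have *: "has_partials T (\<lambda>x. g x \<bullet> b) (\<lambda>x. g1 x \<bullet> b) (\<lambda>x. g2 x \<bullet> b)" if "has_partials T g g1 g2" for g g1 g2
    using has_partials_inner[OF that has_partials_const[of T b]] by simp
  show "h12 x \<bullet> b = h21 x \<bullet> b"
    using symmetric_second_partials_real[OF T *[OF h] *[OF h1] *[OF h2]] .
qed

section \<open>Densities on a compact surface\<close>

locale compact_surface =
  fixes M :: "'m::t2_space set" and A :: "'m chart set"
  assumes surface: "smooth_surface M A" and compact_M: "compact M"
begin

lemma chart:
  assumes "c \<in> A"
  shows chart_dom_open: "openin (top_of_set M) (dom_of c)"
    and chart_cod_open: "openin (top_of_set half_plane) (cod_of c)"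
    and chart_homeo: "homeomorphism (dom_of c) (cod_of c) (coord c) (coord_inv c)"
  using surface assms by (auto simp: smooth_surface_def chart_on_def)

lemma chart_cover: "(\<Union>c\<in>A. dom_of c) = M"
  using surface by (simp add: smooth_surface_def)

lemma chart_inverse:
  assumes "c \<in> A"
  shows "p \<in> dom_of c \<Longrightarrow> coord_inv c (coord c p) = p"
    and "x \<in> cod_of c \<Longrightarrow> coord c (coord_inv c x) = x"
    and "x \<in> cod_of c \<Longrightarrow> coord_inv c x \<in> dom_of c"
    and "inj_on (coord c) (dom_of c)"
    and "continuous_on (dom_of c) (coord c)" and "continuous_on (cod_of c) (coord_inv c)"
  using chart_homeo[OF assms] by (auto simp: homeomorphism_def inj_on_def) metis

lemma overlap_open:
  assumes "c \<in> A" "d \<in> A"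
  shows "openin (top_of_set half_plane) (coord c ` (dom_of c \<inter> dom_of d))"
proof -
  have "openin (top_of_set M) (dom_of c \<inter> dom_of d)" using assms by (intro openin_Int chart_dom_open)
  then have "openin (top_of_set (dom_of c)) (dom_of c \<inter> dom_of d)"
    using openin_subset_trans[of M "dom_of c \<inter> dom_of d" "dom_of c"] chart_dom_open[OF assms(1)]
    by (auto dest: openin_imp_subset)
  then have "openin (top_of_set (cod_of c)) (coord c ` (dom_of c \<inter> dom_of d))"
    by (rule homeomorphism_imp_open_map[OF chart_homeo[OF assms(1)]])
  then show ?thesis using chart_cod_open[OF assms(1)] openin_trans by blast
qed

lemma transition_continuous:
  assumes "c \<in> A" "d \<in> A"
  shows "continuous_on (coord c ` (dom_of c \<inter> dom_of d)) (\<lambda>x. coord d (coord_inv c x))"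
proof (rule continuous_on_compose2[OF chart_inverse(5)[OF assms(2)]])
  show "continuous_on (coord c ` (dom_of c \<inter> dom_of d)) (coord_inv c)"
    by (rule continuous_on_subset[OF chart_inverse(6)[OF assms(1)]]) auto
  show "coord_inv c ` coord c ` (dom_of c \<inter> dom_of d) \<subseteq> dom_of d"
    using chart_inverse(1)[OF assms(1)] by auto
qed

text \<open>The coordinate image in \<open>d\<close> is the preimage of the one in \<open>c\<close>
  under the continuous transition from \<open>d\<close> to \<open>c\<close>, and preimages of Borel
  sets are Borel.\<close>

lemma borel_transfer:
  assumes cd: "c \<in> A" "d \<in> A" and E: "E \<subseteq> dom_of c \<inter> dom_of d" and B: "coord c ` E \<in> sets borel"
  shows "coord d ` E \<in> sets borel"
proof -
  let ?O = "coord d ` (dom_of d \<inter> dom_of c)" and ?t = "\<lambda>x. coord c (coord_inv d x)"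
  have O: "?O \<in> sets borel" by (rule borel_openin_half_plane[OF overlap_open[OF cd(2,1)]])
  have "?t \<in> borel_measurable (restrict_space borel ?O)"
    by (rule borel_measurable_continuous_on_restrict[OF transition_continuous[OF cd(2,1)]])
  from measurable_sets[OF this B] have "?t -` (coord c ` E) \<inter> ?O \<in> sets (restrict_space borel ?O)"
    by (simp add: space_restrict_space)
  then have "?t -` (coord c ` E) \<inter> ?O \<in> sets borel"
    using O by (subst (asm) sets_restrict_space_iff) auto
  moreover have "?t -` (coord c ` E) \<inter> ?O = coord d ` E"
  proof (intro set_eqI iffI)
    fix y assume "y \<in> ?t -` (coord c ` E) \<inter> ?O"
    then obtain p q where p: "p \<in> dom_of d" "p \<in> dom_of c" "y = coord d p" "q \<in> E" "?t y = coord c q"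
      by auto
    then have "coord c p = coord c q" using chart_inverse(1)[OF cd(2)] by simp
    then have "p = q" using p E chart_inverse(1)[OF cd(1)] by (metis IntD1 subsetD)
    then show "y \<in> coord d ` E" using p by simp
  next
    fix y assume "y \<in> coord d ` E"
    then show "y \<in> ?t -` (coord c ` E) \<inter> ?O" using E chart_inverse(1)[OF cd(2)] by auto
  qed
  ultimately show ?thesis by simp
qed

text \<open>Each of the two sets is known to be Borel in its own chart only, so the part of
  \<open>E'\<close> inside the domain of \<open>c\<close> is transferred before
  intersecting.\<close>

lemma borel_chart_Int:
  assumes cd: "c \<in> A" "d \<in> A" and E: "E \<subseteq> dom_of c" "coord c ` E \<in> sets borel"
    and E': "E' \<subseteq> dom_of d" "coord d ` E' \<in> sets borel"
  shows "coord c ` (E \<inter> E') \<in> sets borel"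
proof -
  have "coord d ` (E' \<inter> dom_of c) = coord d ` E' \<inter> coord d ` (dom_of d \<inter> dom_of c)"
    using E'(1) inj_on_image_Int[OF chart_inverse(4)[OF cd(2)], of E' "dom_of d \<inter> dom_of c"]
    by (metis Int_assoc Int_lower1 inf.absorb1)
  then have "coord d ` (E' \<inter> dom_of c) \<in> sets borel"
    using E'(2) borel_openin_half_plane[OF overlap_open[OF cd(2,1)]] by simp
  then have "coord c ` (E' \<inter> dom_of c) \<in> sets borel"
    using borel_transfer[OF cd(2,1), of "E' \<inter> dom_of c"] E'(1) by auto
  moreover have "coord c ` (E \<inter> (E' \<inter> dom_of c)) = coord c ` E \<inter> coord c ` (E' \<inter> dom_of c)"
    using E(1) by (intro inj_on_image_Int[OF chart_inverse(4)[OF cd(1)]]) auto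
  moreover have "E \<inter> (E' \<inter> dom_of c) = E \<inter> E'" using E(1) by blast
  ultimately show ?thesis using E(2) by simp
qed

section \<open>Coordinate discs and finite covers\<close>

definition chart_ball :: "'m chart \<times> (real^2) \<times> real \<Rightarrow> 'm set" where
  "chart_ball = (\<lambda>(c, x, r). coord_inv c ` (ball x r \<inter> half_plane))"

definition chart_cball :: "'m chart \<times> (real^2) \<times> real \<Rightarrow> 'm set" where
  "chart_cball = (\<lambda>(c, x, r). coord_inv c ` (cball x r \<inter> half_plane))"

text \<open>The closed disc, not only the open one, has to fit into the chart: its preimage is then
  a compact set that can carry the support of a bump function. Near the boundary line the disc is
  cut off by the half-plane.\<close>

definition good_ball :: "'m chart \<times> (real^2) \<times> real \<Rightarrow> bool" where
  "good_ball = (\<lambda>(c, x, r). c \<in> A \<and> r > 0 \<and> cball x r \<inter> half_plane \<subseteq> cod_of c)"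

lemma good_ballD:
  assumes "good_ball (c, x, r)"
  shows "c \<in> A" "r > 0" "cball x r \<inter> half_plane \<subseteq> cod_of c"
  using assms by (auto simp: good_ball_def)

lemma compact_chart_cball:
  assumes "good_ball (c, x, r)"
  shows "compact (chart_cball (c, x, r))" "chart_cball (c, x, r) \<subseteq> dom_of c"
    "chart_ball (c, x, r) \<subseteq> chart_cball (c, x, r)"
proof -
  note g = good_ballD[OF assms]
  have "continuous_on (cball x r \<inter> half_plane) (coord_inv c)"
    using chart_inverse(6)[OF g(1)] g(3) by (rule continuous_on_subset)
  moreover have "compact (cball x r \<inter> half_plane)"
    by (intro compact_Int_closed closed_half_plane compact_cball)
  ultimately show "compact (chart_cball (c, x, r))"
    unfolding chart_cball_def by (simp add: compact_continuous_image)
  show "chart_cball (c, x, r) \<subseteq> dom_of c"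
    using chart_inverse(3)[OF g(1)] g(3) by (auto simp: chart_cball_def)
  show "chart_ball (c, x, r) \<subseteq> chart_cball (c, x, r)"
    by (auto simp: chart_ball_def chart_cball_def)
qed

lemma open_chart_ball:
  assumes "good_ball (c, x, r)"
  shows "openin (top_of_set M) (chart_ball (c, x, r))"
proof -
  note g = good_ballD[OF assms]
  have "ball x r \<inter> half_plane = cod_of c \<inter> ball x r"
    using g(3) chart_cod_open[OF g(1)] by (auto dest: openin_imp_subset)
  then have "openin (top_of_set (cod_of c)) (ball x r \<inter> half_plane)" by (simp add: openin_open_Int)
  then have "openin (top_of_set (dom_of c)) (chart_ball (c, x, r))"
    using homeomorphism_imp_open_map[OF homeomorphism_symD[OF chart_homeo[OF g(1)]]]
    by (simp add: chart_ball_def)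
  then show ?thesis using chart_dom_open[OF g(1)] openin_trans by blast
qed

lemma finite_good_cover:
  obtains I where "finite I" "\<And>i. i \<in> I \<Longrightarrow> good_ball i" "M = (\<Union>i\<in>I. chart_ball i)"
proof -
  have sub: "chart_ball i \<subseteq> M" if "good_ball i" for i
    using that open_chart_ball openin_imp_subset by (metis prod_cases3)
  have "\<exists>i. good_ball i \<and> p \<in> chart_ball i" if p: "p \<in> M" for p
  proof -
    obtain c where c: "c \<in> A" "p \<in> dom_of c" using p chart_cover by auto
    obtain G where G: "open G" "cod_of c = half_plane \<inter> G"
      using chart_cod_open[OF c(1)] by (auto simp: openin_open)
    have "coord c p \<in> half_plane \<inter> G" using c G by auto
    then obtain r where r: "r > 0" "cball (coord c p) r \<subseteq> G" using G(1) open_contains_cball by blast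
    then have "good_ball (c, coord c p, r)" using c G by (auto simp: good_ball_def)
    moreover have "p \<in> chart_ball (c, coord c p, r)"
      using r \<open>coord c p \<in> half_plane \<inter> G\<close> chart_inverse(1)[OF c]
      by (auto simp: chart_ball_def intro!: image_eqI[of p _ "coord c p"])
    ultimately show ?thesis by blast
  qed
  then have "M \<subseteq> \<Union> (chart_ball ` Collect good_ball)" by blast
  moreover have "\<forall>U\<in>chart_ball ` Collect good_ball. openin (top_of_set M) U"
    using open_chart_ball by auto
  ultimately obtain F where F: "F \<subseteq> chart_ball ` Collect good_ball" "finite F" "M \<subseteq> \<Union> F"
    using compact_M unfolding compact_eq_openin_cover by meson
  then obtain I where I: "I \<subseteq> Collect good_ball" "finite I" "F = chart_ball ` I"
    using finite_subset_image by metis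
  show thesis
  proof (rule that[OF I(2)])
    show "M = (\<Union>i\<in>I. chart_ball i)" using F I sub by blast
  qed (use I in auto)
qed

text \<open>The pieces of this partition have compact closure in their chart, hence all densities are
  bounded on them.\<close>

lemma compact_chart_partition:
  obtains D E K where "chart_partition M A D E" "\<And>c. c \<in> D \<Longrightarrow> compact (K c)"
    "\<And>c. c \<in> D \<Longrightarrow> E c \<subseteq> K c" "\<And>c. c \<in> D \<Longrightarrow> K c \<subseteq> dom_of c"
proof -
  obtain I where I: "finite I" "\<And>i. i \<in> I \<Longrightarrow> good_ball i" "M = (\<Union>i\<in>I. chart_ball i)"
    using finite_good_cover by metis
  define D where "D = fst ` I"
  define K where "K c = (\<Union>i\<in>{i\<in>I. fst i = c}. chart_cball i)" for c
  have D: "finite D" "D \<subseteq> A" using I(1,2) by (auto simp: D_def good_ball_def)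
  have K: "compact (K c)" "K c \<subseteq> dom_of c" for c
  proof -
    show "compact (K c)"
      unfolding K_def
    proof (rule compact_UN)
      fix i assume "i \<in> {i \<in> I. fst i = c}"
      then show "compact (chart_cball i)" using I(2) compact_chart_cball(1) by (metis (no_types, lifting) mem_Collect_eq prod_cases3)
    qed (use I(1) in simp)
    show "K c \<subseteq> dom_of c"
    proof
      fix p assume "p \<in> K c"
      then obtain i where i: "i \<in> I" "fst i = c" "p \<in> chart_cball i" by (auto simp: K_def)
      obtain x r where "i = (c, x, r)" using i(2) by (metis prod.collapse)
      then show "p \<in> dom_of c" using compact_chart_cball(2)[of c x r] I(2)[OF i(1)] i(3) by auto
    qed
  qed
  have "M \<subseteq> (\<Union>c\<in>D. K c)"
  proof
    fix p assume "p \<in> M"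
    then obtain i where i: "i \<in> I" "p \<in> chart_ball i" using I(3) by auto
    obtain c x r where ic: "i = (c, x, r)" by (rule prod_cases3)
    then have "p \<in> chart_cball i" using compact_chart_cball(3)[of c x r] I(2)[OF i(1)] i(2) by auto
    then have "p \<in> K c" unfolding K_def using i(1) ic by (intro UN_I[of i]) auto
    moreover have "c \<in> D" unfolding D_def using i(1) ic by (intro image_eqI[of _ _ i]) auto
    ultimately show "p \<in> (\<Union>c\<in>D. K c)" by blast
  qed
  moreover have "K c \<subseteq> M" if "c \<in> D" for c using K(2) D(2) chart_cover that by blast
  ultimately have KM: "M = (\<Union>c\<in>D. K c)" by blast
  \<comment> \<open>An arbitrary injective numbering orders the finitely many charts; a point goes
    to the chart of least number whose compact set contains it.\<close>
  obtain idx :: "'m chart \<Rightarrow> nat" where idx: "inj_on idx D" using D(1) finite_imp_inj_to_nat_seg by metis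
  define E where "E c = K c - (\<Union>d\<in>{d\<in>D. idx d < idx c}. K d)" for c
  have EK: "E c \<subseteq> K c" for c by (auto simp: E_def)
  have borel: "coord c ` E c \<in> sets borel" if c: "c \<in> D" for c
  proof -
    have cA: "c \<in> A" using c D by auto
    have cb: "coord c ` L \<in> sets borel" if "compact L" "L \<subseteq> K c" for L
      using that K(2)[of c] chart_inverse(5)[OF cA]
      by (meson borel_compact compact_continuous_image continuous_on_subset order_trans)
    \<comment> \<open>Only the part of \<open>K d\<close> inside \<open>K c\<close> is sure to have
      coordinates in \<open>c\<close>; it is compact, so its coordinate image is Borel.\<close>
    have "E c = K c - (\<Union>d\<in>{d\<in>D. idx d < idx c}. K c \<inter> K d)" by (auto simp: E_def)
    then have "coord c ` E c = coord c ` K c - coord c ` (\<Union>d\<in>{d\<in>D. idx d < idx c}. K c \<inter> K d)"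
      using inj_on_image_set_diff[OF chart_inverse(4)[OF cA], of "K c" "\<Union>d\<in>{d\<in>D. idx d < idx c}. K c \<inter> K d"] K(2)[of c]
      by auto
    also have "\<dots> \<in> sets borel"
      unfolding image_UN using D(1) K(1) by (intro sets.Diff sets.finite_UN cb compact_Int) auto
    finally show ?thesis .
  qed
  have "chart_partition M A D E" unfolding chart_partition_def
  proof (intro conjI ballI D)
    show "disjoint_family_on E D"
      unfolding disjoint_family_on_def
    proof (intro ballI impI)
      fix c d assume cd: "c \<in> D" "d \<in> D" "c \<noteq> d"
      then have "idx c < idx d \<or> idx d < idx c" using idx by (metis inj_onD nat_neq_iff)
      then show "E c \<inter> E d = {}" using cd by (auto simp: E_def)
    qed
    show "(\<Union>c\<in>D. E c) = M"
    proof
      show "M \<subseteq> (\<Union>c\<in>D. E c)"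
      proof
        fix p assume "p \<in> M"
        then obtain c where "c \<in> D \<and> p \<in> K c" using KM by auto
        then have "\<exists>c. (c \<in> D \<and> p \<in> K c) \<and> (\<forall>d. d \<in> D \<and> p \<in> K d \<longrightarrow> idx c \<le> idx d)"
          by (rule ex_has_least_nat)
        then obtain c where "c \<in> D" "p \<in> K c" "\<And>d. d \<in> D \<Longrightarrow> p \<in> K d \<Longrightarrow> idx c \<le> idx d" by blast
        then have "p \<in> E c" by (auto simp: E_def not_less[symmetric])
        then show "p \<in> (\<Union>c\<in>D. E c)" using \<open>c \<in> D\<close> by blast
      qed
    qed (use EK KM in blast)
    show "E c \<subseteq> dom_of c" for c using EK K(2) by (rule order_trans)
  qed (use borel in auto)
  then show thesis by (rule that[of D E K]) (rule K EK)+
qed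

lemma ex_chart_partition: "\<exists>D E. chart_partition M A D E"
  by (rule compact_chart_partition) blast

end

section \<open>Densities and their totals\<close>

lemma absolutely_integrable_compact_continuous:
  fixes f :: "'p::euclidean_space \<Rightarrow> real"
  assumes "compact K" "continuous_on K f"
  shows "f absolutely_integrable_on K"
proof -
  have "integrable lborel (\<lambda>x. indicator K x *\<^sub>R f x)" by (rule borel_integrable_compact[OF assms])
  then show ?thesis
    unfolding set_integrable_def by (subst integrable_completion) (auto dest: borel_measurable_integrable)
qed

definition slice :: "('p \<Rightarrow> real^2) \<Rightarrow> 'm chart \<Rightarrow> 'm set \<Rightarrow> 'p set" where
  "slice j c E = {x. j x \<in> coord c ` E}"

lemma slice_mono: "E \<subseteq> E' \<Longrightarrow> slice j c E \<subseteq> slice j c E'"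
  by (auto simp: slice_def)

lemma slice_UN: "slice j c (\<Union>i\<in>I. E i) = (\<Union>i\<in>I. slice j c (E i))"
  by (auto simp: slice_def)

text \<open>A density assigns to each chart a function on the parameter domain such that its integral over
  a piece of the surface does not depend on the chart.  Two-dimensional densities arise
  from \<open>j x = x\<close>, densities on the boundary from \<open>j t = (t, 0)\<close>.\<close>

locale surface_density = compact_surface M A
  for M :: "'m::t2_space set" and A :: "'m chart set" +
  fixes j :: "'p::euclidean_space \<Rightarrow> real^2" and \<theta> :: "'m chart \<Rightarrow> 'p \<Rightarrow> real"
  assumes j_continuous: "continuous_on UNIV j"
    and j_proper: "compact K \<Longrightarrow> compact (j -` K)"
    and density_continuous: "c \<in> A \<Longrightarrow> continuous_on (slice j c (dom_of c)) (\<theta> c)"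
    and density_transfer: "\<lbrakk>c \<in> A; d \<in> A; E \<subseteq> dom_of c \<inter> dom_of d; coord c ` E \<in> sets borel;
        coord d ` E \<in> sets borel; \<theta> c absolutely_integrable_on slice j c E\<rbrakk>
      \<Longrightarrow> \<theta> d absolutely_integrable_on slice j d E \<and>
          integral (slice j d E) (\<theta> d) = integral (slice j c E) (\<theta> c)"
begin

definition total :: real where
  "total = total_over_charts M A (\<lambda>c E. integral (slice j c E) (\<theta> c))"

lemma slice_borel: "coord c ` E \<in> sets borel \<Longrightarrow> slice j c E \<in> sets borel"
proof -
  assume B: "coord c ` E \<in> sets borel"
  have "j \<in> borel_measurable borel" using j_continuous by (rule borel_measurable_continuous_onI)
  from measurable_sets[OF this B] show ?thesis by (simp add: slice_def vimage_def)
qed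

lemma slice_lebesgue: "coord c ` E \<in> sets borel \<Longrightarrow> slice j c E \<in> sets lebesgue"
  using slice_borel by (metis sets_completionI_sets sets_lborel)

lemma slice_disjoint:
  assumes "c \<in> A" "E \<subseteq> dom_of c" "E' \<subseteq> dom_of c" "E \<inter> E' = {}"
  shows "slice j c E \<inter> slice j c E' = {}"
  using assms inj_on_image_Int[OF chart_inverse(4)[OF assms(1)], of E E'] by (auto simp: slice_def)

lemma partition_Int:
  assumes P: "chart_partition M A D E" and c: "c \<in> A" and Q: "Q \<subseteq> dom_of c" "coord c ` Q \<in> sets borel"
    and d: "d \<in> D"
  shows "d \<in> A" "Q \<inter> E d \<subseteq> dom_of c \<inter> dom_of d" "coord c ` (Q \<inter> E d) \<in> sets borel"
    "coord d ` (Q \<inter> E d) \<in> sets borel"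
proof -
  show dA: "d \<in> A" and sub: "Q \<inter> E d \<subseteq> dom_of c \<inter> dom_of d"
    using P d Q by (auto simp: chart_partition_def)
  show B: "coord c ` (Q \<inter> E d) \<in> sets borel"
    using P d dA c Q by (intro borel_chart_Int[of c d]) (auto simp: chart_partition_def)
  show "coord d ` (Q \<inter> E d) \<in> sets borel" by (rule borel_transfer[OF c dA sub B])
qed

lemma partition_slice:
  assumes P: "chart_partition M A D E" and c: "c \<in> A" and Q: "Q \<subseteq> dom_of c"
  shows "slice j c Q = (\<Union>d\<in>D. slice j c (Q \<inter> E d))"
proof -
  have "Q \<subseteq> M" using Q c chart_cover by blast
  then have "Q = (\<Union>d\<in>D. Q \<inter> E d)" using P by (auto simp: chart_partition_def)
  then show ?thesis using slice_UN by metis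
qed

text \<open>In the chart \<open>c\<close> itself the density may be unbounded towards the rim of the
  domain. Cutting \<open>Q\<close> into pieces that lie in compact parts of other charts gives
  integrability there, and the transfer law brings it back.\<close>

lemma density_integrable:
  assumes c: "c \<in> A" and Q: "Q \<subseteq> dom_of c" "coord c ` Q \<in> sets borel"
  shows "\<theta> c absolutely_integrable_on slice j c Q"
proof -
  obtain D E K where P: "chart_partition M A D E" and K: "\<And>c. c \<in> D \<Longrightarrow> compact (K c)"
    "\<And>c. c \<in> D \<Longrightarrow> E c \<subseteq> K c" "\<And>c. c \<in> D \<Longrightarrow> K c \<subseteq> dom_of c"
    by (rule compact_chart_partition) blast
  have "\<theta> c absolutely_integrable_on slice j c (Q \<inter> E d)" if d: "d \<in> D" for d
  proof -
    note Qd = partition_Int[OF P c Q d]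
    have "compact (slice j d (K d))"
    proof -
      have "compact (coord d ` K d)"
        using K(1,3)[OF d] chart_inverse(5)[OF Qd(1)] by (meson compact_continuous_image continuous_on_subset)
      then show ?thesis using j_proper by (simp add: slice_def vimage_def)
    qed
    moreover have "continuous_on (slice j d (K d)) (\<theta> d)"
      by (rule continuous_on_subset[OF density_continuous[OF Qd(1)] slice_mono[OF K(3)[OF d]]])
    ultimately have "\<theta> d absolutely_integrable_on slice j d (K d)"
      by (rule absolutely_integrable_compact_continuous)
    then have "\<theta> d absolutely_integrable_on slice j d (Q \<inter> E d)"
      by (rule set_integrable_subset) (use slice_lebesgue[OF Qd(4)] K(2)[OF d] in \<open>auto simp: slice_def\<close>)
    then show ?thesis using density_transfer[OF Qd(1) c _ Qd(4,3)] Qd(2) by blast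
  qed
  then have "\<theta> c absolutely_integrable_on (\<Union>d\<in>D. slice j c (Q \<inter> E d))"
    using P slice_lebesgue[OF partition_Int(3)[OF P c Q]]
    by (intro set_integrable_UN) (auto simp: chart_partition_def)
  then show ?thesis using partition_slice[OF P c Q(1)] by simp
qed

text \<open>Additivity over a partition combined with transfer: every piece is integrated in the
  chart that the partition assigns to it.\<close>

lemma density_split:
  assumes P: "chart_partition M A D E" and c: "c \<in> A" and Q: "Q \<subseteq> dom_of c" "coord c ` Q \<in> sets borel"
  shows "integral (slice j c Q) (\<theta> c) = (\<Sum>d\<in>D. integral (slice j d (Q \<inter> E d)) (\<theta> d))"
proof -
  note Qd = partition_Int[OF P c Q]
  have int: "\<theta> c absolutely_integrable_on slice j c (Q \<inter> E d)" if "d \<in> D" for d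
    using density_integrable[OF c _ Qd(3)[OF that]] Q by blast
  have "integral (slice j c Q) (\<theta> c) = (LINT x:(\<Union>d\<in>D. slice j c (Q \<inter> E d))|lebesgue. \<theta> c x)"
    using set_lebesgue_integral_eq_integral(2)[OF density_integrable[OF c Q]] partition_slice[OF P c Q(1)] by simp
  also have "\<dots> = (\<Sum>d\<in>D. LINT x:slice j c (Q \<inter> E d)|lebesgue. \<theta> c x)"
  proof (rule set_integral_finite_UN_AE)
    show "AE x in lebesgue. x \<in> slice j c (Q \<inter> E d) \<and> x \<in> slice j c (Q \<inter> E e) \<longrightarrow> d = e"
      if de: "d \<in> D" "e \<in> D" for d e
    proof (cases "d = e")
      case False
      then have "E d \<inter> E e = {}"
        using P de by (simp add: chart_partition_def disjoint_family_on_def)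
      then have "slice j c (Q \<inter> E d) \<inter> slice j c (Q \<inter> E e) = {}"
        using Q by (intro slice_disjoint[OF c]) auto
      then show ?thesis by (intro AE_I2) blast
    qed simp
  qed (use P int slice_lebesgue[OF Qd(3)] in \<open>auto simp: chart_partition_def\<close>)
  also have "\<dots> = (\<Sum>d\<in>D. integral (slice j c (Q \<inter> E d)) (\<theta> c))"
    by (intro sum.cong refl set_lebesgue_integral_eq_integral(2) int)
  also have "\<dots> = (\<Sum>d\<in>D. integral (slice j d (Q \<inter> E d)) (\<theta> d))"
    by (intro sum.cong refl) (use density_transfer[OF c Qd(1) Qd(2) Qd(3) Qd(4) int] in simp)
  finally show ?thesis .
qed

text \<open>Two partitions are compared on their common refinement. This makes the value described
  in \<open>total_over_charts\<close> unique, so any partition computes it.\<close>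

lemma total_eq:
  assumes P: "chart_partition M A D E"
  shows "total = (\<Sum>c\<in>D. integral (slice j c (E c)) (\<theta> c))"
proof -
  have pw: "c \<in> A" "E c \<subseteq> dom_of c" "coord c ` E c \<in> sets borel"
    if "chart_partition M A D E" "c \<in> D" for D E c
    using that by (auto simp: chart_partition_def)
  have eq: "(\<Sum>c\<in>D. integral (slice j c (E c)) (\<theta> c)) = (\<Sum>c\<in>D'. integral (slice j c (E' c)) (\<theta> c))"
    if P': "chart_partition M A D' E'" for D' E'
  proof -
    have "(\<Sum>c\<in>D. integral (slice j c (E c)) (\<theta> c)) = (\<Sum>c\<in>D. \<Sum>d\<in>D'. integral (slice j d (E c \<inter> E' d)) (\<theta> d))"
      by (intro sum.cong refl density_split[OF P'] pw[OF P])
    \<comment> \<open>The transfer back to the charts of \<open>D\<close> prepares for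
      \<open>density_split\<close> with respect to that partition, read from right to left.\<close>
    also have "\<dots> = (\<Sum>c\<in>D. \<Sum>d\<in>D'. integral (slice j c (E' d \<inter> E c)) (\<theta> c))"
    proof (intro sum.cong refl)
      fix c d assume cd: "c \<in> D" "d \<in> D'"
      note Qd = partition_Int[OF P' pw[OF P cd(1)] cd(2)]
      have "E c \<inter> E' d \<subseteq> dom_of c" using Qd(2) by blast
      from density_transfer[OF pw(1)[OF P cd(1)] Qd density_integrable[OF pw(1)[OF P cd(1)] this Qd(3)]]
      show "integral (slice j d (E c \<inter> E' d)) (\<theta> d) = integral (slice j c (E' d \<inter> E c)) (\<theta> c)"
        by (simp add: Int_commute)
    qed
    also have "\<dots> = (\<Sum>d\<in>D'. \<Sum>c\<in>D. integral (slice j c (E' d \<inter> E c)) (\<theta> c))" by (rule sum.swap)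
    also have "\<dots> = (\<Sum>c\<in>D'. integral (slice j c (E' c)) (\<theta> c))"
      by (intro sum.cong refl density_split[OF P, symmetric] pw[OF P'])
    finally show ?thesis .
  qed
  show ?thesis unfolding total_def total_over_charts_def
  proof (rule the_equality)
    fix a assume "\<forall>D E. chart_partition M A D E \<longrightarrow> a = (\<Sum>c\<in>D. integral (slice j c (E c)) (\<theta> c))"
    then show "a = (\<Sum>c\<in>D. integral (slice j c (E c)) (\<theta> c))" using P by blast
  qed (use eq in blast)
qed

text \<open>Isolates one piece: for a nonnegative density the rest can only add to the total. It is
  applied to a short boundary arc.\<close>

lemma total_ge:
  assumes nonneg: "\<And>c x. c \<in> A \<Longrightarrow> x \<in> slice j c (dom_of c) \<Longrightarrow> 0 \<le> \<theta> c x"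
    and c: "c \<in> A" and Q: "Q \<subseteq> dom_of c" "coord c ` Q \<in> sets borel"
  shows "integral (slice j c Q) (\<theta> c) \<le> total"
proof -
  obtain D E where P: "chart_partition M A D E" using ex_chart_partition by (elim exE)
  have "integral (slice j c Q) (\<theta> c) = (\<Sum>d\<in>D. integral (slice j d (Q \<inter> E d)) (\<theta> d))"
    by (rule density_split[OF P c Q])
  also have "\<dots> \<le> (\<Sum>d\<in>D. integral (slice j d (E d)) (\<theta> d))"
  proof (rule sum_mono, rule integral_subset_le)
    fix d assume d: "d \<in> D"
    note Qd = partition_Int[OF P c Q d]
    have E: "E d \<subseteq> dom_of d" "coord d ` E d \<in> sets borel" using P d by (auto simp: chart_partition_def)
    show "slice j d (Q \<inter> E d) \<subseteq> slice j d (E d)" by (rule slice_mono) simp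
    have "Q \<inter> E d \<subseteq> dom_of d" using E by blast
    then show "\<theta> d integrable_on slice j d (Q \<inter> E d)"
      using set_lebesgue_integral_eq_integral(1)[OF density_integrable[OF Qd(1) _ Qd(4)]] by blast
    show "\<theta> d integrable_on slice j d (E d)"
      by (rule set_lebesgue_integral_eq_integral(1)[OF density_integrable[OF Qd(1) E]])
    show "\<forall>x\<in>slice j d (E d). 0 \<le> \<theta> d x"
    proof
      fix x assume that: "x \<in> slice j d (E d)"
      show "0 \<le> \<theta> d x"
        by (rule nonneg[OF Qd(1) subsetD[OF slice_mono[OF E(1)] that]])
    qed
  qed
  also have "\<dots> = total" by (simp add: total_eq[OF P])
  finally show ?thesis .
qed

text \<open>A density that vanishes outside one chart is integrated in that chart alone; this
  reduces Green's formula to the half-plane.\<close>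

lemma total_supported:
  assumes c: "c \<in> A" and supp: "\<And>d x. d \<in> A \<Longrightarrow> x \<in> slice j d (dom_of d - dom_of c) \<Longrightarrow> \<theta> d x = 0"
  shows "total = integral (slice j c (dom_of c)) (\<theta> c)"
proof -
  obtain D E where P: "chart_partition M A D E" using ex_chart_partition by (elim exE)
  have B: "coord c ` dom_of c \<in> sets borel" using borel_openin_half_plane[OF chart_cod_open[OF c]] .
  have "total = (\<Sum>d\<in>D. integral (slice j d (E d)) (\<theta> d))" by (rule total_eq[OF P])
  also have "\<dots> = (\<Sum>d\<in>D. integral (slice j d (dom_of c \<inter> E d)) (\<theta> d))"
  proof (intro sum.cong refl)
    fix d assume d: "d \<in> D"
    have E: "d \<in> A" "E d \<subseteq> dom_of d" using P d by (auto simp: chart_partition_def)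
    have "integral (slice j d (dom_of c \<inter> E d)) (\<theta> d) =
        integral (slice j d (E d)) (\<lambda>x. if x \<in> slice j d (dom_of c \<inter> E d) then \<theta> d x else 0)"
    proof -
      have "slice j d (dom_of c \<inter> E d) \<inter> slice j d (E d) = slice j d (dom_of c \<inter> E d)"
        by (auto simp: slice_def)
      then show ?thesis by (simp add: Henstock_Kurzweil_Integration.integral_restrict_Int)
    qed
    also have "\<dots> = integral (slice j d (E d)) (\<theta> d)"
    proof (rule integral_cong)
      fix x assume "x \<in> slice j d (E d)"
      then show "(if x \<in> slice j d (dom_of c \<inter> E d) then \<theta> d x else 0) = \<theta> d x"
        using supp[OF E(1), of x] E(2) by (auto simp: slice_def)
    qed
    finally show "integral (slice j d (E d)) (\<theta> d) = integral (slice j d (dom_of c \<inter> E d)) (\<theta> d)" by simp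
  qed
  also have "\<dots> = integral (slice j c (dom_of c)) (\<theta> c)" by (rule density_split[OF P c subset_refl B, symmetric])
  finally show ?thesis .
qed

end

section \<open>Monotonicity and additivity of totals\<close>

lemma total_mono:
  assumes "surface_density M A j \<theta>" "surface_density M A j \<theta>'"
    and le: "\<And>c x. c \<in> A \<Longrightarrow> x \<in> slice j c (dom_of c) \<Longrightarrow> \<theta> c x \<le> \<theta>' c x"
  shows "surface_density.total M A j \<theta> \<le> surface_density.total M A j \<theta>'"
proof -
  interpret a: surface_density M A j \<theta> by fact
  interpret b: surface_density M A j \<theta>' by fact
  obtain D E where P: "chart_partition M A D E" using a.ex_chart_partition by (elim exE)
  show ?thesis unfolding a.total_eq[OF P] b.total_eq[OF P]
  proof (rule sum_mono)
    fix c assume "c \<in> D"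
    then have E: "c \<in> A" "E c \<subseteq> dom_of c" "coord c ` E c \<in> sets borel"
      using P by (auto simp: chart_partition_def)
    show "integral (slice j c (E c)) (\<theta> c) \<le> integral (slice j c (E c)) (\<theta>' c)"
    proof (rule integral_le)
      show "\<theta> c x \<le> \<theta>' c x" if "x \<in> slice j c (E c)" for x
        by (rule le[OF E(1) subsetD[OF slice_mono[OF E(2)] that]])
    qed (intro set_lebesgue_integral_eq_integral(1) a.density_integrable[OF E] b.density_integrable[OF E])+
  qed
qed

lemma total_sum:
  assumes fin: "finite I" and \<theta>: "\<And>i. i \<in> I \<Longrightarrow> surface_density M A j (\<theta> i)" and \<theta>': "surface_density M A j \<theta>'"
    and eq: "\<And>c x. c \<in> A \<Longrightarrow> x \<in> slice j c (dom_of c) \<Longrightarrow> \<theta>' c x = (\<Sum>i\<in>I. \<theta> i c x)"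
  shows "surface_density.total M A j \<theta>' = (\<Sum>i\<in>I. surface_density.total M A j (\<theta> i))"
proof -
  interpret b: surface_density M A j \<theta>' by fact
  obtain D E where P: "chart_partition M A D E" using b.ex_chart_partition by (elim exE)
  have "integral (slice j c (E c)) (\<theta>' c) = (\<Sum>i\<in>I. integral (slice j c (E c)) (\<theta> i c))" if "c \<in> D" for c
  proof -
    have E: "c \<in> A" "E c \<subseteq> dom_of c" "coord c ` E c \<in> sets borel"
      using P that by (auto simp: chart_partition_def)
    have "integral (slice j c (E c)) (\<theta>' c) = integral (slice j c (E c)) (\<lambda>x. \<Sum>i\<in>I. \<theta> i c x)"
      by (intro integral_cong eq[OF E(1)] subsetD[OF slice_mono[OF E(2)]])
    also have "\<dots> = (\<Sum>i\<in>I. integral (slice j c (E c)) (\<theta> i c))"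
      by (intro integral_sum fin set_lebesgue_integral_eq_integral(1) surface_density.density_integrable[OF \<theta> E])
    finally show ?thesis .
  qed
  then show ?thesis
    unfolding b.total_eq[OF P] by (simp add: surface_density.total_eq[OF \<theta> P] sum.swap[of _ D I])
qed

section \<open>Immersed minimal patches\<close>

lemma C_k_on_imp_continuous_on:
  assumes "C_k_on k T g" shows "continuous_on T g"
proof (cases k)
  case (Suc l)
  then have "\<forall>x\<in>T. g differentiable at x" using assms by simp
  then show ?thesis by (meson continuous_at_imp_continuous_on differentiable_imp_continuous_within)
qed (use assms in simp)

lemma C_k_on_Suc_partials:
  fixes g :: "real^2 \<Rightarrow> 'b::real_normed_vector"
  assumes "C_k_on (Suc k) T g"
  shows "has_partials T g (\<lambda>x. frechet_derivative g (at x) (axis 1 1)) (\<lambda>x. frechet_derivative g (at x) (axis 2 1))"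
    "C_k_on k T (\<lambda>x. frechet_derivative g (at x) (axis i 1))"
proof -
  have "axis i 1 \<in> (Basis :: (real^2) set)" for i by (auto simp: Basis_vec_def)
  then show C: "C_k_on k T (\<lambda>x. frechet_derivative g (at x) (axis i 1))" for i using assms by simp
  show "has_partials T g (\<lambda>x. frechet_derivative g (at x) (axis 1 1)) (\<lambda>x. frechet_derivative g (at x) (axis 2 1))"
  proof (rule has_partialsI)
    fix x assume "x \<in> T"
    then have d: "(g has_derivative frechet_derivative g (at x)) (at x)"
      using assms by (simp add: frechet_derivative_works)
    interpret bounded_linear "frechet_derivative g (at x)" using d by (rule has_derivative_bounded_linear)
    have "frechet_derivative g (at x) v =
        v $ 1 *\<^sub>R frechet_derivative g (at x) (axis 1 1) + v $ 2 *\<^sub>R frechet_derivative g (at x) (axis 2 1)" for v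
      by (subst real2_decompose[of v]) (simp only: add scaleR)
    then have "frechet_derivative g (at x) = (\<lambda>v. v $ 1 *\<^sub>R frechet_derivative g (at x) (axis 1 1)
        + v $ 2 *\<^sub>R frechet_derivative g (at x) (axis 2 1))" by (rule ext)
    with d show "(g has_derivative (\<lambda>v. v $ 1 *\<^sub>R frechet_derivative g (at x) (axis 1 1)
        + v $ 2 *\<^sub>R frechet_derivative g (at x) (axis 2 1))) (at x within T)"
      by (metis has_derivative_at_withinI)
  qed (use C_k_on_imp_continuous_on[OF C] in auto)
qed

text \<open>Smoothness up to the boundary line means restriction from open sets. Two orders of
  derivatives of the extension \<open>h\<close> are extracted; on \<open>S\<close> its first partial
  derivatives are the one-sided ones of \<open>g\<close>, since those are unique.\<close>

lemma smooth_on_local_extension: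
  fixes g :: "real^2 \<Rightarrow> 'b::euclidean_space"
  assumes S: "openin (top_of_set half_plane) S" and g: "smooth_on S g" and x: "x \<in> S"
  obtains T h h1 h2 h11 h12 h21 h22 where "open T" "x \<in> T" "\<And>y. y \<in> S \<inter> T \<Longrightarrow> h y = g y"
    "has_partials T h h1 h2" "has_partials T h1 h11 h12" "has_partials T h2 h21 h22"
    "\<And>y. y \<in> S \<inter> T \<Longrightarrow> partial S g 1 y = h1 y" "\<And>y. y \<in> S \<inter> T \<Longrightarrow> partial S g 2 y = h2 y"
    "openin (top_of_set half_plane) (S \<inter> T)"
proof -
  obtain T h where T: "open T" "x \<in> T" "\<And>k. C_k_on k T h" "\<And>y. y \<in> S \<inter> T \<Longrightarrow> h y = g y"
    using g x unfolding smooth_on_def by metis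
  define h' where "h' i = (\<lambda>x. frechet_derivative h (at x) (axis i 1))" for i :: 2
  have h: "has_partials T h (h' 1) (h' 2)"
    using C_k_on_Suc_partials(1)[OF T(3)[of "Suc 0"]] by (simp only: h'_def)
  have "C_k_on (Suc 0) T (h' i)" for i
    using C_k_on_Suc_partials(2)[OF T(3)[of "Suc (Suc 0)"], of i] by (simp only: h'_def)
  then have h2: "has_partials T (h' i) (\<lambda>x. frechet_derivative (h' i) (at x) (axis 1 1))
      (\<lambda>x. frechet_derivative (h' i) (at x) (axis 2 1))" for i
    by (rule C_k_on_Suc_partials(1))
  have o: "openin (top_of_set half_plane) (S \<inter> T)" using S T(1) by (simp add: openin_Int_open)
  have p: "partial S g 1 y = h' 1 y" "partial S g 2 y = h' 2 y" if y: "y \<in> S \<inter> T" for y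
  proof -
    have "at y within S = at y within S \<inter> T"
      using at_within_openin_subset[OF o _ openin_imp_subset[OF S]] y by auto
    then have "partial S g i y = partial (S \<inter> T) g i y" for i by (simp add: partial_def)
    moreover have "has_partials (S \<inter> T) g (h' 1) (h' 2)"
      by (rule has_partials_cong[OF has_partials_subset[OF h]]) (use T(4) in auto)
    ultimately show "partial S g 1 y = h' 1 y" "partial S g 2 y = h' 2 y"
      using has_partials_partial[OF _ o y] by metis+
  qed
  show thesis by (rule that[OF T(1,2,4) h h2 h2 p o])
qed

lemma smooth_on_C1_on:
  fixes g :: "real^2 \<Rightarrow> 'b::euclidean_space"
  assumes S: "openin (top_of_set half_plane) S" and g: "smooth_on S g"
  shows "C1_on S g" "C1_on S (partial S g i)"
proof -
  have "\<exists>W. openin (top_of_set half_plane) W \<and> x \<in> W \<and> W \<subseteq> S \<and> C1_on W g \<and> C1_on W (partial S g i)"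
    if x: "x \<in> S" for x
  proof -
    obtain T h h1 h2 h11 h12 h21 h22 where T: "open T" "x \<in> T" "\<And>y. y \<in> S \<inter> T \<Longrightarrow> h y = g y"
      "has_partials T h h1 h2" "has_partials T h1 h11 h12" "has_partials T h2 h21 h22"
      "\<And>y. y \<in> S \<inter> T \<Longrightarrow> partial S g 1 y = h1 y" "\<And>y. y \<in> S \<inter> T \<Longrightarrow> partial S g 2 y = h2 y"
      "openin (top_of_set half_plane) (S \<inter> T)"
      by (rule smooth_on_local_extension[OF S g x]) blast
    have sub: "S \<inter> T \<subseteq> T" by simp
    have "C1_on (S \<inter> T) g"
      by (rule C1_on_cong[OF C1_onI[OF has_partials_subset[OF T(4) sub]] T(3)])
    moreover have "C1_on (S \<inter> T) (partial S g 1)"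
      by (rule C1_on_cong[OF C1_onI[OF has_partials_subset[OF T(5) sub]] T(7)[symmetric]])
    moreover have "C1_on (S \<inter> T) (partial S g 2)"
      by (rule C1_on_cong[OF C1_onI[OF has_partials_subset[OF T(6) sub]] T(8)[symmetric]])
    ultimately show ?thesis using T(2,9) x exhaust_2[of i] by (intro exI[of _ "S \<inter> T"]) auto
  qed
  note loc = this
  show "C1_on S g" by (rule C1_on_local[OF S]) (drule loc, elim exE conjE, intro exI conjI)
  show "C1_on S (partial S g i)" by (rule C1_on_local[OF S]) (drule loc, elim exE conjE, intro exI conjI)
qed

text \<open>Schwarz's theorem asks for a full neighbourhood, which boundary points lack in
  \<open>S\<close>; it is applied to the extension \<open>h\<close> instead.\<close>

lemma smooth_on_symmetric_partials:
  fixes g :: "real^2 \<Rightarrow> 'b::euclidean_space"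
  assumes S: "openin (top_of_set half_plane) S" and g: "smooth_on S g" and x: "x \<in> S"
  shows "partial S (partial S g 1) 2 x = partial S (partial S g 2) 1 x"
proof -
  obtain T h h1 h2 h11 h12 h21 h22 where T: "open T" "x \<in> T" "\<And>y. y \<in> S \<inter> T \<Longrightarrow> h y = g y"
    "has_partials T h h1 h2" "has_partials T h1 h11 h12" "has_partials T h2 h21 h22"
    "\<And>y. y \<in> S \<inter> T \<Longrightarrow> partial S g 1 y = h1 y" "\<And>y. y \<in> S \<inter> T \<Longrightarrow> partial S g 2 y = h2 y"
    "openin (top_of_set half_plane) (S \<inter> T)"
    by (rule smooth_on_local_extension[OF S g x]) blast
  have sub: "S \<inter> T \<subseteq> T" "S \<inter> T \<subseteq> S" and xT: "x \<in> S \<inter> T" using T(2) x by auto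
  note C = C1_on_has_partials[OF smooth_on_C1_on(2)[OF S g] S]
  have "partial S (partial S g 1) 2 x = h12 x"
    by (rule has_partials_unique(2)[OF T(9) xT has_partials_subset[OF C sub(2)]])
      (rule has_partials_cong[OF has_partials_subset[OF T(5) sub(1)] T(7)[symmetric]], auto)
  moreover have "partial S (partial S g 2) 1 x = h21 x"
    by (rule has_partials_unique(1)[OF T(9) xT has_partials_subset[OF C sub(2)]])
      (rule has_partials_cong[OF has_partials_subset[OF T(6) sub(1)] T(8)[symmetric]], auto)
  ultimately show ?thesis using symmetric_second_partials[OF T(1,2,4-6)] by simp
qed

text \<open>In index notation this is \<open>sqrt g g\<^sup>i\<^sup>j \<langle>\<partial>\<^sub>i U, \<partial>\<^sub>j F\<rangle>\<close>; the factor \<open>sqrt g\<close> makes it a density.\<close>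

definition grad_pairing ::
  "(real^2) set \<Rightarrow> (real^2 \<Rightarrow> 'v::euclidean_space) \<Rightarrow> (real^2 \<Rightarrow> 'v) \<Rightarrow> real^2 \<Rightarrow> real" where
  "grad_pairing S F U x =
    ((partial S F 2 x \<bullet> partial S F 2 x) * (partial S U 1 x \<bullet> partial S F 1 x)
      - (partial S F 1 x \<bullet> partial S F 2 x) * (partial S U 1 x \<bullet> partial S F 2 x + partial S U 2 x \<bullet> partial S F 1 x)
      + (partial S F 1 x \<bullet> partial S F 1 x) * (partial S U 2 x \<bullet> partial S F 2 x))
    / sqrt (det (first_form S F x))"

section \<open>Metric, flux and conormal of an immersed patch\<close>

locale immersed_patch =
  fixes S :: "(real^2) set" and F :: "real^2 \<Rightarrow> 'v::euclidean_space"
  assumes open_S: "openin (top_of_set half_plane) S"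
    and smooth_F: "smooth_on S F"
    and inj_F: "x \<in> S \<Longrightarrow> inj (frechet_derivative F (at x within S))"
begin

abbreviation "F1 \<equiv> partial S F 1"
abbreviation "F2 \<equiv> partial S F 2"

text \<open>The area element, usually written sqrt g.\<close>

definition D :: "real^2 \<Rightarrow> real" where "D x = sqrt (det (first_form S F x))"

lemma det_first_form: "det (first_form S F x) = (F1 x \<bullet> F1 x) * (F2 x \<bullet> F2 x) - (F1 x \<bullet> F2 x) * (F1 x \<bullet> F2 x)"
  by (simp add: det_2 first_form_def inner_commute)

lemma C1_F: "C1_on S F" and C1_Fi: "C1_on S (partial S F i)"
  using smooth_on_C1_on[OF open_S smooth_F] by auto

lemma partials_F: "has_partials S F F1 F2"
  and partials_F1: "has_partials S F1 (partial S F1 1) (partial S F1 2)"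
  and partials_F2: "has_partials S F2 (partial S F2 1) (partial S F2 2)"
  by (intro C1_on_has_partials open_S C1_F C1_Fi)+

lemma mixed_partials: "x \<in> S \<Longrightarrow> partial S F1 2 x = partial S F2 1 x"
  using smooth_on_symmetric_partials[OF open_S smooth_F] .

lemma derivative_F: "x \<in> S \<Longrightarrow> frechet_derivative F (at x within S) = (\<lambda>v. v $ 1 *\<^sub>R F1 x + v $ 2 *\<^sub>R F2 x)"
  using has_partials_derivative[OF partials_F open_S] .

lemma independent_F:
  assumes x: "x \<in> S" and eq: "a *\<^sub>R F1 x + b *\<^sub>R F2 x = 0"
  shows "a = 0" "b = 0"
proof -
  have "frechet_derivative F (at x within S) (vector [a, b]) = frechet_derivative F (at x within S) 0"
    using eq by (simp add: derivative_F[OF x])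
  then have "vector [a, b] = (0 :: real^2)" using inj_F[OF x] by (simp add: inj_eq)
  then show "a = 0" "b = 0" by (auto simp: vec_eq_iff forall_2)
qed

lemma F1_pos: "x \<in> S \<Longrightarrow> 0 < F1 x \<bullet> F1 x" and F2_pos: "x \<in> S \<Longrightarrow> 0 < F2 x \<bullet> F2 x"
  using independent_F[of x 1 0] independent_F[of x 0 1] by auto

lemma det_pos:
  assumes x: "x \<in> S"
  shows "0 < det (first_form S F x)"
proof -
  \<comment> \<open>\<open>?v\<close> is g22 times the component of \<open>F1\<close> orthogonal to
    \<open>F2\<close>; its squared length is g22 times the determinant.\<close>
  let ?v = "(F2 x \<bullet> F2 x) *\<^sub>R F1 x + (- (F1 x \<bullet> F2 x)) *\<^sub>R F2 x"
  have "?v \<noteq> 0"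
  proof
    assume "?v = 0"
    from independent_F(1)[OF x this] show False using F2_pos[OF x] by simp
  qed
  then have "0 < ?v \<bullet> ?v" by simp
  also have "?v \<bullet> ?v = (F2 x \<bullet> F2 x) * det (first_form S F x)"
    by (simp add: det_first_form inner_simps inner_commute algebra_simps)
  finally show ?thesis using F2_pos[OF x] by (simp add: zero_less_mult_iff)
qed

lemma D_pos: "x \<in> S \<Longrightarrow> 0 < D x" and D_sq: "x \<in> S \<Longrightarrow> D x * D x = det (first_form S F x)"
  using det_pos[of x] by (auto simp: D_def)

lemma C1_D: "C1_on S D"
  unfolding D_def
proof (rule C1_on_sqrt)
  have "C1_on S (\<lambda>x. (F1 x \<bullet> F1 x) * (F2 x \<bullet> F2 x) + (- 1) * ((F1 x \<bullet> F2 x) * (F1 x \<bullet> F2 x)))"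
    by (intro C1_on_add C1_on_mult C1_on_inner C1_Fi C1_on_const)
  then show "C1_on S (\<lambda>x. det (first_form S F x))" by (simp add: det_first_form)
qed (rule det_pos)

text \<open>The coefficients of \<open>P\<close> and \<open>N\<close> are those of the matrix \<open>sqrt g g\<^sup>i\<^sup>j\<close>, so \<open>P\<close> and \<open>N\<close> form the
  coordinate flux of the identity map; \<open>N\<close> points along the inward conormal at the boundary.\<close>

definition P :: "real^2 \<Rightarrow> 'v" where
  "P x = (inverse (D x) * (F2 x \<bullet> F2 x)) *\<^sub>R F1 x + (inverse (D x) * - (F1 x \<bullet> F2 x)) *\<^sub>R F2 x"

definition N :: "real^2 \<Rightarrow> 'v" where
  "N x = (inverse (D x) * - (F1 x \<bullet> F2 x)) *\<^sub>R F1 x + (inverse (D x) * (F1 x \<bullet> F1 x)) *\<^sub>R F2 x"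

lemma C1_coefficient: "C1_on S (\<lambda>x. inverse (D x) * - (F1 x \<bullet> F2 x))" "C1_on S (\<lambda>x. inverse (D x) * (partial S F i x \<bullet> partial S F i x))"
proof -
  have i: "C1_on S (\<lambda>x. inverse (D x))" using C1_on_inverse[OF C1_D] D_pos by force
  have h: "C1_on S (\<lambda>x. (- 1) * (F1 x \<bullet> F2 x))" by (intro C1_on_mult C1_on_const C1_on_inner C1_Fi)
  show "C1_on S (\<lambda>x. inverse (D x) * - (F1 x \<bullet> F2 x))" using C1_on_mult[OF i h] by simp
  show "C1_on S (\<lambda>x. inverse (D x) * (partial S F i x \<bullet> partial S F i x))"
    by (intro C1_on_mult i C1_on_inner C1_Fi)
qed

lemma C1_P: "C1_on S P" and C1_N: "C1_on S N"
  unfolding P_def N_def by (intro C1_on_add C1_on_scaleR C1_coefficient C1_Fi)+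

text \<open>\<open>P\<close> and \<open>N\<close> are \<open>D\<close> times the basis of the
  tangent plane dual to \<open>F1\<close>, \<open>F2\<close>; the value \<open>D\<close> arises as
  the determinant divided by \<open>D\<close>.\<close>

lemma P_N_inner:
  assumes "x \<in> S"
  shows "P x \<bullet> F1 x = D x" "P x \<bullet> F2 x = 0" "N x \<bullet> F1 x = 0" "N x \<bullet> F2 x = D x"
proof -
  have "P x \<bullet> F1 x = inverse (D x) * det (first_form S F x)"
    by (simp add: P_def det_first_form inner_simps inner_commute algebra_simps)
  then show "P x \<bullet> F1 x = D x" using D_pos[OF assms] by (simp add: D_sq[OF assms, symmetric])
  have "N x \<bullet> F2 x = inverse (D x) * det (first_form S F x)"
    by (simp add: N_def det_first_form inner_simps inner_commute algebra_simps)
  then show "N x \<bullet> F2 x = D x" using D_pos[OF assms] by (simp add: D_sq[OF assms, symmetric])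
  show "P x \<bullet> F2 x = 0" "N x \<bullet> F1 x = 0"
    by (simp_all add: P_def N_def inner_simps inner_commute algebra_simps)
qed

lemma grad_pairing_flux: "grad_pairing S F U x = partial S U 1 x \<bullet> P x + partial S U 2 x \<bullet> N x"
  by (simp add: grad_pairing_def P_def N_def D_def[symmetric] inner_simps divide_inverse algebra_simps)

lemma grad_pairing_identity:
  assumes "x \<in> S" shows "grad_pairing S F F x = 2 * D x"
  using P_N_inner[OF assms] by (simp add: grad_pairing_flux inner_commute)

text \<open>Up to the factor det, the left side is the squared length of the tangential part of
  \<open>z\<close>, which is at most that of \<open>z\<close>.\<close>

lemma tangential_energy_le:
  assumes x: "x \<in> S"
  shows "(F2 x \<bullet> F2 x) * (z \<bullet> F1 x)\<^sup>2 - 2 * (F1 x \<bullet> F2 x) * (z \<bullet> F1 x) * (z \<bullet> F2 x) + (F1 x \<bullet> F1 x) * (z \<bullet> F2 x)\<^sup>2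
    \<le> (z \<bullet> z) * det (first_form S F x)" (is "?q \<le> _")
proof -
  let ?d = "det (first_form S F x)"
  \<comment> \<open>\<open>t\<close> is det times the tangential projection of \<open>z\<close>;
    this makes \<open>t \<bullet> z\<close> equal to \<open>?q\<close> and
    \<open>t \<bullet> t\<close> equal to \<open>?d * ?q\<close>, so Cauchy-Schwarz gives the
    bound.\<close>
  define t where "t = ((F2 x \<bullet> F2 x) * (z \<bullet> F1 x) - (F1 x \<bullet> F2 x) * (z \<bullet> F2 x)) *\<^sub>R F1 x
    + ((F1 x \<bullet> F1 x) * (z \<bullet> F2 x) - (F1 x \<bullet> F2 x) * (z \<bullet> F1 x)) *\<^sub>R F2 x"
  have tz: "t \<bullet> z = ?q" by (simp add: t_def inner_simps inner_commute power2_eq_square algebra_simps)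
  have tt: "t \<bullet> t = ?d * ?q"
    by (simp add: t_def det_first_form inner_simps inner_commute power2_eq_square algebra_simps)
  have "?q\<^sup>2 \<le> (?d * ?q) * (z \<bullet> z)" using Cauchy_Schwarz_ineq[of t z] unfolding tz tt .
  then have "?q * ?q \<le> ?q * ((z \<bullet> z) * ?d)" by (simp only: power2_eq_square mult_ac)
  moreover have "0 \<le> ?q"
    using det_pos[OF x] inner_ge_zero[of t] unfolding tt by (simp only: zero_le_mult_iff) linarith
  moreover have "0 \<le> (z \<bullet> z) * ?d" using det_pos[OF x] by simp
  moreover have "q \<le> c" if "q * q \<le> q * c" "0 \<le> q" "0 \<le> c" for q c :: real
    using that by (cases "q = 0") auto
  ultimately show ?thesis by blast
qed

text \<open>With \<open>z = F - y\<close> and \<open>U = F - 2 z / \<bar>z\<bar>\<^sup>2\<close>, the difference of the two sides is a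
  positive multiple of the squared length of the normal component of \<open>z\<close>.\<close>

lemma grad_pairing_le:
  assumes x: "x \<in> S" and z: "z \<noteq> 0"
    and U: "\<And>i. partial S U i x = partial S F i x - (2 / (z \<bullet> z)) *\<^sub>R partial S F i x
      + (4 * (z \<bullet> partial S F i x) / (z \<bullet> z)\<^sup>2) *\<^sub>R z"
  shows "grad_pairing S F U x \<le> 2 * D x"
proof -
  let ?q = "(F2 x \<bullet> F2 x) * (z \<bullet> F1 x)\<^sup>2 - 2 * (F1 x \<bullet> F2 x) * (z \<bullet> F1 x) * (z \<bullet> F2 x) + (F1 x \<bullet> F1 x) * (z \<bullet> F2 x)\<^sup>2"
  let ?r = "z \<bullet> z"
  have r: "?r > 0" using z by simp
  have D0: "D x \<noteq> 0" using D_pos[OF x] by simp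
  \<comment> \<open>Multiplication by \<open>D x\<close> removes the denominator of
    \<open>grad_pairing\<close>. The multiples of \<open>partial S F i x\<close> give the trace 2 of
    the identity; the rank one term along \<open>z\<close> gives the quadratic form
    \<open>?q\<close>.\<close>
  have "grad_pairing S F U x * D x = 2 * (1 - 2 / ?r) * det (first_form S F x) + 4 / ?r\<^sup>2 * ?q"
    unfolding grad_pairing_def D_def[symmetric] times_divide_eq_left nonzero_mult_div_cancel_right[OF D0]
    unfolding U det_first_form
    by (simp add: inner_simps inner_commute power2_eq_square algebra_simps add_divide_distrib diff_divide_distrib)
  also have "\<dots> \<le> 2 * (1 - 2 / ?r) * det (first_form S F x) + 4 / ?r\<^sup>2 * (?r * det (first_form S F x))"
    by (intro add_left_mono mult_left_mono tangential_energy_le[OF x]) simp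
  \<comment> \<open>The terms in 1 / \<open>?r\<close> cancel, leaving the energy of
    \<open>F\<close> itself.\<close>
  also have "\<dots> = 2 * D x * D x"
    using r by (simp add: D_sq[OF x] power2_eq_square field_simps)
  finally show ?thesis using D_pos[OF x] by simp
qed

text \<open>\<open>N\<close> is tangent, orthogonal to \<open>F1\<close>, as long as
  \<open>F1\<close>, and has a positive coefficient at \<open>F2\<close>: it is the inward conormal
  scaled by the length element. As \<open>outward_conormal\<close> is a definite description,
  uniqueness has to be shown too.\<close>

lemma conormal_flux:
  assumes x: "x \<in> S"
  shows "N x = - norm (F1 x) *\<^sub>R outward_conormal S F x"
proof -
  let ?a = "inverse (D x) * - (F1 x \<bullet> F2 x)" and ?c = "inverse (D x) * (F1 x \<bullet> F1 x)"
  have c: "?c > 0" using D_pos[OF x] F1_pos[OF x] by simp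
  have nF: "norm (F1 x) > 0" using F1_pos[OF x] by simp
  have c': "0 < inverse (D x) * (inverse (norm (F1 x)) * (F1 x \<bullet> F1 x))"
    by (intro mult_pos_pos positive_imp_inverse_positive D_pos[OF x] nF F1_pos[OF x])
  have "N x \<bullet> N x = ?a * (N x \<bullet> F1 x) + ?c * (N x \<bullet> F2 x)"
    by (subst (2) N_def) (simp only: inner_add_right inner_scaleR_right)
  then have "N x \<bullet> N x = F1 x \<bullet> F1 x" using P_N_inner[OF x] D_pos[OF x] by simp
  then have nN: "norm (N x) = norm (F1 x)" by (simp add: norm_eq_sqrt_inner)
  let ?w = "- inverse (norm (F1 x)) *\<^sub>R N x"
  have "outward_conormal S F x = ?w"
    unfolding outward_conormal_def
  proof (rule the_equality, intro conjI)
    show "\<exists>v. v $ 2 < 0 \<and> ?w = frechet_derivative F (at x within S) v"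
      by (rule exI[of _ "vector [- inverse (norm (F1 x)) * ?a, - inverse (norm (F1 x)) * ?c]"])
        (use c' nF in \<open>simp add: derivative_F[OF x] N_def algebra_simps\<close>)
    show "norm ?w = 1" using nN nF by simp
    show "orthogonal ?w (F1 x)" using P_N_inner[OF x] by (simp add: orthogonal_def)
  next
    fix w assume w: "(\<exists>v. v $ 2 < 0 \<and> w = frechet_derivative F (at x within S) v) \<and> norm w = 1 \<and> orthogonal w (F1 x)"
    then obtain v :: "real^2" where v: "v $ 2 < 0" "w = v $ 1 *\<^sub>R F1 x + v $ 2 *\<^sub>R F2 x"
      using derivative_F[OF x] by auto
    \<comment> \<open>\<open>b\<close> matches the coefficients at \<open>F2\<close> of
      \<open>w\<close> and of \<open>b *\<^sub>R N x\<close>. What is left is a multiple of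
      \<open>F1\<close>, removed by orthogonality, and the unit length fixes
      \<open>b\<close>.\<close>
    define b where "b = v $ 2 / ?c"
    have b: "b < 0" "b * ?c = v $ 2" using v(1) c by (auto simp: b_def divide_neg_pos)
    have "w - b *\<^sub>R N x = (v $ 1 - b * ?a) *\<^sub>R F1 x + (v $ 2 - b * ?c) *\<^sub>R F2 x"
      unfolding v(2) N_def by (simp only: scaleR_add_right scaleR_diff_left scaleR_scaleR) (simp add: algebra_simps)
    then have eq: "w - b *\<^sub>R N x = (v $ 1 - b * ?a) *\<^sub>R F1 x" using b(2) by simp
    have "(w - b *\<^sub>R N x) \<bullet> F1 x = 0"
      using w P_N_inner[OF x] by (simp add: orthogonal_def inner_diff_left)
    then have "v $ 1 - b * ?a = 0" unfolding eq using F1_pos[OF x] by simp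
    then have wb: "w = b *\<^sub>R N x" using eq by simp
    then have "- b * norm (F1 x) = 1" using w b nN by simp
    then have "b = - inverse (norm (F1 x))" using nF by (simp add: field_simps)
    then show "w = ?w" using wb by simp
  qed
  then show ?thesis using nF by simp
qed

end

section \<open>Minimality, the divergence of the flux, and Green's formula in one chart\<close>

lemma normal_part_diff:
  assumes "subspace T" shows "v - normal_part T v \<in> T"
proof -
  obtain y z where yz: "y \<in> span T" "\<And>w. w \<in> span T \<Longrightarrow> orthogonal z w" "v = y + z"
    using orthogonal_subspace_decomp_exists by metis
  have sp: "span T = T" using assms by (simp add: span_eq_iff)
  \<comment> \<open>The orthogonal decomposition has to be unique as well, because
    \<open>normal_part\<close> is a definite description.\<close>
  have "\<exists>!w. w \<in> orthogonal_comp T \<and> v - w \<in> T"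
  proof (rule ex1I[of _ z])
    show "z \<in> orthogonal_comp T \<and> v - z \<in> T"
      using yz sp by (auto simp: orthogonal_comp_def orthogonal_commute)
  next
    fix w assume w: "w \<in> orthogonal_comp T \<and> v - w \<in> T"
    have "y - (v - w) \<in> T" by (rule subspace_diff[OF assms]) (use w yz(1) sp in auto)
    moreover have "y - (v - w) = w - z" using yz by simp
    ultimately have "w - z \<in> T" by simp
    then have "w \<bullet> (w - z) = 0"
      using w \<open>w - z \<in> T\<close> unfolding orthogonal_comp_def orthogonal_def
      by (subst inner_commute) blast
    moreover have "z \<bullet> (w - z) = 0"
      using yz(2)[of "w - z"] \<open>w - z \<in> T\<close> sp by (simp add: orthogonal_def)
    ultimately have "(w - z) \<bullet> (w - z) = 0" by (simp add: inner_diff_left)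
    then show "w = z" by simp
  qed
  from theI'[OF this] show ?thesis unfolding normal_part_def by simp
qed

lemma matrix_inv_2:
  fixes B :: "real^2^2"
  assumes "det B \<noteq> 0"
  shows "matrix_inv B $ 1 $ 1 = B $ 2 $ 2 / det B" "matrix_inv B $ 1 $ 2 = - (B $ 1 $ 2) / det B"
    "matrix_inv B $ 2 $ 1 = - (B $ 2 $ 1) / det B" "matrix_inv B $ 2 $ 2 = B $ 1 $ 1 / det B"
proof -
  let ?C = "vector [vector [B $ 2 $ 2 / det B, - (B $ 1 $ 2) / det B],
     vector [- (B $ 2 $ 1) / det B, B $ 1 $ 1 / det B]] :: real^2^2"
  have d: "B $ 1 $ 1 * B $ 2 $ 2 = det B + B $ 1 $ 2 * B $ 2 $ 1" by (simp add: det_2)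
  have "B ** ?C = mat 1" "?C ** B = mat 1"
    using assms by (simp_all add: vec_eq_iff forall_2 matrix_matrix_mult_def sum_2 mat_def field_simps) (use d in \<open>simp_all add: algebra_simps\<close>)
  then have "matrix_inv B = ?C"
  proof -
    assume C: "B ** ?C = mat 1" "?C ** B = mat 1"
    then have "\<exists>A'. B ** A' = mat 1 \<and> A' ** B = mat 1" by blast
    then have "B ** matrix_inv B = mat 1" unfolding matrix_inv_def by (rule someI2_ex) blast
    then have "?C ** (B ** matrix_inv B) = ?C" by simp
    then show ?thesis using C(2) by (simp add: matrix_mul_assoc)
  qed
  then show "matrix_inv B $ 1 $ 1 = B $ 2 $ 2 / det B" "matrix_inv B $ 1 $ 2 = - (B $ 1 $ 2) / det B"
    "matrix_inv B $ 2 $ 1 = - (B $ 2 $ 1) / det B" "matrix_inv B $ 2 $ 2 = B $ 1 $ 1 / det B"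
    by simp_all
qed

locale minimal_patch = immersed_patch S F
  for S :: "(real^2) set" and F :: "real^2 \<Rightarrow> 'v::euclidean_space" +
  assumes minimal: "x \<in> S \<Longrightarrow> mean_curvature S F x = 0"
begin

abbreviation "F11 \<equiv> partial S F1 1"
abbreviation "F12 \<equiv> partial S F1 2"
abbreviation "F21 \<equiv> partial S F2 1"
abbreviation "F22 \<equiv> partial S F2 2"

text \<open>Multiplying the mean curvature by det replaces the inverse metric by cofactors. The
  result is the normal part of this combination of second derivatives, so its vanishing leaves a
  tangent vector.\<close>

lemma minimal_tangential:
  assumes x: "x \<in> S"
  obtains a b where "(F2 x \<bullet> F2 x) *\<^sub>R F11 x - (F1 x \<bullet> F2 x) *\<^sub>R (F12 x + F21 x) + (F1 x \<bullet> F1 x) *\<^sub>R F22 x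
    = a *\<^sub>R F1 x + b *\<^sub>R F2 x"
proof -
  let ?T = "tangent_plane S F x" and ?d = "det (first_form S F x)"
  have T: "?T = range (\<lambda>v::real^2. v $ 1 *\<^sub>R F1 x + v $ 2 *\<^sub>R F2 x)" by (simp add: tangent_plane_def derivative_F[OF x])
  have "linear (\<lambda>v::real^2. v $ 1 *\<^sub>R F1 x + v $ 2 *\<^sub>R F2 x)" by (rule linearI) (auto simp: algebra_simps)
  then have sub: "subspace ?T" unfolding T by (rule linear_subspace_image) simp
  define n where "n v = normal_part ?T v" for v
  have n: "v - n v \<in> ?T" for v unfolding n_def by (rule normal_part_diff[OF sub])
  have d: "?d \<noteq> 0" using det_pos[OF x] by simp
  let ?g = "first_form S F x"
  have g: "?g $ 1 $ 1 = F1 x \<bullet> F1 x" "?g $ 1 $ 2 = F1 x \<bullet> F2 x" "?g $ 2 $ 1 = F1 x \<bullet> F2 x" "?g $ 2 $ 2 = F2 x \<bullet> F2 x"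
    by (simp_all add: first_form_def inner_commute)
  have "0 = ?d *\<^sub>R mean_curvature S F x" using minimal[OF x] by simp
  also have "\<dots> = (F2 x \<bullet> F2 x) *\<^sub>R n (F11 x) - (F1 x \<bullet> F2 x) *\<^sub>R (n (F12 x) + n (F21 x)) + (F1 x \<bullet> F1 x) *\<^sub>R n (F22 x)"
    using d unfolding mean_curvature_def sum_2 matrix_inv_2[OF d] g second_form_def n_def[symmetric]
    by (simp add: scaleR_add_right scaleR_diff_right algebra_simps)
  finally have zero: "(F2 x \<bullet> F2 x) *\<^sub>R n (F11 x) - (F1 x \<bullet> F2 x) *\<^sub>R (n (F12 x) + n (F21 x)) + (F1 x \<bullet> F1 x) *\<^sub>R n (F22 x) = 0"
    by simp
  have "(F2 x \<bullet> F2 x) *\<^sub>R (F11 x - n (F11 x)) - (F1 x \<bullet> F2 x) *\<^sub>R ((F12 x - n (F12 x)) + (F21 x - n (F21 x)))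
      + (F1 x \<bullet> F1 x) *\<^sub>R (F22 x - n (F22 x)) \<in> ?T"
    by (intro subspace_add subspace_diff subspace_scale sub n)
  also have "(F2 x \<bullet> F2 x) *\<^sub>R (F11 x - n (F11 x)) - (F1 x \<bullet> F2 x) *\<^sub>R ((F12 x - n (F12 x)) + (F21 x - n (F21 x)))
      + (F1 x \<bullet> F1 x) *\<^sub>R (F22 x - n (F22 x))
    = ((F2 x \<bullet> F2 x) *\<^sub>R F11 x - (F1 x \<bullet> F2 x) *\<^sub>R (F12 x + F21 x) + (F1 x \<bullet> F1 x) *\<^sub>R F22 x)
      - ((F2 x \<bullet> F2 x) *\<^sub>R n (F11 x) - (F1 x \<bullet> F2 x) *\<^sub>R (n (F12 x) + n (F21 x)) + (F1 x \<bullet> F1 x) *\<^sub>R n (F22 x))"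
    by (simp add: algebra_simps)
  finally have "(F2 x \<bullet> F2 x) *\<^sub>R F11 x - (F1 x \<bullet> F2 x) *\<^sub>R (F12 x + F21 x) + (F1 x \<bullet> F1 x) *\<^sub>R F22 x \<in> ?T"
    unfolding zero by simp
  then show thesis using that unfolding T by auto
qed

text \<open>Minimality makes the divergence of the flux \<open>(P, N)\<close> tangential; that it is orthogonal to the
  tangent plane holds for every immersion.\<close>

lemma flux_divergence_free:
  assumes x: "x \<in> S" and P: "has_partials S P P1 P2" and N: "has_partials S N N1 N2"
  shows "P1 x + N2 x = 0"
proof -
  let ?g11 = "F1 x \<bullet> F1 x" and ?g12 = "F1 x \<bullet> F2 x" and ?g22 = "F2 x \<bullet> F2 x"
  have D: "D x > 0" "D x * D x = ?g11 * ?g22 - ?g12 * ?g12"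
    using D_pos[OF x] D_sq[OF x] by (auto simp: det_first_form)
  obtain a1 a2 where a: "has_partials S (\<lambda>x. inverse (D x) * (F2 x \<bullet> F2 x)) a1 a2"
    using C1_coefficient(2)[of 2] C1_on_def by metis
  obtain b1 b2 where b: "has_partials S (\<lambda>x. inverse (D x) * - (F1 x \<bullet> F2 x)) b1 b2"
    using C1_coefficient(1) C1_on_def by metis
  obtain c1 c2 where c: "has_partials S (\<lambda>x. inverse (D x) * (F1 x \<bullet> F1 x)) c1 c2"
    using C1_coefficient(2)[of 1] C1_on_def by metis
  note expP = has_partials_add[OF has_partials_scaleR[OF a partials_F1] has_partials_scaleR[OF b partials_F2]]
  note expN = has_partials_add[OF has_partials_scaleR[OF b partials_F1] has_partials_scaleR[OF c partials_F2]]
  have Px: "P1 x = a1 x *\<^sub>R F1 x + (inverse (D x) * ?g22) *\<^sub>R F11 x + (b1 x *\<^sub>R F2 x + (inverse (D x) * - ?g12) *\<^sub>R F21 x)"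
    by (rule has_partials_unique(1)[OF open_S x P expP[folded P_def]])
  have Nx: "N2 x = b2 x *\<^sub>R F1 x + (inverse (D x) * - ?g12) *\<^sub>R F12 x + (c2 x *\<^sub>R F2 x + (inverse (D x) * ?g11) *\<^sub>R F22 x)"
    by (rule has_partials_unique(2)[OF open_S x N expN[folded N_def]])
  obtain k l where kl: "?g22 *\<^sub>R F11 x - ?g12 *\<^sub>R (F12 x + F21 x) + ?g11 *\<^sub>R F22 x = k *\<^sub>R F1 x + l *\<^sub>R F2 x"
    by (rule minimal_tangential[OF x])
  \<comment> \<open>The derivatives of the scalar coefficients contribute only multiples of
    \<open>F1\<close> and \<open>F2\<close>; minimality makes the second-order terms tangent as
    well.\<close>
  have "P1 x + N2 x = (a1 x + b2 x) *\<^sub>R F1 x + (b1 x + c2 x) *\<^sub>R F2 x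
      + inverse (D x) *\<^sub>R (?g22 *\<^sub>R F11 x - ?g12 *\<^sub>R (F12 x + F21 x) + ?g11 *\<^sub>R F22 x)"
    unfolding Px Nx by (simp add: algebra_simps)
  also have "\<dots> = (a1 x + b2 x + inverse (D x) * k) *\<^sub>R F1 x + (b1 x + c2 x + inverse (D x) * l) *\<^sub>R F2 x"
    unfolding kl by (simp add: algebra_simps)
  finally obtain s t where st: "P1 x + N2 x = s *\<^sub>R F1 x + t *\<^sub>R F2 x" by blast
  obtain D1 D2 where Dp: "has_partials S D D1 D2" using C1_D C1_on_def by metis
  have sym: "F12 x = F21 x" by (rule mixed_partials[OF x])
  \<comment> \<open>Differentiating the duality relations \<open>P_N_inner\<close> expresses the
    inner products of the divergence with \<open>F1\<close> and \<open>F2\<close> by second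
    derivatives of \<open>F\<close> and derivatives of \<open>D\<close>.\<close>
  have 1: "P1 x \<bullet> F1 x + P x \<bullet> F11 x = D1 x"
    by (rule has_partials_unique(1)[OF open_S x has_partials_cong[OF has_partials_inner[OF P partials_F1] P_N_inner(1)] Dp]) simp_all
  have 2: "P1 x \<bullet> F2 x + P x \<bullet> F21 x = 0"
    by (rule has_partials_unique(1)[OF open_S x has_partials_cong[OF has_partials_inner[OF P partials_F2] P_N_inner(2)] has_partials_const]) simp_all
  have 3: "N2 x \<bullet> F1 x + N x \<bullet> F12 x = 0"
    by (rule has_partials_unique(2)[OF open_S x has_partials_cong[OF has_partials_inner[OF N partials_F1] P_N_inner(3)] has_partials_const]) simp_all
  have 4: "N2 x \<bullet> F2 x + N x \<bullet> F22 x = D2 x"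
    by (rule has_partials_unique(2)[OF open_S x has_partials_cong[OF has_partials_inner[OF N partials_F2] P_N_inner(4)] Dp]) simp_all
  note g11 = has_partials_inner[OF partials_F1 partials_F1]
  note g12 = has_partials_inner[OF partials_F1 partials_F2]
  note g22 = has_partials_inner[OF partials_F2 partials_F2]
  \<comment> \<open>The derivatives of \<open>D\<close> are read off from \<open>D * D\<close>, so
    that no square root has to be differentiated.\<close>
  note dd = has_partials_add[OF has_partials_mult[OF g11 g22]
      has_partials_mult[OF has_partials_const[of S "-1"] has_partials_mult[OF g12 g12]]]
  have DD: "D y * D y = (F1 y \<bullet> F1 y) * (F2 y \<bullet> F2 y) + - 1 * ((F1 y \<bullet> F2 y) * (F1 y \<bullet> F2 y))" if "y \<in> S" for y
    using D_sq[OF that] by (simp add: det_first_form)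
  note dd' = has_partials_cong[OF has_partials_mult[OF Dp Dp] DD refl refl]
  have 5: "D x * D1 x = ?g22 * (F1 x \<bullet> F11 x) + ?g11 * (F2 x \<bullet> F21 x) - ?g12 * (F11 x \<bullet> F2 x + F1 x \<bullet> F21 x)"
    using has_partials_unique(1)[OF open_S x dd' dd] by (simp add: inner_commute algebra_simps)
  have 6: "D x * D2 x = ?g22 * (F1 x \<bullet> F12 x) + ?g11 * (F2 x \<bullet> F22 x) - ?g12 * (F12 x \<bullet> F2 x + F1 x \<bullet> F22 x)"
    using has_partials_unique(2)[OF open_S x dd' dd] by (simp add: inner_commute algebra_simps)
  have PN: "D x * (P x \<bullet> v) = ?g22 * (F1 x \<bullet> v) - ?g12 * (F2 x \<bullet> v)"
    "D x * (N x \<bullet> v) = ?g11 * (F2 x \<bullet> v) - ?g12 * (F1 x \<bullet> v)" for v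
    using D(1) by (simp_all add: P_def N_def inner_simps field_simps)
  have "D x * ((P1 x + N2 x) \<bullet> F1 x) = D x * D1 x - D x * (P x \<bullet> F11 x) - D x * (N x \<bullet> F12 x)"
  proof -
    have "(P1 x + N2 x) \<bullet> F1 x = D1 x - P x \<bullet> F11 x - N x \<bullet> F12 x" using 1 3 by (simp add: inner_add_left)
    then show ?thesis by (simp only: right_diff_distrib)
  qed
  also have "\<dots> = 0" unfolding 5 PN sym by (simp add: inner_commute algebra_simps)
  finally have o1: "(P1 x + N2 x) \<bullet> F1 x = 0" using D(1) by simp
  have "D x * ((P1 x + N2 x) \<bullet> F2 x) = D x * D2 x - D x * (P x \<bullet> F21 x) - D x * (N x \<bullet> F22 x)"
  proof -
    have "(P1 x + N2 x) \<bullet> F2 x = D2 x - P x \<bullet> F21 x - N x \<bullet> F22 x" using 2 4 by (simp add: inner_add_left)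
    then show ?thesis by (simp only: right_diff_distrib)
  qed
  also have "\<dots> = 0" unfolding 6 PN sym by (simp add: inner_commute algebra_simps)
  finally have o2: "(P1 x + N2 x) \<bullet> F2 x = 0" using D(1) by simp
  \<comment> \<open>The divergence is tangent by \<open>st\<close> and orthogonal to both
    \<open>F1\<close> and \<open>F2\<close>, hence orthogonal to itself.\<close>
  have "(P1 x + N2 x) \<bullet> (P1 x + N2 x) = 0"
    by (subst (2) st) (simp only: inner_add_right inner_scaleR_right o1 o2 mult_zero_right add_0_right)
  then show ?thesis by simp
qed

text \<open>By the product rule the divergence of (\<open>U \<bullet> P\<close>,
  \<open>U \<bullet> N\<close>) is the pairing plus the inner product of \<open>U\<close> with the
  divergence of the flux, which is zero. Compact support in \<open>S\<close> allows an extension by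
  zero to the whole half-plane.\<close>

lemma green_formula:
  assumes U: "C1_on S U" and K: "compact K" "K \<subseteq> S" and supp: "\<And>x. x \<in> S \<Longrightarrow> x \<notin> K \<Longrightarrow> U x = 0"
  shows "integral S (grad_pairing S F U) = - integral {t. vector [t, 0] \<in> S} (\<lambda>t. U (vector [t, 0]) \<bullet> N (vector [t, 0]))"
proof -
  have SH: "S \<subseteq> half_plane" using open_S by (rule openin_imp_subset)
  have Up: "has_partials S U (partial S U 1) (partial S U 2)" by (rule C1_on_has_partials[OF U open_S])
  \<comment> \<open>Two relatively open sets cover the half-plane: \<open>S\<close>, where the
    function is an inner product of C^1 functions, and the complement of \<open>K\<close>, where it
    is 0.\<close>
  have ext: "C1_on half_plane (\<lambda>x. if x \<in> S then U x \<bullet> Q x else 0)" if Q: "C1_on S Q" for Q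
  proof (rule C1_on_local)
    fix x assume x: "x \<in> half_plane"
    show "\<exists>W. openin (top_of_set half_plane) W \<and> x \<in> W \<and> W \<subseteq> half_plane \<and>
        C1_on W (\<lambda>x. if x \<in> S then U x \<bullet> Q x else 0)"
    proof (cases "x \<in> S")
      case True
      have "C1_on S (\<lambda>x. if x \<in> S then U x \<bullet> Q x else 0)"
        by (rule C1_on_cong[OF C1_on_inner[OF U Q]]) simp
      then show ?thesis using True open_S SH by blast
    next
      case False
      have "openin (top_of_set half_plane) (half_plane \<inter> - K)"
        using compact_imp_closed[OF K(1)] by (intro openin_open_Int open_Compl)
      moreover have "C1_on (half_plane \<inter> - K) (\<lambda>x. if x \<in> S then U x \<bullet> Q x else 0)"
        by (rule C1_on_cong[OF C1_on_const[of _ 0]]) (use supp in auto)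
      ultimately show ?thesis using False K(2) x by (intro exI[of _ "half_plane \<inter> - K"]) auto
    qed
  qed simp
  define V where "V Q x = (if x \<in> S then U x \<bullet> Q x else 0)" for Q x
  have V: "has_partials half_plane (V Q) (partial half_plane (V Q) 1) (partial half_plane (V Q) 2)" if "C1_on S Q" for Q
    unfolding V_def by (intro C1_on_has_partials ext that openin_subtopology_self)
  have V0: "V Q x = 0" if "x \<in> half_plane" "x \<notin> K" for Q x using supp that by (auto simp: V_def)
  have VS: "partial half_plane (V Q) 1 x = partial S U 1 x \<bullet> Q x + U x \<bullet> Q1 x"
    "partial half_plane (V Q) 2 x = partial S U 2 x \<bullet> Q x + U x \<bullet> Q2 x"
    if Q: "has_partials S Q Q1 Q2" and x: "x \<in> S" for Q Q1 Q2 x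
  proof -
    have "has_partials S (V Q) (\<lambda>x. partial S U 1 x \<bullet> Q x + U x \<bullet> Q1 x) (\<lambda>x. partial S U 2 x \<bullet> Q x + U x \<bullet> Q2 x)"
      by (rule has_partials_cong[OF has_partials_inner[OF Up Q]]) (simp_all add: V_def)
    note u = has_partials_unique[OF open_S x has_partials_subset[OF V[OF C1_onI[OF Q]] SH] this]
    show "partial half_plane (V Q) 1 x = partial S U 1 x \<bullet> Q x + U x \<bullet> Q1 x" by (rule u(1))
    show "partial half_plane (V Q) 2 x = partial S U 2 x \<bullet> Q x + U x \<bullet> Q2 x" by (rule u(2))
  qed
  note divP = half_plane_divergence[OF V[OF C1_P] K(1) V0]
  note divN = half_plane_divergence[OF V[OF C1_N] K(1) V0]
  obtain P1 P2 N1 N2 where PN: "has_partials S P P1 P2" "has_partials S N N1 N2"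
    using C1_P C1_N unfolding C1_on_def by metis
  have eq: "partial half_plane (V P) 1 x + partial half_plane (V N) 2 x = (if x \<in> S then grad_pairing S F U x else 0)"
    if x: "x \<in> half_plane" for x
  proof (cases "x \<in> S")
    case True
    have "partial half_plane (V P) 1 x + partial half_plane (V N) 2 x
        = partial S U 1 x \<bullet> P x + partial S U 2 x \<bullet> N x + U x \<bullet> (P1 x + N2 x)"
      unfolding VS(1)[OF PN(1) True] VS(2)[OF PN(2) True] by (simp add: inner_add_right)
    then show ?thesis using True flux_divergence_free[OF True PN] by (simp add: grad_pairing_flux)
  next
    case False
    then have xK: "x \<notin> K" using K(2) by blast
    show ?thesis
      using half_plane_partials_vanish[OF V[OF C1_P] compact_imp_closed[OF K(1)] V0 x xK]
        half_plane_partials_vanish[OF V[OF C1_N] compact_imp_closed[OF K(1)] V0 x xK] False by simp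
  qed
  have "integral S (grad_pairing S F U) = integral half_plane (\<lambda>x. if x \<in> S then grad_pairing S F U x else 0)"
    using SH by (simp add: Henstock_Kurzweil_Integration.integral_restrict_Int inf.absorb1)
  also have "\<dots> = integral half_plane (\<lambda>x. partial half_plane (V P) 1 x + partial half_plane (V N) 2 x)"
    by (intro integral_cong) (simp add: eq)
  also have "\<dots> = integral half_plane (partial half_plane (V P) 1) + integral half_plane (partial half_plane (V N) 2)"
    by (intro integral_add set_lebesgue_integral_eq_integral(1) divP(1) divN(2))
  also have "\<dots> = - integral UNIV (\<lambda>t. V N (vector [t, 0]))" using divP(3) divN(4) by simp
  also have "(\<lambda>t. V N (vector [t, 0])) = (\<lambda>t. if t \<in> {t. vector [t, 0] \<in> S} then U (vector [t, 0]) \<bullet> N (vector [t, 0]) else 0)"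
    by (auto simp: V_def)
  finally show ?thesis by (simp only: Henstock_Kurzweil_Integration.integral_restrict_UNIV)
qed

end

section \<open>Changes of charts\<close>

definition edge :: "real \<Rightarrow> real^2" where "edge t = vector [t, 0]"

lemma edge_nth [simp]: "edge t $ 1 = t" "edge t $ 2 = 0"
  by (simp_all add: edge_def)

lemma edge_eq_iff: "x = edge t \<longleftrightarrow> x $ 1 = t \<and> x $ 2 = 0"
  by (auto simp: edge_def vec_eq_iff forall_2)

lemma continuous_edge: "continuous_on S edge"
  unfolding edge_def by (intro continuous_on_vector2 continuous_intros)

lemma has_derivative_edge: "(edge has_derivative edge) F"
  unfolding edge_def[abs_def] by (intro has_derivative_vector2 has_derivative_ident has_derivative_const)

lemma compact_vimage_edge:
  assumes "compact K" shows "compact (edge -` K)"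
proof -
  obtain B where B: "\<And>x. x \<in> K \<Longrightarrow> norm x \<le> B" using compact_imp_bounded[OF assms] bounded_iff by metis
  have "\<bar>t\<bar> \<le> B" if "edge t \<in> K" for t
    using B[OF that] component_le_norm_cart[of "edge t" 1] by simp
  then have "bounded (edge -` K)" by (auto simp: bounded_real)
  moreover have "closed (edge -` K)"
    using compact_imp_closed[OF assms] continuous_edge by (metis closed_vimage)
  ultimately show ?thesis by (simp add: compact_eq_bounded_closed)
qed

lemma edge_half_plane: "edge t \<in> half_plane"
  by (simp add: half_plane_def)

lemma open_edge:
  assumes "openin (top_of_set half_plane) S" shows "open {t. edge t \<in> S}"
proof -
  obtain G where G: "open G" "S = half_plane \<inter> G" using assms by (auto simp: openin_open)
  then have "{t. edge t \<in> S} = edge -` G" using edge_half_plane by auto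
  then show ?thesis using open_vimage[OF G(1) continuous_edge] by simp
qed

section \<open>Transition maps and transformation laws\<close>

context compact_surface
begin

definition overlap :: "'m chart \<Rightarrow> 'm chart \<Rightarrow> (real^2) set" where
  "overlap c d = coord c ` (dom_of c \<inter> dom_of d)"

definition transition :: "'m chart \<Rightarrow> 'm chart \<Rightarrow> real^2 \<Rightarrow> real^2" where
  "transition c d x = coord d (coord_inv c x)"

lemma open_overlap: "c \<in> A \<Longrightarrow> d \<in> A \<Longrightarrow> openin (top_of_set half_plane) (overlap c d)"
  unfolding overlap_def by (rule overlap_open)

lemma overlap_subset: "overlap c d \<subseteq> cod_of c"
  by (auto simp: overlap_def)

lemma C1_transition:
  assumes "c \<in> A" "d \<in> A"
  shows "C1_on (overlap c d) (transition c d)"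
proof -
  have "smooth_on (overlap c d) (coord d \<circ> coord_inv c)"
    using surface assms by (simp add: smooth_surface_def overlap_def)
  moreover have "coord d \<circ> coord_inv c = transition c d" by (auto simp: transition_def)
  ultimately show ?thesis using smooth_on_C1_on(1)[OF open_overlap[OF assms]] by metis
qed

lemma transition_overlap:
  assumes cd: "c \<in> A" "d \<in> A" and x: "x \<in> overlap c d"
  shows "transition c d x \<in> overlap d c" "transition d c (transition c d x) = x"
    "coord_inv d (transition c d x) = coord_inv c x"
proof -
  obtain p where p: "p \<in> dom_of c" "p \<in> dom_of d" "x = coord c p" using x by (auto simp: overlap_def)
  then show "transition c d x \<in> overlap d c" "transition d c (transition c d x) = x"
    "coord_inv d (transition c d x) = coord_inv c x"
    using chart_inverse(1)[OF cd(1)] chart_inverse(1)[OF cd(2)] by (auto simp: transition_def overlap_def)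
qed

lemma transition_image:
  assumes cd: "c \<in> A" "d \<in> A" and E: "E \<subseteq> dom_of c \<inter> dom_of d"
  shows "transition c d ` coord c ` E = coord d ` E" "inj_on (transition c d) (coord c ` E)"
    "coord c ` E \<subseteq> overlap c d"
proof -
  have "transition c d (coord c p) = coord d p" if "p \<in> E" for p
    using that E chart_inverse(1)[OF cd(1)] by (auto simp: transition_def)
  then show "transition c d ` coord c ` E = coord d ` E" by (force simp: image_image)
  show sub: "coord c ` E \<subseteq> overlap c d" using E by (auto simp: overlap_def)
  show "inj_on (transition c d) (coord c ` E)"
    by (rule inj_on_inverseI[of _ "transition d c"]) (use sub transition_overlap(2)[OF cd] in auto)
qed

lemma local_rep_transition:
  assumes "c \<in> A" "d \<in> A" "x \<in> overlap c d"
  shows "local_rep d u (transition c d x) = local_rep c u x"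
  using transition_overlap(3)[OF assms] by (simp add: local_rep_def)

lemma partials_transition:
  assumes cd: "c \<in> A" "d \<in> A"
  shows "has_partials (overlap c d) (transition c d)
    (partial (overlap c d) (transition c d) 1) (partial (overlap c d) (transition c d) 2)"
  by (rule C1_on_has_partials[OF C1_transition[OF cd] open_overlap[OF cd]])

lemma partial_transition:
  fixes u :: "'m \<Rightarrow> 'b::euclidean_space"
  assumes cd: "c \<in> A" "d \<in> A" and u: "C1_on (cod_of c) (local_rep c u)" "C1_on (cod_of d) (local_rep d u)"
    and x: "x \<in> overlap c d"
  shows "partial (cod_of c) (local_rep c u) i x =
    partial (overlap c d) (transition c d) i x $ 1 *\<^sub>R partial (cod_of d) (local_rep d u) 1 (transition c d x) +
    partial (overlap c d) (transition c d) i x $ 2 *\<^sub>R partial (cod_of d) (local_rep d u) 2 (transition c d x)"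
proof -
  have sub: "transition c d ` overlap c d \<subseteq> cod_of d"
    using transition_overlap(1)[OF cd] overlap_subset by blast
  note chain = has_partials_chain[OF partials_transition[OF cd]
      C1_on_has_partials[OF u(2) chart_cod_open[OF cd(2)]] sub]
  note chain' = has_partials_cong[OF chain local_rep_transition[OF cd] refl refl]
  note c = has_partials_subset[OF C1_on_has_partials[OF u(1) chart_cod_open[OF cd(1)]] overlap_subset]
  note uniq = has_partials_unique[OF open_overlap[OF cd] x c chain']
  show ?thesis using uniq exhaust_2[of i] by auto
qed

text \<open>If the point were interior in the chart \<open>d\<close>, the second coordinate of the
  transition to \<open>c\<close> would have a local minimum there, and the differential of an
  invertible C^1 map with C^1 inverse would be singular.\<close>

lemma boundary_chart_independent:
  assumes cd: "c \<in> A" "d \<in> A" and p: "p \<in> dom_of c" "p \<in> dom_of d" and b: "coord c p $ 2 = 0"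
  shows "coord d p $ 2 = 0"
proof (rule ccontr)
  assume "coord d p $ 2 \<noteq> 0"
  define y where "y = coord d p"
  have y: "y \<in> overlap d c" using p by (auto simp: y_def overlap_def)
  have sub: "overlap d c \<subseteq> half_plane" using open_overlap[OF cd(2,1)] by (rule openin_imp_subset)
  then have y2: "y $ 2 > 0" using y \<open>coord d p $ 2 \<noteq> 0\<close> by (auto simp: half_plane_def y_def)
  let ?t = "transition d c" and ?s = "transition c d"
  have ty: "?t y = coord c p" using p chart_inverse(1)[OF cd(2)] by (simp add: y_def transition_def)
  have min: "(?t z) $ 2 \<ge> (?t y) $ 2" if "z \<in> overlap d c" for z
    using transition_overlap(1)[OF cd(2,1) that] openin_imp_subset[OF open_overlap[OF cd]] b ty
    by (auto simp: half_plane_def)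
  obtain G where G: "open G" "overlap d c = half_plane \<inter> G"
    using open_overlap[OF cd(2,1)] by (auto simp: openin_open)
  \<comment> \<open>Where the second coordinate is positive the derivative is two-sided, as the
    criterion for local extrema requires.\<close>
  let ?G = "G \<inter> {z. 0 < z $ 2}"
  have oG: "open ?G" using G(1) by (intro open_Int open_Collect_less continuous_intros)
  have "{z. 0 < z $ 2} \<subseteq> half_plane" by (auto simp: half_plane_def)
  then have subG: "?G \<subseteq> overlap d c" unfolding G(2) by blast
  have yG: "y \<in> ?G" using y G(2) y2 by auto
  have "(?t has_derivative (\<lambda>v. v $ 1 *\<^sub>R partial (overlap d c) ?t 1 y + v $ 2 *\<^sub>R partial (overlap d c) ?t 2 y)) (at y within ?G)"
    by (rule has_derivative_subset[OF has_partialsD(4)[OF partials_transition[OF cd(2,1)] y] subG])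
  then have "(?t has_derivative (\<lambda>v. v $ 1 *\<^sub>R partial (overlap d c) ?t 1 y + v $ 2 *\<^sub>R partial (overlap d c) ?t 2 y)) (at y)"
    by (simp only: at_within_open[OF yG oG])
  then have "((\<lambda>z. ?t z $ 2) has_derivative (\<lambda>v. (v $ 1 *\<^sub>R partial (overlap d c) ?t 1 y + v $ 2 *\<^sub>R partial (overlap d c) ?t 2 y) $ 2)) (at y)"
    by (rule bounded_linear.has_derivative[OF bounded_linear_vec_nth])
  moreover have "\<forall>z\<in>?G. ?t y $ 2 \<le> ?t z $ 2" using min subG by blast
  ultimately have "(\<lambda>v::real^2. (v $ 1 *\<^sub>R partial (overlap d c) ?t 1 y + v $ 2 *\<^sub>R partial (overlap d c) ?t 2 y) $ 2) = (\<lambda>v. 0)"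
    using differential_zero_maxmin[OF yG oG] by blast
  note D0 = fun_cong[OF this]
  have D: "partial (overlap d c) ?t i y $ 2 = 0" for i
    using D0[of "axis 1 1"] D0[of "axis 2 1"] exhaust_2[of i] by auto
  have img: "?t ` overlap d c \<subseteq> overlap c d" using transition_overlap(1)[OF cd(2,1)] by blast
  \<comment> \<open>By the chain rule for the composition with the inverse transition, both
    coordinate vectors would be multiples of one vector, a value of
    \<open>partial (overlap c d) ?s 1\<close>.\<close>
  note chain = has_partials_cong[OF has_partials_chain[OF partials_transition[OF cd(2,1)] partials_transition[OF cd] img]
      transition_overlap(2)[OF cd(2,1)] refl refl]
  note uniq = has_partials_unique[OF open_overlap[OF cd(2,1)] y chain has_partials_ident]
  show False
    using arg_cong[OF uniq(1), of "\<lambda>v. v $ 1"] arg_cong[OF uniq(1), of "\<lambda>v. v $ 2"]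
      arg_cong[OF uniq(2), of "\<lambda>v. v $ 2"] by (auto simp: D)
qed

text \<open>Scaling by the absolute Jacobian is what the change of variables theorem asks for in a
  transfer between charts.\<close>

lemma area_densityI:
  assumes cont: "\<And>c. c \<in> A \<Longrightarrow> continuous_on (cod_of c) (\<theta> c)"
    and law: "\<And>c d x. c \<in> A \<Longrightarrow> d \<in> A \<Longrightarrow> x \<in> overlap c d \<Longrightarrow>
      \<theta> c x = \<bar>partial (overlap c d) (transition c d) 1 x $ 1 * partial (overlap c d) (transition c d) 2 x $ 2
        - partial (overlap c d) (transition c d) 1 x $ 2 * partial (overlap c d) (transition c d) 2 x $ 1\<bar>
        * \<theta> d (transition c d x)"
  shows "surface_density M A (\<lambda>x. x) \<theta>"
proof unfold_locales
  show "continuous_on (slice (\<lambda>x. x) c (dom_of c)) (\<theta> c)" if "c \<in> A" for c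
    using cont[OF that] by (simp add: slice_def)
next
  fix c d E
  assume cd: "c \<in> A" "d \<in> A" and E: "E \<subseteq> dom_of c \<inter> dom_of d" and B: "coord c ` E \<in> sets borel"
    and int: "\<theta> c absolutely_integrable_on slice (\<lambda>x. x) c E"
  let ?B = "coord c ` E" and ?t = "transition c d"
  let ?p = "partial (overlap c d) ?t"
  let ?g' = "\<lambda>x v::real^2. v $ 1 *\<^sub>R ?p 1 x + v $ 2 *\<^sub>R ?p 2 x"
  note img = transition_image[OF cd E]
  have det: "det (matrix (?g' x)) = ?p 1 x $ 1 * ?p 2 x $ 2 - ?p 1 x $ 2 * ?p 2 x $ 1" for x
    by (simp add: det_2 matrix_def algebra_simps)
  have eq: "\<theta> c x = \<bar>det (matrix (?g' x))\<bar> * \<theta> d (?t x)" if "x \<in> ?B" for x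
    unfolding det using law[OF cd] img(3) that by blast
  \<comment> \<open>\<open>vec\<close> makes the density vector valued, as the change of variables
    theorem wants it; \<open>cov\<close> returns to scalars.\<close>
  have "(\<lambda>x. \<bar>det (matrix (?g' x))\<bar> *\<^sub>R (vec (\<theta> d (?t x)) :: real^1)) absolutely_integrable_on ?B \<and>
      integral ?B (\<lambda>x. \<bar>det (matrix (?g' x))\<bar> *\<^sub>R (vec (\<theta> d (?t x)) :: real^1)) = vec b \<longleftrightarrow>
      (\<lambda>x. vec (\<theta> d x) :: real^1) absolutely_integrable_on (?t ` ?B) \<and>
      integral (?t ` ?B) (\<lambda>x. vec (\<theta> d x) :: real^1) = vec b" for b
  proof (rule has_absolute_integral_change_of_variables)
    show "?B \<in> sets lebesgue" using B by (metis sets_completionI_sets sets_lborel)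
    show "(?t has_derivative ?g' x) (at x within ?B)" if "x \<in> ?B" for x
      using has_derivative_subset[OF has_partialsD(4)[OF partials_transition[OF cd]] img(3)] img(3) that by blast
    show "inj_on ?t ?B" by (rule img(2))
  qed
  then have cov: "(\<lambda>x. \<bar>det (matrix (?g' x))\<bar> * \<theta> d (?t x)) absolutely_integrable_on ?B \<and>
      integral ?B (\<lambda>x. \<bar>det (matrix (?g' x))\<bar> * \<theta> d (?t x)) = b \<longleftrightarrow>
      \<theta> d absolutely_integrable_on (?t ` ?B) \<and> integral (?t ` ?B) (\<theta> d) = b" for b
    by (simp add: absolutely_integrable_on_1_iff integral_on_1_eq)
  have "(\<lambda>x. \<bar>det (matrix (?g' x))\<bar> * \<theta> d (?t x)) absolutely_integrable_on ?B"
    using int set_integrable_cong[of lebesgue lebesgue ?B ?B, OF refl refl eq] by (simp add: slice_def)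
  moreover have "integral ?B (\<lambda>x. \<bar>det (matrix (?g' x))\<bar> * \<theta> d (?t x)) = integral ?B (\<theta> c)"
    by (rule integral_cong) (simp add: eq)
  ultimately have "\<theta> d absolutely_integrable_on (?t ` ?B) \<and> integral (?t ` ?B) (\<theta> d) = integral ?B (\<theta> c)"
    using cov by blast
  then show "\<theta> d absolutely_integrable_on slice (\<lambda>x. x) d E \<and>
      integral (slice (\<lambda>x. x) d E) (\<theta> d) = integral (slice (\<lambda>x. x) c E) (\<theta> c)"
    by (simp add: slice_def img(1))
qed (auto simp: continuous_on_id vimage_def)

text \<open>Boundary points stay boundary points under a transition, so it maps the boundary line
  into itself: along the line its second component is constantly 0 and its first is the change of
  the boundary parameter.\<close>

lemma edge_transition:
  assumes cd: "c \<in> A" "d \<in> A" and t: "edge t \<in> overlap c d"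
  shows "transition c d (edge t) = edge (transition c d (edge t) $ 1)"
    "((\<lambda>t. transition c d (edge t) $ 1) has_real_derivative partial (overlap c d) (transition c d) 1 (edge t) $ 1) (at t)"
    "partial (overlap c d) (transition c d) 1 (edge t) $ 2 = 0"
proof -
  have zero: "transition c d (edge s) $ 2 = 0" if "edge s \<in> overlap c d" for s
  proof -
    obtain p where "p \<in> dom_of c" "p \<in> dom_of d" "edge s = coord c p" using \<open>edge s \<in> overlap c d\<close> by (auto simp: overlap_def)
    then show ?thesis
      using boundary_chart_independent[OF cd, of p] chart_inverse(1)[OF cd(1), of p] edge_nth(2)[of s]
      by (simp add: transition_def)
  qed
  then show "transition c d (edge t) = edge (transition c d (edge t) $ 1)" using t by (simp add: edge_eq_iff)
  let ?O = "{t. edge t \<in> overlap c d}" and ?p = "partial (overlap c d) (transition c d)"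
  have o: "open ?O" by (rule open_edge[OF open_overlap[OF cd]])
  have "((\<lambda>t. transition c d (edge t)) has_derivative (\<lambda>h. edge h $ 1 *\<^sub>R ?p 1 (edge t) + edge h $ 2 *\<^sub>R ?p 2 (edge t))) (at t within ?O)"
    by (rule has_derivative_in_compose2[OF has_partialsD(4)[OF partials_transition[OF cd]] _ _ has_derivative_edge])
      (use t in auto)
  then have der: "((\<lambda>t. transition c d (edge t)) has_derivative (\<lambda>h. h *\<^sub>R ?p 1 (edge t))) (at t)"
    using at_within_open[OF _ o, of t] t by simp
  have comp: "((\<lambda>t. transition c d (edge t) $ i) has_real_derivative ?p 1 (edge t) $ i) (at t)" for i
    unfolding has_field_derivative_def
    by (rule has_derivative_eq_rhs[OF bounded_linear.has_derivative[OF bounded_linear_vec_nth der]]) auto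
  show "((\<lambda>t. transition c d (edge t) $ 1) has_real_derivative ?p 1 (edge t) $ 1) (at t)" by (rule comp)
  have "((\<lambda>t. 0) has_real_derivative ?p 1 (edge t) $ 2) (at t)"
    by (rule has_field_derivative_transform_within_open[OF comp o]) (use t zero in auto)
  then show "?p 1 (edge t) $ 2 = 0" using DERIV_unique DERIV_const by metis
qed

text \<open>One-dimensional counterpart of \<open>area_densityI\<close>, with the derivative of the
  change of boundary parameter as Jacobian.\<close>

lemma boundary_densityI:
  assumes cont: "\<And>c. c \<in> A \<Longrightarrow> continuous_on {t. edge t \<in> cod_of c} (\<theta> c)"
    and law: "\<And>c d t. c \<in> A \<Longrightarrow> d \<in> A \<Longrightarrow> edge t \<in> overlap c d \<Longrightarrow>
      \<theta> c t = \<bar>partial (overlap c d) (transition c d) 1 (edge t) $ 1\<bar> * \<theta> d (transition c d (edge t) $ 1)"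
  shows "surface_density M A edge \<theta>"
proof unfold_locales
  show "continuous_on (slice edge c (dom_of c)) (\<theta> c)" if "c \<in> A" for c
    using cont[OF that] by (simp add: slice_def)
  show "compact (edge -` K)" if "compact K" for K using compact_vimage_edge[OF that] .
next
  fix c d E
  assume cd: "c \<in> A" "d \<in> A" and E: "E \<subseteq> dom_of c \<inter> dom_of d" and B: "coord c ` E \<in> sets borel"
    and int: "\<theta> c absolutely_integrable_on slice edge c E"
  let ?B = "slice edge c E" and ?s = "\<lambda>t. transition c d (edge t) $ 1"
  let ?g' = "\<lambda>t. partial (overlap c d) (transition c d) 1 (edge t) $ 1"
  have sub: "edge t \<in> overlap c d" if "t \<in> slice edge c E" for t
    using that transition_image(3)[OF cd E] by (auto simp: slice_def)
  have sub': "edge t \<in> overlap d c" if "t \<in> slice edge d E" for t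
    using that transition_image(3)[OF cd(2,1), of E] E by (auto simp: slice_def)
  have img: "?s ` ?B = slice edge d E"
  proof (intro set_eqI iffI)
    fix s assume "s \<in> ?s ` ?B"
    then obtain t where t: "t \<in> ?B" "s = ?s t" by auto
    have "edge s = transition c d (edge t)" using edge_transition(1)[OF cd sub[OF t(1)]] t(2) by simp
    also have "\<dots> \<in> coord d ` E" using t(1) transition_image(1)[OF cd E] by (auto simp: slice_def)
    finally show "s \<in> slice edge d E" by (simp add: slice_def)
  next
    fix s assume s: "s \<in> slice edge d E"
    let ?t = "transition d c (edge s) $ 1"
    have t: "edge ?t = transition d c (edge s)" using edge_transition(1)[OF cd(2,1) sub'[OF s]] by simp
    have "transition d c (edge s) \<in> coord c ` E"
      using s transition_image(1)[OF cd(2,1), of E] E by (auto simp: slice_def)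
    then have "?t \<in> ?B" by (simp add: slice_def t)
    moreover have "?s ?t = s" unfolding t transition_overlap(2)[OF cd(2,1) sub'[OF s]] by simp
    ultimately show "s \<in> ?s ` ?B" by (metis image_eqI)
  qed
  have eq: "\<theta> c t = \<bar>?g' t\<bar> * \<theta> d (?s t)" if "t \<in> ?B" for t using law[OF cd sub[OF that]] .
  have cov: "(\<lambda>x. \<bar>?g' x\<bar> * \<theta> d (?s x)) absolutely_integrable_on ?B \<and>
      integral ?B (\<lambda>x. \<bar>?g' x\<bar> * \<theta> d (?s x)) = b \<longleftrightarrow>
      \<theta> d absolutely_integrable_on (?s ` ?B) \<and> integral (?s ` ?B) (\<theta> d) = b" for b
  proof (rule has_absolute_integral_change_of_variables_1')
    have "edge \<in> borel_measurable borel" using continuous_edge by (rule borel_measurable_continuous_onI)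
    from measurable_sets[OF this B] show "?B \<in> sets lebesgue"
      by (auto simp: slice_def vimage_def)
    show "(?s has_real_derivative ?g' t) (at t within ?B)" if "t \<in> ?B" for t
      using edge_transition(2)[OF cd sub[OF that]] by (rule has_field_derivative_at_within)
    show "inj_on ?s ?B"
    proof (rule inj_onI)
      fix t t' assume t: "t \<in> ?B" "t' \<in> ?B" "?s t = ?s t'"
      then have "transition c d (edge t) = transition c d (edge t')"
        using edge_transition(1)[OF cd sub] by metis
      then have "edge t = edge t'" using transition_overlap(2)[OF cd sub] t by metis
      then show "t = t'" using edge_nth(1) by metis
    qed
  qed
  have "(\<lambda>x. \<bar>?g' x\<bar> * \<theta> d (?s x)) absolutely_integrable_on ?B"
    using int set_integrable_cong[of lebesgue lebesgue ?B ?B, OF refl refl eq] by simp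
  moreover have "integral ?B (\<lambda>x. \<bar>?g' x\<bar> * \<theta> d (?s x)) = integral ?B (\<theta> c)"
    by (rule integral_cong) (simp add: eq)
  ultimately show "\<theta> d absolutely_integrable_on slice edge d E \<and>
      integral (slice edge d E) (\<theta> d) = integral (slice edge c E) (\<theta> c)"
    using cov unfolding img by blast
qed (auto simp: continuous_edge)

end

section \<open>Green's formula on a free boundary minimal surface\<close>

text \<open>In every combination of signs the remainder is at most (y - t)^2. The squared positive
  part will serve as a C^1 cut-off.\<close>

lemma DERIV_max_0_power2: "((\<lambda>t::real. (max 0 t)\<^sup>2) has_real_derivative 2 * max 0 t) (at t)"
  unfolding has_field_derivative_def
proof (rule has_derivativeI_sandwich[of 1])
  fix y :: real assume y: "y \<noteq> t"
  have "\<bar>(max 0 y)\<^sup>2 - (max 0 t)\<^sup>2 - 2 * max 0 t * (y - t)\<bar> \<le> (y - t)\<^sup>2"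
  proof (cases "0 \<le> y"; cases "0 \<le> t")
    assume *: "\<not> 0 \<le> y" "0 \<le> t"
    have "\<bar>(max 0 y)\<^sup>2 - (max 0 t)\<^sup>2 - 2 * max 0 t * (y - t)\<bar> = \<bar>t * (t - 2 * y)\<bar>"
      using * by (simp add: power2_eq_square algebra_simps)
    also have "\<dots> = t * (t - 2 * y)" using * by (intro abs_of_nonneg mult_nonneg_nonneg) auto
    also have "\<dots> \<le> (y - t)\<^sup>2" by (simp add: power2_eq_square algebra_simps)
    finally show ?thesis .
  next
    assume *: "0 \<le> y" "\<not> 0 \<le> t"
    have "y\<^sup>2 \<le> (y - t)\<^sup>2" using * by (intro power_mono) auto
    then show ?thesis using * by simp
  next
    assume *: "0 \<le> y" "0 \<le> t"
    have "(max 0 y)\<^sup>2 - (max 0 t)\<^sup>2 - 2 * max 0 t * (y - t) = (y - t)\<^sup>2"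
      using * by (simp add: power2_eq_square algebra_simps)
    then show ?thesis by simp
  qed simp
  then have "norm ((max 0 y)\<^sup>2 - (max 0 t)\<^sup>2 - 2 * max 0 t * (y - t)) / norm (y - t) \<le> (y - t)\<^sup>2 / norm (y - t)"
    by (intro divide_right_mono) auto
  also have "(y - t)\<^sup>2 = norm (y - t) * norm (y - t)" by (simp add: power2_eq_square)
  also have "norm (y - t) * norm (y - t) / norm (y - t) = norm (y - t)"
    by (rule nonzero_mult_div_cancel_right) (use y in simp)
  finally show "norm ((max 0 y)\<^sup>2 - (max 0 t)\<^sup>2 - 2 * max 0 t * (y - t)) / norm (y - t) \<le> norm (y - t)" .
next
  have "((\<lambda>y. norm (y - t)) \<longlongrightarrow> norm (t - t)) (at t)" by (intro tendsto_intros)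
  then show "((\<lambda>y. norm (y - t)) \<longlongrightarrow> 0) (at t)" by simp
qed (auto intro: bounded_linear_mult_right)

lemma C1_on_bump: "C1_on S (\<lambda>z. (max 0 (r\<^sup>2 - (z - x) \<bullet> (z - x)))\<^sup>2)"
proof (rule C1_on_compose_real[where T = UNIV and g = "\<lambda>z. r\<^sup>2 - (z - x) \<bullet> (z - x)"
      and h = "\<lambda>t. (max 0 t)\<^sup>2" and h' = "\<lambda>t. 2 * max 0 t"])
  have "C1_on S (\<lambda>z. r\<^sup>2 + (- 1) * ((z + (- x)) \<bullet> (z + (- x))))"
    by (intro C1_on_add C1_on_mult C1_on_inner C1_on_const C1_onI[OF has_partials_ident])
  then show "C1_on S (\<lambda>z. r\<^sup>2 - (z - x) \<bullet> (z - x))" by simp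
  show "((\<lambda>t::real. (max 0 t)\<^sup>2) has_real_derivative 2 * max 0 t) (at t within UNIV)" for t
    using DERIV_max_0_power2 .
qed (auto intro!: continuous_intros)

section \<open>C^1 maps on the surface and partitions of unity\<close>

context compact_surface
begin

definition C1_map :: "('m \<Rightarrow> 'b::real_normed_vector) \<Rightarrow> bool" where
  "C1_map u \<longleftrightarrow> (\<forall>c\<in>A. C1_on (cod_of c) (local_rep c u))"

lemma C1_mapD: "C1_map u \<Longrightarrow> c \<in> A \<Longrightarrow> C1_on (cod_of c) (local_rep c u)"
  by (simp add: C1_map_def)

lemma C1_map_sum: "(\<And>i. i \<in> I \<Longrightarrow> C1_map (u i)) \<Longrightarrow> C1_map (\<lambda>p. \<Sum>i\<in>I. u i p)"
  unfolding C1_map_def using C1_on_sum[of I] by (fastforce simp: local_rep_def comp_def)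

lemma C1_map_bilinear:
  assumes "bounded_bilinear pr" "C1_map u" "C1_map v" shows "C1_map (\<lambda>p. pr (u p) (v p))"
  unfolding C1_map_def
proof
  fix c assume c: "c \<in> A"
  show "C1_on (cod_of c) (local_rep c (\<lambda>p. pr (u p) (v p)))"
    using C1_on_bilinear[OF assms(1) C1_mapD[OF assms(2) c] C1_mapD[OF assms(3) c]]
    by (simp add: local_rep_def comp_def)
qed

lemma C1_map_inverse:
  fixes u :: "'m \<Rightarrow> real"
  assumes "C1_map u" "\<And>p. p \<in> M \<Longrightarrow> u p \<noteq> 0" shows "C1_map (\<lambda>p. inverse (u p))"
  unfolding C1_map_def
proof
  fix c assume c: "c \<in> A"
  have "local_rep c u x \<noteq> 0" if "x \<in> cod_of c" for x
    using assms(2) chart_inverse(3)[OF c that] chart_cover c by (auto simp: local_rep_def)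
  then show "C1_on (cod_of c) (local_rep c (\<lambda>p. inverse (u p)))"
    using C1_on_inverse[OF C1_mapD[OF assms(1) c]] by (simp add: local_rep_def comp_def)
qed

lemma open_chart_diff:
  assumes d: "d \<in> A" and K: "compact K"
  shows "openin (top_of_set half_plane) (coord d ` (dom_of d - K))"
proof -
  have "openin (top_of_set (dom_of d)) (dom_of d \<inter> - K)"
    by (intro openin_open_Int open_Compl compact_imp_closed K)
  then have "openin (top_of_set (cod_of d)) (coord d ` (dom_of d - K))"
    using homeomorphism_imp_open_map[OF chart_homeo[OF d]] by (simp add: Diff_eq)
  then show ?thesis using chart_cod_open[OF d] openin_trans by blast
qed

lemma partial_vanish:
  fixes u :: "'m \<Rightarrow> 'b::euclidean_space"
  assumes u: "C1_map u" and K: "compact K" and supp: "\<And>p. p \<notin> K \<Longrightarrow> u p = 0"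
    and d: "d \<in> A" and x: "x \<in> coord d ` (dom_of d - K)"
  shows "partial (cod_of d) (local_rep d u) i x = 0"
proof -
  have o: "openin (top_of_set half_plane) (coord d ` (dom_of d - K))" by (rule open_chart_diff[OF d K])
  have sub: "coord d ` (dom_of d - K) \<subseteq> cod_of d" by auto
  have z: "has_partials (coord d ` (dom_of d - K)) (local_rep d u) (\<lambda>x. 0) (\<lambda>x. 0)"
    by (rule has_partials_cong[OF has_partials_const])
      (auto simp: local_rep_def chart_inverse(1)[OF d] supp)
  note c = has_partials_subset[OF C1_on_has_partials[OF C1_mapD[OF u d] chart_cod_open[OF d]] sub]
  show ?thesis using has_partials_unique[OF o x c z] exhaust_2[of i] by auto
qed

definition bump :: "'m chart \<times> (real^2) \<times> real \<Rightarrow> 'm \<Rightarrow> real" where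
  "bump = (\<lambda>(c, x, r) p. if p \<in> dom_of c then (max 0 (r\<^sup>2 - (coord c p - x) \<bullet> (coord c p - x)))\<^sup>2 else 0)"

lemma bump_nonneg: "0 \<le> bump i p"
  by (cases i) (simp add: bump_def)

lemma bump_pos:
  assumes "good_ball i" "p \<in> chart_ball i" shows "0 < bump i p"
proof -
  obtain c x r where i: "i = (c, x, r)" by (rule prod_cases3)
  note g = good_ballD[OF assms(1)[unfolded i]]
  obtain y where y: "y \<in> ball x r" "y \<in> half_plane" "p = coord_inv c y"
    using assms(2) i by (auto simp: chart_ball_def)
  then have "y \<in> cod_of c" using g(3) by auto
  then have "p \<in> dom_of c" "coord c p = y" using chart_inverse(2,3)[OF g(1)] y by auto
  moreover have "(y - x) \<bullet> (y - x) < r\<^sup>2"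
    using y(1) g(2) unfolding power2_norm_eq_inner[symmetric]
    by (intro power_strict_mono) (auto simp: dist_norm norm_minus_commute)
  ultimately show ?thesis by (simp add: bump_def i)
qed

lemma bump_support:
  assumes "good_ball i" "p \<notin> chart_cball i" shows "bump i p = 0"
proof -
  obtain c x r where i: "i = (c, x, r)" by (rule prod_cases3)
  note g = good_ballD[OF assms(1)[unfolded i]]
  have "r\<^sup>2 - (coord c p - x) \<bullet> (coord c p - x) \<le> 0" if p: "p \<in> dom_of c"
  proof (rule ccontr)
    assume "\<not> ?thesis"
    then have "(norm (coord c p - x))\<^sup>2 < r\<^sup>2" by (simp add: power2_norm_eq_inner)
    then have "norm (coord c p - x) < r" using g(2) by (simp add: power2_less_imp_less)
    then have "coord c p \<in> cball x r" by (simp add: dist_norm norm_minus_commute)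
    moreover have "coord c p \<in> half_plane"
      using p chart_cod_open[OF g(1)] by (auto dest: openin_imp_subset)
    ultimately have "p \<in> chart_cball i"
      using chart_inverse(1)[OF g(1) p] unfolding i chart_cball_def
      by (auto intro!: image_eqI[of p _ "coord c p"])
    then show False using assms(2) by simp
  qed
  then show ?thesis by (simp add: bump_def i)
qed

text \<open>In another chart \<open>d\<close> the bump is a composition with the transition on the
  overlap, and 0 off the compact disc; these open sets cover the chart since the disc lies in the
  domain of \<open>c\<close>.\<close>

lemma C1_bump:
  assumes "good_ball i" shows "C1_map (bump i)"
  unfolding C1_map_def
proof
  fix d assume d: "d \<in> A"
  obtain c x r where i: "i = (c, x, r)" by (rule prod_cases3)
  note g = good_ballD[OF assms(1)[unfolded i]]
  have K: "compact (chart_cball i)" "chart_cball i \<subseteq> dom_of c"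
    using compact_chart_cball[OF assms[unfolded i]] i by auto
  show "C1_on (cod_of d) (local_rep d (bump i))"
  proof (rule C1_on_local[OF chart_cod_open[OF d]])
    fix y assume "y \<in> cod_of d"
    then obtain p where p: "p \<in> dom_of d" "y = coord d p" by auto
    show "\<exists>W. openin (top_of_set half_plane) W \<and> y \<in> W \<and> W \<subseteq> cod_of d \<and> C1_on W (local_rep d (bump i))"
    proof (cases "p \<in> dom_of c")
      case True
      have "C1_on (overlap d c) (local_rep d (bump i))"
      proof (rule C1_on_cong[OF C1_on_chain[OF C1_transition[OF d g(1)] C1_on_bump[of UNIV r x] subset_UNIV]])
        fix z assume "z \<in> overlap d c"
        then have "coord_inv d z \<in> dom_of c" using chart_inverse(1)[OF d] by (auto simp: overlap_def)
        then show "(max 0 (r\<^sup>2 - (transition d c z - x) \<bullet> (transition d c z - x)))\<^sup>2 = local_rep d (bump i) z"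
          by (simp add: local_rep_def bump_def i transition_def)
      qed
      then show ?thesis using True p open_overlap[OF d g(1)] overlap_subset
        by (intro exI[of _ "overlap d c"]) (auto simp: overlap_def)
    next
      case False
      have "C1_on (coord d ` (dom_of d - chart_cball i)) (local_rep d (bump i))"
        by (rule C1_on_cong[OF C1_on_const[of _ 0]])
          (auto simp: local_rep_def chart_inverse(1)[OF d] bump_support[OF assms])
      then show ?thesis using False p K(2) open_chart_diff[OF d K(1)]
        by (intro exI[of _ "coord d ` (dom_of d - chart_cball i)"]) auto
    qed
  qed
qed

text \<open>Bumps that are positive on the discs of a finite cover, divided by their sum.\<close>

lemma partition_of_unity:
  obtains I \<psi> where "finite I" "\<And>i. i \<in> I \<Longrightarrow> good_ball i" "\<And>i. i \<in> I \<Longrightarrow> C1_map (\<psi> i :: 'm \<Rightarrow> real)"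
    "\<And>i p. i \<in> I \<Longrightarrow> p \<notin> chart_cball i \<Longrightarrow> \<psi> i p = 0" "\<And>p. p \<in> M \<Longrightarrow> (\<Sum>i\<in>I. \<psi> i p) = 1"
proof -
  obtain I where I: "finite I" "\<And>i. i \<in> I \<Longrightarrow> good_ball i" "M = (\<Union>i\<in>I. chart_ball i)"
    by (rule finite_good_cover) blast
  define b where "b p = (\<Sum>i\<in>I. bump i p)" for p
  have pos: "b p > 0" if pM: "p \<in> M" for p
  proof -
    obtain i where i: "i \<in> I" "p \<in> chart_ball i" using pM unfolding I(3) by blast
    show ?thesis unfolding b_def
      by (rule sum_pos2[OF I(1) i(1)]) (intro bump_pos bump_nonneg I(2) i)+
  qed
  have "C1_map b" unfolding b_def by (intro C1_map_sum C1_bump I(2))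
  then have inv: "C1_map (\<lambda>p. inverse (b p))" using pos by (intro C1_map_inverse) force+
  show thesis
  proof (rule that[of I "\<lambda>i p. bump i p * inverse (b p)"])
    show "C1_map (\<lambda>p. bump i p * inverse (b p))" if "i \<in> I" for i
      by (rule C1_map_bilinear[OF bounded_bilinear_mult C1_bump[OF I(2)[OF that]] inv])
    show "bump i p * inverse (b p) = 0" if "i \<in> I" "p \<notin> chart_cball i" for i p
      using bump_support[OF I(2)] that by simp
    show "(\<Sum>i\<in>I. bump i p * inverse (b p)) = 1" if "p \<in> M" for p
      using pos[OF that] by (simp add: sum_distrib_right[symmetric] b_def[symmetric])
  qed (use I in auto)
qed

end

section \<open>Densities and Green's formula on a free boundary surface\<close>

locale free_boundary_surface = compact_surface M A
  for M :: "'m::t2_space set" and A :: "'m chart set" +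
  fixes f :: "'m \<Rightarrow> 'v::euclidean_space"
  assumes minimal_f: "minimal_immersion A f"
    and in_ball: "f ` M \<subseteq> cball 0 1"
    and on_sphere: "f ` surface_boundary A \<subseteq> sphere 0 1"
    and meets_orthogonally: "meets_unit_sphere_orthogonally A f"
begin

lemma patch: "c \<in> A \<Longrightarrow> minimal_patch (cod_of c) (local_rep c f)"
  using minimal_f chart_cod_open
  by unfold_locales (auto simp: minimal_immersion_def immersion_def)

lemma immersed: "c \<in> A \<Longrightarrow> immersed_patch (cod_of c) (local_rep c f)"
  using patch by (simp add: minimal_patch_def)

lemma C1_f: "C1_map f"
  using immersed_patch.C1_F[OF immersed] by (simp add: C1_map_def)

definition area_density :: "'m chart \<Rightarrow> real^2 \<Rightarrow> real" where
  "area_density c x = sqrt (det (first_form (cod_of c) (local_rep c f) x))"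

definition energy_density :: "('m \<Rightarrow> 'v) \<Rightarrow> 'm chart \<Rightarrow> real^2 \<Rightarrow> real" where
  "energy_density u c = grad_pairing (cod_of c) (local_rep c f) (local_rep c u)"

definition boundary_density :: "('m \<Rightarrow> real) \<Rightarrow> 'm chart \<Rightarrow> real \<Rightarrow> real" where
  "boundary_density w c t = local_rep c w (edge t) * norm (partial (cod_of c) (local_rep c f) 1 (edge t))"

definition surface_integral :: "('m chart \<Rightarrow> real^2 \<Rightarrow> real) \<Rightarrow> real" where
  "surface_integral \<theta> = surface_density.total M A (\<lambda>x. x) \<theta>"

definition boundary_integral :: "('m \<Rightarrow> real) \<Rightarrow> real" where
  "boundary_integral w = surface_density.total M A edge (boundary_density w)"

text \<open>A change of coordinates multiplies both the Gram determinant and the numerator of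
  \<open>grad_pairing\<close> by \<open>J\<^sup>2\<close>; the area element and the quotient
  therefore pick up the absolute value of \<open>J\<close>.\<close>

lemma first_form_transition:
  assumes cd: "c \<in> A" "d \<in> A" and x: "x \<in> overlap c d"
  defines "J \<equiv> partial (overlap c d) (transition c d) 1 x $ 1 * partial (overlap c d) (transition c d) 2 x $ 2
        - partial (overlap c d) (transition c d) 1 x $ 2 * partial (overlap c d) (transition c d) 2 x $ 1"
  shows "area_density c x = \<bar>J\<bar> * area_density d (transition c d x)"
    "C1_map u \<Longrightarrow> energy_density u c x = \<bar>J\<bar> * energy_density u d (transition c d x)"
proof -
  interpret c: immersed_patch "cod_of c" "local_rep c f" by (rule immersed[OF cd(1)])
  interpret d: immersed_patch "cod_of d" "local_rep d f" by (rule immersed[OF cd(2)])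
  let ?y = "transition c d x"
  let ?a = "partial (overlap c d) (transition c d) 1 x $ 1" and ?b = "partial (overlap c d) (transition c d) 1 x $ 2"
    and ?p = "partial (overlap c d) (transition c d) 2 x $ 1" and ?q = "partial (overlap c d) (transition c d) 2 x $ 2"
  note Ff = partial_transition[OF cd C1_mapD[OF C1_f cd(1)] C1_mapD[OF C1_f cd(2)] x]
  have det: "det (first_form (cod_of c) (local_rep c f) x) = J\<^sup>2 * det (first_form (cod_of d) (local_rep d f) ?y)"
    unfolding c.det_first_form d.det_first_form Ff J_def
    by (simp add: inner_simps inner_commute power2_eq_square algebra_simps)
  then show area: "area_density c x = \<bar>J\<bar> * area_density d ?y"
    by (simp add: area_density_def real_sqrt_mult)
  have xc: "x \<in> cod_of c" using x overlap_subset by blast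
  have J: "J \<noteq> 0" using c.det_pos[OF xc] det by auto
  assume u: "C1_map u"
  note Fu = partial_transition[OF cd C1_mapD[OF u cd(1)] C1_mapD[OF u cd(2)] x]
  let ?num = "\<lambda>F1 F2 U1 U2. (F2 \<bullet> F2) * (U1 \<bullet> F1) - (F1 \<bullet> F2) * (U1 \<bullet> F2 + U2 \<bullet> F1) + (F1 \<bullet> F1) * (U2 \<bullet> F2 :: real)"
  have alg: "?num (a *\<^sub>R G1 + b *\<^sub>R G2) (p *\<^sub>R G1 + q *\<^sub>R G2) (a *\<^sub>R V1 + b *\<^sub>R V2) (p *\<^sub>R V1 + q *\<^sub>R V2)
      = (a * q - b * p)\<^sup>2 * ?num G1 G2 V1 V2" for a b p q and G1 G2 V1 V2 :: 'v
  proof -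
    \<comment> \<open>Naming the inner products turns the claim into a polynomial identity.\<close>
    define g11 g12 g22 where "g11 = G1 \<bullet> G1" "g12 = G1 \<bullet> G2" "g22 = G2 \<bullet> G2"
    define v11 v12 v21 v22 where "v11 = V1 \<bullet> G1" "v12 = V1 \<bullet> G2" "v21 = V2 \<bullet> G1" "v22 = V2 \<bullet> G2"
    have g21: "G2 \<bullet> G1 = g12" by (simp add: g11_g12_g22_def inner_commute)
    show ?thesis
      unfolding inner_add_left inner_add_right inner_scaleR_left inner_scaleR_right g21
        g11_g12_g22_def[symmetric] v11_v12_v21_v22_def[symmetric]
      by (simp add: power2_eq_square algebra_simps)
  qed
  \<comment> \<open>Multiplication by the area density clears the denominator; the law for the area
    then accounts for one of the two factors \<open>\<bar>J\<bar>\<close>.\<close>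
  have "energy_density u c x * area_density c x = J\<^sup>2 * (energy_density u d ?y * area_density d ?y)"
  proof -
    have "area_density c x \<noteq> 0" "area_density d ?y \<noteq> 0"
      using c.det_pos[OF xc] area by (auto simp: area_density_def)
    then show ?thesis
      unfolding energy_density_def grad_pairing_def area_density_def[symmetric] Ff Fu alg J_def by simp
  qed
  also have "\<dots> = (\<bar>J\<bar> * energy_density u d ?y) * area_density c x"
  proof -
    have "J\<^sup>2 = \<bar>J\<bar> * \<bar>J\<bar>" by (simp add: power2_eq_square)
    then show ?thesis by (simp only: area mult_ac)
  qed
  finally show "energy_density u c x = \<bar>J\<bar> * energy_density u d ?y"
    using c.det_pos[OF xc] by (simp add: area_density_def)
qed

lemma area_density: "surface_density M A (\<lambda>x. x) area_density"
proof (rule area_densityI)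
  fix c assume "c \<in> A"
  then interpret c: immersed_patch "cod_of c" "local_rep c f" by (rule immersed)
  show "continuous_on (cod_of c) (area_density c)"
    using C1_on_imp_continuous_on[OF c.C1_D] by (simp add: c.D_def[abs_def] area_density_def[abs_def])
qed (rule first_form_transition(1))

lemma energy_density:
  assumes u: "C1_map u" shows "surface_density M A (\<lambda>x. x) (energy_density u)"
proof (rule area_densityI)
  fix c assume cA: "c \<in> A"
  then interpret c: immersed_patch "cod_of c" "local_rep c f" by (rule immersed)
  note up = has_partialsD[OF C1_on_has_partials[OF C1_mapD[OF u cA] chart_cod_open[OF cA]]]
  show "continuous_on (cod_of c) (energy_density u c)"
    unfolding energy_density_def c.grad_pairing_flux[abs_def]
    by (intro continuous_intros up(2,3) C1_on_imp_continuous_on c.C1_P c.C1_N)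
qed (rule first_form_transition(2)[OF _ _ _ u])

lemma boundary_density:
  assumes w: "C1_map w" shows "surface_density M A edge (boundary_density w)"
proof (rule boundary_densityI)
  fix c assume cA: "c \<in> A"
  then interpret c: immersed_patch "cod_of c" "local_rep c f" by (rule immersed)
  have "continuous_on (cod_of c) (\<lambda>x. local_rep c w x * norm (c.F1 x))"
    by (intro continuous_intros C1_on_imp_continuous_on C1_mapD[OF w cA] c.C1_Fi)
  then show "continuous_on {t. edge t \<in> cod_of c} (boundary_density w c)"
    unfolding boundary_density_def by (rule continuous_on_compose2[OF _ continuous_edge]) auto
next
  fix c d t assume cd: "c \<in> A" "d \<in> A" and t: "edge t \<in> overlap c d"
  note Ff = partial_transition[OF cd C1_mapD[OF C1_f cd(1)] C1_mapD[OF C1_f cd(2)] t, of 1]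
  note e = edge_transition(1,3)[OF cd t]
  show "boundary_density w c t = \<bar>partial (overlap c d) (transition c d) 1 (edge t) $ 1\<bar>
      * boundary_density w d (transition c d (edge t) $ 1)"
    unfolding boundary_density_def e(1)[symmetric] local_rep_transition[OF cd t] Ff by (simp add: e(2))
qed

text \<open>Here the orthogonality condition enters: the outward conormal is the position vector,
  while \<open>N\<close> points inward.\<close>

lemma boundary_flux:
  assumes c: "c \<in> A" and t: "edge t \<in> cod_of c"
  shows "immersed_patch.N (cod_of c) (local_rep c f) (edge t)
    = - norm (partial (cod_of c) (local_rep c f) 1 (edge t)) *\<^sub>R local_rep c f (edge t)"
proof -
  interpret c: immersed_patch "cod_of c" "local_rep c f" by (rule immersed[OF c])
  obtain p where p: "p \<in> dom_of c" "coord c p = edge t" using t by (metis imageE)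
  then have "p \<in> surface_boundary A" unfolding surface_boundary_def using c by (auto intro!: bexI[of _ c])
  then have "outward_conormal (cod_of c) (local_rep c f) (coord c p) = f p"
    using meets_orthogonally c p(1) by (auto simp: meets_unit_sphere_orthogonally_def)
  then have "outward_conormal (cod_of c) (local_rep c f) (edge t) = local_rep c f (edge t)"
    using chart_inverse(1)[OF c p(1)] p(2) by (simp add: local_rep_def)
  then show ?thesis using c.conormal_flux[OF t] by simp
qed

text \<open>With the support inside one chart, both totals are single integrals, which
  \<open>green_formula\<close> compares.\<close>

lemma green_local:
  assumes u: "C1_map u" and c: "c \<in> A" and K: "compact K" "K \<subseteq> dom_of c" and supp: "\<And>p. p \<notin> K \<Longrightarrow> u p = 0"
  shows "surface_integral (energy_density u) = boundary_integral (\<lambda>p. u p \<bullet> f p)"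
proof -
  interpret c: minimal_patch "cod_of c" "local_rep c f" by (rule patch[OF c])
  have w: "C1_map (\<lambda>p. u p \<bullet> f p)" by (rule C1_map_bilinear[OF bounded_bilinear_inner u C1_f])
  interpret e: surface_density M A "\<lambda>x. x" "energy_density u" by (rule energy_density[OF u])
  interpret b: surface_density M A edge "boundary_density (\<lambda>p. u p \<bullet> f p)" by (rule boundary_density[OF w])
  have e0: "energy_density u d x = 0" if d: "d \<in> A" "x \<in> slice (\<lambda>x. x) d (dom_of d - dom_of c)" for d x
  proof -
    have x: "x \<in> coord d ` (dom_of d - K)" using d K(2) by (auto simp: slice_def)
    show ?thesis using partial_vanish[OF u K(1) supp d(1) x] by (simp add: energy_density_def grad_pairing_def)
  qed
  have b0: "boundary_density (\<lambda>p. u p \<bullet> f p) d t = 0" if d: "d \<in> A" "t \<in> slice edge d (dom_of d - dom_of c)" for d t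
  proof -
    obtain p where p: "p \<in> dom_of d" "p \<notin> dom_of c" "edge t = coord d p" using d by (auto simp: slice_def)
    then have "u p = 0" using supp K(2) by blast
    then show ?thesis using p chart_inverse(1)[OF d(1) p(1)] by (simp add: boundary_density_def local_rep_def)
  qed
  have "surface_integral (energy_density u) = integral (slice (\<lambda>x. x) c (dom_of c)) (energy_density u c)"
    unfolding surface_integral_def by (rule e.total_supported[OF c e0])
  also have "\<dots> = integral (cod_of c) (grad_pairing (cod_of c) (local_rep c f) (local_rep c u))"
    by (simp add: slice_def energy_density_def)
  also have "\<dots> = - integral {t. vector [t, 0] \<in> cod_of c} (\<lambda>t. local_rep c u (vector [t, 0]) \<bullet> c.N (vector [t, 0]))"
  proof (rule c.green_formula)
    show "C1_on (cod_of c) (local_rep c u)" by (rule C1_mapD[OF u c])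
    show "compact (coord c ` K)"
      using K chart_inverse(5)[OF c] by (meson compact_continuous_image continuous_on_subset)
    show "coord c ` K \<subseteq> cod_of c" using K(2) by blast
    show "local_rep c u x = 0" if "x \<in> cod_of c" "x \<notin> coord c ` K" for x
    proof -
      have "coord_inv c x \<notin> K" using that(2) chart_inverse(2)[OF c that(1)] by (metis image_eqI)
      then show ?thesis using supp by (simp add: local_rep_def)
    qed
  qed
  also have "\<dots> = integral {t. edge t \<in> cod_of c} (\<lambda>t. - (local_rep c u (edge t) \<bullet> c.N (edge t)))"
    by (simp add: edge_def)
  \<comment> \<open>The minus sign of the half-plane formula cancels against that of the inward
    flux.\<close>
  also have "\<dots> = integral {t. edge t \<in> cod_of c} (boundary_density (\<lambda>p. u p \<bullet> f p) c)"
    by (intro integral_cong) (simp add: boundary_flux[OF c] boundary_density_def, simp add: local_rep_def)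
  also have "{t. edge t \<in> cod_of c} = slice edge c (dom_of c)" by (simp add: slice_def)
  also have "integral (slice edge c (dom_of c)) (boundary_density (\<lambda>p. u p \<bullet> f p) c) = boundary_integral (\<lambda>p. u p \<bullet> f p)"
    unfolding boundary_integral_def by (rule b.total_supported[OF c b0, symmetric])
  finally show ?thesis .
qed

text \<open>Both sides are additive in \<open>u\<close>, so it is cut up by a partition of unity;
  the derivatives of the cut-offs cancel because the pieces add up to \<open>u\<close>.\<close>

theorem green:
  assumes u: "C1_map u"
  shows "surface_integral (energy_density u) = boundary_integral (\<lambda>p. u p \<bullet> f p)"
proof -
  obtain I \<psi> where I: "finite I" "\<And>i. i \<in> I \<Longrightarrow> good_ball i" "\<And>i. i \<in> I \<Longrightarrow> C1_map (\<psi> i :: 'm \<Rightarrow> real)"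
    "\<And>i p. i \<in> I \<Longrightarrow> p \<notin> chart_cball i \<Longrightarrow> \<psi> i p = 0" "\<And>p. p \<in> M \<Longrightarrow> (\<Sum>i\<in>I. \<psi> i p) = 1"
    by (rule partition_of_unity) blast
  define v where "v i p = \<psi> i p *\<^sub>R u p" for i p
  have v: "C1_map (v i)" if "i \<in> I" for i
    unfolding v_def by (rule C1_map_bilinear[OF bounded_bilinear_scaleR I(3)[OF that] u])
  have w: "C1_map (\<lambda>p. v i p \<bullet> f p)" if "i \<in> I" for i
    by (rule C1_map_bilinear[OF bounded_bilinear_inner v[OF that] C1_f])
  have w': "C1_map (\<lambda>p. u p \<bullet> f p)" by (rule C1_map_bilinear[OF bounded_bilinear_inner u C1_f])
  have sum_v: "(\<Sum>i\<in>I. local_rep c (v i) x) = local_rep c u x" if "c \<in> A" "x \<in> cod_of c" for c x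
  proof -
    have "coord_inv c x \<in> M" using chart_inverse(3)[OF that] chart_cover that(1) by auto
    then show ?thesis using I(5) by (simp add: local_rep_def v_def scaleR_left.sum[symmetric])
  qed
  have "surface_integral (energy_density u) = (\<Sum>i\<in>I. surface_integral (energy_density (v i)))"
    unfolding surface_integral_def
  proof (rule total_sum[OF I(1) energy_density[OF v] energy_density[OF u]])
    fix c and x :: "real^2" assume c: "c \<in> A" and x: "x \<in> slice (\<lambda>x. x) c (dom_of c)"
    interpret c: immersed_patch "cod_of c" "local_rep c f" by (rule immersed[OF c])
    have x': "x \<in> cod_of c" using x by (simp add: slice_def)
    let ?p = "\<lambda>g i. partial (cod_of c) (local_rep c g) i"
    have "has_partials (cod_of c) (\<lambda>x. \<Sum>i\<in>I. local_rep c (v i) x) (\<lambda>x. \<Sum>i\<in>I. ?p (v i) 1 x) (\<lambda>x. \<Sum>i\<in>I. ?p (v i) 2 x)"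
      by (intro has_partials_sum C1_on_has_partials C1_mapD[OF v] chart_cod_open c)
    from has_partials_cong[OF this sum_v[OF c] refl refl]
    have "?p u 1 x = (\<Sum>i\<in>I. ?p (v i) 1 x)" "?p u 2 x = (\<Sum>i\<in>I. ?p (v i) 2 x)"
      using has_partials_partial[OF _ chart_cod_open[OF c] x'] by blast+
    then show "energy_density u c x = (\<Sum>i\<in>I. energy_density (v i) c x)"
      by (simp add: energy_density_def c.grad_pairing_flux inner_sum_left sum.distrib)
  qed
  also have "\<dots> = (\<Sum>i\<in>I. boundary_integral (\<lambda>p. v i p \<bullet> f p))"
  proof (intro sum.cong refl)
    fix i assume i: "i \<in> I"
    obtain c x r where i': "i = (c, x, r)" by (rule prod_cases3)
    note K = compact_chart_cball[OF I(2)[OF i, unfolded i'], folded i']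
    show "surface_integral (energy_density (v i)) = boundary_integral (\<lambda>p. v i p \<bullet> f p)"
      by (rule green_local[OF v[OF i] good_ballD(1)[OF I(2)[OF i, unfolded i']] K(1,2)])
        (simp add: v_def I(4)[OF i])
  qed
  also have "\<dots> = boundary_integral (\<lambda>p. u p \<bullet> f p)"
    unfolding boundary_integral_def
  proof (rule total_sum[OF I(1) boundary_density[OF w] boundary_density[OF w'], symmetric])
    fix c t assume c: "c \<in> A" and "t \<in> slice edge c (dom_of c)"
    then have t: "edge t \<in> cod_of c" by (simp add: slice_def)
    have "local_rep c (\<lambda>p. u p \<bullet> f p) (edge t) = (\<Sum>i\<in>I. local_rep c (\<lambda>p. v i p \<bullet> f p) (edge t))"
      using sum_v[OF c t] by (simp add: local_rep_def inner_sum_left[symmetric])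
    then show "boundary_density (\<lambda>p. u p \<bullet> f p) c t = (\<Sum>i\<in>I. boundary_density (\<lambda>p. v i p \<bullet> f p) c t)"
      by (simp add: boundary_density_def sum_distrib_right)
  qed
  finally show ?thesis .
qed

section \<open>The area is half the boundary length\<close>

lemma area_eq: "surface_area M A f = surface_integral area_density"
  unfolding surface_area_def surface_integral_def surface_density.total_def[OF area_density]
  by (simp add: slice_def area_density_def[abs_def])

lemma C1_const: "C1_map (\<lambda>p. k)"
  by (simp add: C1_map_def local_rep_def comp_def C1_on_const)

lemma length_eq: "boundary_length M A f = boundary_integral (\<lambda>p. 1)"
  unfolding boundary_length_def boundary_integral_def surface_density.total_def[OF boundary_density[OF C1_const]]
  by (simp add: slice_def boundary_density_def[abs_def] local_rep_def comp_def edge_def)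

lemma norm_boundary:
  assumes "c \<in> A" "edge t \<in> cod_of c" shows "local_rep c f (edge t) \<bullet> local_rep c f (edge t) = 1"
proof -
  obtain p where p: "p \<in> dom_of c" "coord c p = edge t" using assms(2) by (metis imageE)
  then have "p \<in> surface_boundary A" unfolding surface_boundary_def using assms(1) by (auto intro!: bexI[of _ c])
  then have "norm (f p) = 1" using on_sphere by auto
  then show ?thesis
    using chart_inverse(1)[OF assms(1) p(1)] p(2) by (simp add: local_rep_def power2_norm_eq_inner[symmetric])
qed

text \<open>The functions may differ in the interior of the surface. Equality of the totals comes
  from monotonicity in both directions.\<close>

lemma boundary_integral_cong:
  assumes "C1_map w" "C1_map w'" "\<And>c t. c \<in> A \<Longrightarrow> edge t \<in> cod_of c \<Longrightarrow> local_rep c w (edge t) = local_rep c w' (edge t)"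
  shows "boundary_integral w = boundary_integral w'"
  unfolding boundary_integral_def
  by (intro antisym total_mono boundary_density assms) (simp_all add: slice_def boundary_density_def assms(3))

lemma twice_area: "surface_integral (energy_density f) = 2 * surface_area M A f"
proof -
  \<comment> \<open>A constant sum over the two truth values represents the factor 2, so that
    \<open>total_sum\<close> applies.\<close>
  have "surface_integral (energy_density f) = (\<Sum>i\<in>(UNIV :: bool set). surface_integral area_density)"
    unfolding surface_integral_def
  proof (rule total_sum[OF _ area_density energy_density[OF C1_f]])
    fix c and x :: "real^2" assume c: "c \<in> A" and "x \<in> slice (\<lambda>x. x) c (dom_of c)"
    then have x: "x \<in> cod_of c" by (simp add: slice_def)
    interpret c: immersed_patch "cod_of c" "local_rep c f" by (rule immersed[OF c])
    show "energy_density f c x = (\<Sum>i\<in>(UNIV :: bool set). area_density c x)"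
      using c.grad_pairing_identity[OF x] by (simp add: energy_density_def area_density_def c.D_def)
  qed simp
  then show ?thesis by (simp add: area_eq)
qed

lemma area_length: "2 * surface_area M A f = boundary_length M A f"
proof -
  have "2 * surface_area M A f = boundary_integral (\<lambda>p. f p \<bullet> f p)"
    using twice_area green[OF C1_f] by simp
  also have "\<dots> = boundary_integral (\<lambda>p. 1)"
    by (rule boundary_integral_cong[OF C1_map_bilinear[OF bounded_bilinear_inner C1_f C1_f] C1_const])
      (use norm_boundary in \<open>simp add: local_rep_def\<close>)
  finally show ?thesis by (simp add: length_eq)
qed

end

section \<open>The lower bound for the boundary length\<close>

text \<open>The subtracted field is the gradient of log |w - y|^2, so the derivative is the identity
  minus the Hessian of that function.\<close>

lemma has_derivative_log_gradient:
  fixes w y :: "'v::euclidean_space"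
  assumes "w \<noteq> y"
  shows "((\<lambda>w. w - (2 / ((w - y) \<bullet> (w - y))) *\<^sub>R (w - y)) has_derivative
    (\<lambda>v. v - (2 / ((w - y) \<bullet> (w - y))) *\<^sub>R v + (4 * ((w - y) \<bullet> v) / ((w - y) \<bullet> (w - y))\<^sup>2) *\<^sub>R (w - y)))
    (at w within T)"
proof -
  let ?z = "w - y"
  have z: "?z \<bullet> ?z \<noteq> 0" using assms by simp
  have q: "((\<lambda>w. (w - y) \<bullet> (w - y)) has_derivative (\<lambda>v. 2 * (?z \<bullet> v))) (at w within T)"
    by (auto intro!: derivative_eq_intros simp: inner_commute)
  have "((\<lambda>w. 2 * inverse ((w - y) \<bullet> (w - y))) has_derivative
      (\<lambda>v. 2 * - (inverse (?z \<bullet> ?z) * (2 * (?z \<bullet> v)) * inverse (?z \<bullet> ?z)))) (at w within T)"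
    by (rule has_derivative_mult_right[OF Deriv.has_derivative_inverse[OF z q]])
  then have i: "((\<lambda>w. 2 / ((w - y) \<bullet> (w - y))) has_derivative (\<lambda>v. - (4 * (?z \<bullet> v) / (?z \<bullet> ?z)\<^sup>2))) (at w within T)"
    by (simp add: divide_inverse power2_eq_square mult_ac)
  have d: "((\<lambda>w. w - y) has_derivative (\<lambda>v. v)) (at w within T)"
    by (auto intro!: derivative_eq_intros)
  show ?thesis
    by (rule has_derivative_eq_rhs[OF has_derivative_diff[OF has_derivative_ident has_derivative_scaleR[OF i d]]])
      (simp add: fun_eq_iff)
qed

text \<open>The antiderivative is \<open>arctan (k * (t - t0) / a) / (a * k)\<close>. A multiple of
  the integrand will bound the Poisson kernel from below along the boundary curve.\<close>

lemma arctan_integral: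
  fixes a k \<delta> t0 :: real
  assumes "a > 0" "k > 0" "\<delta> > 0"
  shows "((\<lambda>t. 1 / (a\<^sup>2 + k\<^sup>2 * (t - t0)\<^sup>2)) has_integral 2 / (a * k) * arctan (k * \<delta> / a)) {t0 - \<delta>..t0 + \<delta>}"
proof -
  have "((\<lambda>t. 1 / (a\<^sup>2 + k\<^sup>2 * (t - t0)\<^sup>2)) has_integral
      arctan (k * (t0 + \<delta> - t0) / a) / (a * k) - arctan (k * (t0 - \<delta> - t0) / a) / (a * k)) {t0 - \<delta>..t0 + \<delta>}"
  proof (rule fundamental_theorem_of_calculus)
    fix t
    define X where "X = a\<^sup>2 + k\<^sup>2 * (t - t0)\<^sup>2"
    have X: "X > 0" using assms unfolding X_def by (intro add_pos_nonneg) auto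
    have "1 + (k * (t - t0) / a)\<^sup>2 = X / a\<^sup>2"
      using assms by (simp add: X_def power_divide power_mult_distrib add_divide_distrib)
    then have "(k / a) * inverse (1 + (k * (t - t0) / a)\<^sup>2) / (a * k) = 1 / X"
      using assms X by (simp add: power2_eq_square field_simps)
    moreover have "((\<lambda>t. arctan (k * (t - t0) / a) / (a * k)) has_real_derivative
        (k / a) * inverse (1 + (k * (t - t0) / a)\<^sup>2) / (a * k)) (at t within {t0 - \<delta>..t0 + \<delta>})"
      using assms by (auto intro!: derivative_eq_intros)
    ultimately show "((\<lambda>t. arctan (k * (t - t0) / a) / (a * k)) has_vector_derivative
        1 / (a\<^sup>2 + k\<^sup>2 * (t - t0)\<^sup>2)) (at t within {t0 - \<delta>..t0 + \<delta>})"
      by (simp only: has_real_derivative_iff_has_vector_derivative[symmetric] X_def)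
  qed (use assms in auto)
  then show ?thesis by (simp add: arctan_minus)
qed

section \<open>Comparison with the Poisson kernel and its concentration at a boundary point\<close>

context free_boundary_surface
begin

lemma poisson_kernel_le:
  assumes y: "norm y = 1" and R: "R > 1"
  defines "w \<equiv> \<lambda>p. (R\<^sup>2 - 1) * inverse ((f p - R *\<^sub>R y) \<bullet> (f p - R *\<^sub>R y))"
  shows "C1_map w" "boundary_integral w \<le> boundary_length M A f"
proof -
  \<comment> \<open>The coefficient 2 is forced by the boundary values: with z = F - R y, on the
    sphere 2 <z, F> = |z|^2 + 1 - R^2, so it cancels the constant 1 and leaves a pure multiple of 1
    / |z|^2.\<close>
  define u where "u p = f p - (2 / ((f p - R *\<^sub>R y) \<bullet> (f p - R *\<^sub>R y))) *\<^sub>R (f p - R *\<^sub>R y)" for p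
  have ne: "f p \<noteq> R *\<^sub>R y" if "p \<in> M" for p
  proof
    assume "f p = R *\<^sub>R y"
    then have "norm (f p) = R" using y R by simp
    then show False using in_ball that R by auto
  qed
  have ne': "local_rep c f x \<noteq> R *\<^sub>R y" if "c \<in> A" "x \<in> cod_of c" for c x
    using ne chart_inverse(3)[OF that] chart_cover that(1) by (auto simp: local_rep_def)
  let ?W' = "\<lambda>w v. v - (2 / ((w - R *\<^sub>R y) \<bullet> (w - R *\<^sub>R y))) *\<^sub>R v
      + (4 * ((w - R *\<^sub>R y) \<bullet> v) / ((w - R *\<^sub>R y) \<bullet> (w - R *\<^sub>R y))\<^sup>2) *\<^sub>R (w - R *\<^sub>R y)"
  have up: "has_partials (cod_of c) (local_rep c u)
      (\<lambda>x. ?W' (local_rep c f x) (partial (cod_of c) (local_rep c f) 1 x))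
      (\<lambda>x. ?W' (local_rep c f x) (partial (cod_of c) (local_rep c f) 2 x))" if c: "c \<in> A" for c
  proof -
    interpret c: immersed_patch "cod_of c" "local_rep c f" by (rule immersed[OF c])
    have "has_partials (cod_of c)
        (\<lambda>x. local_rep c f x - (2 / ((local_rep c f x - R *\<^sub>R y) \<bullet> (local_rep c f x - R *\<^sub>R y))) *\<^sub>R (local_rep c f x - R *\<^sub>R y))
      (\<lambda>x. ?W' (local_rep c f x) (c.F1 x)) (\<lambda>x. ?W' (local_rep c f x) (c.F2 x))"
    proof (rule has_partials_compose[OF c.partials_F has_derivative_log_gradient])
      show "local_rep c f x \<noteq> R *\<^sub>R y" if "x \<in> cod_of c" for x by (rule ne'[OF c that])
      show "continuous_on (cod_of c) (\<lambda>x. ?W' (local_rep c f x) (c.F1 x))"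
        "continuous_on (cod_of c) (\<lambda>x. ?W' (local_rep c f x) (c.F2 x))"
        using ne'[OF c] by (intro continuous_intros has_partialsD[OF c.partials_F]; simp)+
    qed
    then show ?thesis by (simp add: local_rep_def comp_def u_def)
  qed
  have u: "C1_map u" unfolding C1_map_def using up C1_onI by blast
  have "C1_map (\<lambda>p. (f p + (- (R *\<^sub>R y))) \<bullet> (f p + (- (R *\<^sub>R y))))"
  proof -
    have "C1_map (\<lambda>p. f p + (- (R *\<^sub>R y)))"
      unfolding C1_map_def
    proof
      fix c assume "c \<in> A"
      from C1_on_add[OF C1_mapD[OF C1_f this] C1_on_const]
      show "C1_on (cod_of c) (local_rep c (\<lambda>p. f p + (- (R *\<^sub>R y))))" by (simp only: local_rep_def comp_def)
    qed
    then show ?thesis by (rule C1_map_bilinear[OF bounded_bilinear_inner]) fact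
  qed
  then have "C1_map (\<lambda>p. inverse ((f p - R *\<^sub>R y) \<bullet> (f p - R *\<^sub>R y)))"
    using ne by (intro C1_map_inverse) simp_all
  then show w: "C1_map w"
    unfolding w_def by (rule C1_map_bilinear[OF bounded_bilinear_mult C1_const])
  have "boundary_integral w = boundary_integral (\<lambda>p. u p \<bullet> f p)"
  proof (rule boundary_integral_cong[OF w C1_map_bilinear[OF bounded_bilinear_inner u C1_f]])
    fix c t assume c: "c \<in> A" and t: "edge t \<in> cod_of c"
    let ?F = "local_rep c f (edge t)"
    let ?z = "?F - R *\<^sub>R y"
    have F: "?F \<bullet> ?F = 1" by (rule norm_boundary[OF c t])
    have yy: "y \<bullet> y = 1" using y by (simp add: power2_norm_eq_inner[symmetric])
    have zF: "2 * (?z \<bullet> ?F) = ?z \<bullet> ?z + 1 - R\<^sup>2"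
      using F yy by (simp add: inner_simps inner_commute power2_eq_square algebra_simps)
    have z: "?z \<bullet> ?z \<noteq> 0" using ne'[OF c t] by simp
    have "(?F - (2 / (?z \<bullet> ?z)) *\<^sub>R ?z) \<bullet> ?F = 1 - (2 * (?z \<bullet> ?F)) / (?z \<bullet> ?z)"
      using F by (simp add: inner_diff_left)
    also have "\<dots> = (R\<^sup>2 - 1) * inverse (?z \<bullet> ?z)"
      unfolding zF using z by (simp add: field_simps)
    finally show "local_rep c w (edge t) = local_rep c (\<lambda>p. u p \<bullet> f p) (edge t)"
      by (simp add: local_rep_def w_def u_def)
  qed
  also have "\<dots> = surface_integral (energy_density u)" by (rule green[OF u, symmetric])
  also have "\<dots> \<le> surface_integral (energy_density f)"
    unfolding surface_integral_def
  proof (rule total_mono[OF energy_density[OF u] energy_density[OF C1_f]])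
    fix c and x :: "real^2" assume c: "c \<in> A" and "x \<in> slice (\<lambda>x. x) c (dom_of c)"
    then have x: "x \<in> cod_of c" by (simp add: slice_def)
    interpret c: immersed_patch "cod_of c" "local_rep c f" by (rule immersed[OF c])
    let ?z = "local_rep c f x - R *\<^sub>R y"
    have "grad_pairing (cod_of c) (local_rep c f) (local_rep c u) x \<le> 2 * c.D x"
    proof (rule c.grad_pairing_le[OF x, of ?z])
      show "?z \<noteq> 0" using ne'[OF c x] by simp
      show "partial (cod_of c) (local_rep c u) i x = partial (cod_of c) (local_rep c f) i x
          - (2 / (?z \<bullet> ?z)) *\<^sub>R partial (cod_of c) (local_rep c f) i x
          + (4 * (?z \<bullet> partial (cod_of c) (local_rep c f) i x) / (?z \<bullet> ?z)\<^sup>2) *\<^sub>R ?z" for i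
        using has_partials_partial[OF up[OF c] chart_cod_open[OF c] x] exhaust_2[of i] by auto
    qed
    then show "energy_density u c x \<le> energy_density f c x"
      using c.grad_pairing_identity[OF x] by (simp add: energy_density_def)
  qed
  also have "\<dots> = boundary_length M A f" using twice_area area_length by simp
  finally show "boundary_integral w \<le> boundary_length M A f" .
qed

lemma boundary_curve:
  assumes c: "c \<in> A" and t: "edge t \<in> cod_of c"
  shows "((\<lambda>t. local_rep c f (edge t)) has_derivative (\<lambda>h. h *\<^sub>R partial (cod_of c) (local_rep c f) 1 (edge t))) (at t)"
proof -
  interpret c: immersed_patch "cod_of c" "local_rep c f" by (rule immersed[OF c])
  have "((\<lambda>t. local_rep c f (edge t)) has_derivative (\<lambda>h. edge h $ 1 *\<^sub>R c.F1 (edge t) + edge h $ 2 *\<^sub>R c.F2 (edge t)))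
      (at t within {t. edge t \<in> cod_of c})"
    by (rule has_derivative_in_compose2[OF has_partialsD(4)[OF c.partials_F] _ _ has_derivative_edge]) (use t in auto)
  then show ?thesis using at_within_open[OF _ open_edge[OF chart_cod_open[OF c]], of t] t by simp
qed

text \<open>On a short arc the distance to the point at \<open>t0\<close> grows at rate at most
  \<open>v + \<epsilon>\<close> and the length element is at least \<open>v - \<epsilon>\<close>, so
  the kernel density is bounded below by a rational function of the parameter.
  \<open>\<delta>\<close> does not depend on \<open>R\<close>, which can therefore tend to 1
  afterwards.\<close>

lemma boundary_length_ge_arctan:
  assumes c: "c \<in> A" and t0: "edge t0 \<in> cod_of c"
    and v: "v = norm (partial (cod_of c) (local_rep c f) 1 (edge t0))" and \<epsilon>: "0 < \<epsilon>" "\<epsilon> < v"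
  obtains \<delta> where "\<delta> > 0" "\<And>R. R > 1 \<Longrightarrow>
    2 * (R + 1) * (v - \<epsilon>) / (sqrt R * (v + \<epsilon>)) * arctan (sqrt R * (v + \<epsilon>) * \<delta> / (R - 1)) \<le> boundary_length M A f"
proof -
  interpret c: immersed_patch "cod_of c" "local_rep c f" by (rule immersed[OF c])
  let ?\<gamma> = "\<lambda>t. local_rep c f (edge t)" and ?n = "\<lambda>t. norm (c.F1 (edge t))"
  let ?U = "{t. edge t \<in> cod_of c}"
  have oU: "open ?U" by (rule open_edge[OF chart_cod_open[OF c]])
  have "continuous_on ?U ?n"
    by (intro continuous_on_norm continuous_on_compose2[OF C1_on_imp_continuous_on[OF c.C1_Fi] continuous_edge]) auto
  then have "isCont ?n t0" using continuous_on_eq_continuous_at[OF oU] t0 by blast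
  then obtain d1 where d1: "d1 > 0" "\<And>t. \<bar>t - t0\<bar> < d1 \<Longrightarrow> \<bar>?n t - v\<bar> < \<epsilon>"
    using \<epsilon>(1) unfolding v continuous_at_eps_delta by (auto simp: dist_real_def)
  obtain d2 where d2: "d2 > 0" "\<And>t. \<bar>t - t0\<bar> < d2 \<Longrightarrow> edge t \<in> cod_of c"
    using oU t0 unfolding open_dist by (auto simp: dist_real_def)
  \<comment> \<open>Half the smaller radius, so that the closed interval satisfies both strict
    bounds.\<close>
  define \<delta> where "\<delta> = min d1 d2 / 2"
  have \<delta>: "\<delta> > 0" "\<delta> < d1" "\<delta> < d2" using d1 d2 by (auto simp: \<delta>_def)
  let ?I = "{t0 - \<delta>..t0 + \<delta>}"
  have I: "edge t \<in> cod_of c" "?n t \<le> v + \<epsilon>" "v - \<epsilon> \<le> ?n t" if "t \<in> ?I" for t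
  proof -
    have "\<bar>t - t0\<bar> \<le> \<delta>" using that by auto
    then show "edge t \<in> cod_of c" using d2(2) \<delta> by simp
    have "\<bar>?n t - v\<bar> < \<epsilon>" using d1(2) \<delta> \<open>\<bar>t - t0\<bar> \<le> \<delta>\<close> by simp
    then show "?n t \<le> v + \<epsilon>" "v - \<epsilon> \<le> ?n t" by linarith+
  qed
  have t0I: "t0 \<in> ?I" using \<delta> by simp
  have lip: "norm (?\<gamma> t - ?\<gamma> t0) \<le> (v + \<epsilon>) * \<bar>t - t0\<bar>" if "t \<in> ?I" for t
  proof -
    have "norm (?\<gamma> t - ?\<gamma> t0) \<le> (v + \<epsilon>) * norm (t - t0)"
    proof (rule differentiable_bound[OF convex_real_interval(5)[of "t0 - \<delta>" "t0 + \<delta>"]])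
      show "(?\<gamma> has_derivative (\<lambda>h. h *\<^sub>R c.F1 (edge s))) (at s within ?I)" if "s \<in> ?I" for s
        by (rule has_derivative_at_withinI[OF boundary_curve[OF c I(1)[OF that]]])
      show "onorm (\<lambda>h. h *\<^sub>R c.F1 (edge s)) \<le> v + \<epsilon>" if "s \<in> ?I" for s
        by (rule onorm_le) (use I(2)[OF that] in \<open>simp add: mult.commute mult_left_mono\<close>)
    qed (use that t0I in auto)
    then show ?thesis by simp
  qed
  let ?y = "?\<gamma> t0"
  have y: "norm ?y = 1" using norm_boundary[OF c t0] by (simp add: norm_eq_sqrt_inner)
  have "2 * (R + 1) * (v - \<epsilon>) / (sqrt R * (v + \<epsilon>)) * arctan (sqrt R * (v + \<epsilon>) * \<delta> / (R - 1)) \<le> boundary_length M A f"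
    if R: "R > 1" for R
  proof -
    define w where "w p = (R\<^sup>2 - 1) * inverse ((f p - R *\<^sub>R ?y) \<bullet> (f p - R *\<^sub>R ?y))" for p
    note pk = poisson_kernel_le[OF y R, folded w_def[abs_def]]
    interpret b: surface_density M A edge "boundary_density w" by (rule boundary_density[OF pk(1)])
    \<comment> \<open>The arc as a subset of the surface, which is the form that
      \<open>total_ge\<close> takes.\<close>
    define Q where "Q = coord_inv c ` edge ` ?I"
    have edgeI: "edge ` ?I \<subseteq> cod_of c" using I(1) by blast
    then have cQ: "coord c ` Q = edge ` ?I"
      using chart_inverse(2)[OF c] unfolding Q_def image_image by force
    have Q: "Q \<subseteq> dom_of c" using edgeI chart_inverse(3)[OF c] by (auto simp: Q_def)
    have "compact (edge ` ?I)" by (intro compact_continuous_image continuous_edge compact_Icc)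
    then have BQ: "coord c ` Q \<in> sets borel" unfolding cQ by (rule borel_compact)
    have "inj edge" by (rule injI) (metis edge_nth(1))
    then have sQ: "slice edge c Q = ?I" unfolding slice_def cQ by (auto simp: inj_image_mem_iff)
    \<comment> \<open>\<open>k\<close> absorbs the factor \<open>R\<close> in front of the squared
      chord, giving the form of \<open>arctan_integral\<close> with a = R - 1.\<close>
    define k where "k = sqrt R * (v + \<epsilon>)"
    have k: "k > 0" "k\<^sup>2 = R * (v + \<epsilon>)\<^sup>2" using R \<epsilon> by (auto simp: k_def power_mult_distrib)
    let ?m = "(R\<^sup>2 - 1) * (v - \<epsilon>)"
    have m: "?m \<ge> 0" using R \<epsilon> by (intro mult_nonneg_nonneg) (auto simp: power2_eq_square mult_mono less_1_mult less_imp_le)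
    have R2: "R\<^sup>2 - 1 > 0" using R by (simp add: power2_eq_square less_1_mult)
    have low: "?m * (1 / ((R - 1)\<^sup>2 + k\<^sup>2 * (t - t0)\<^sup>2)) \<le> boundary_density w c t" if t: "t \<in> ?I" for t
    proof -
      let ?z = "?\<gamma> t - R *\<^sub>R ?y"
      have "?\<gamma> t \<bullet> ?\<gamma> t = 1" "?y \<bullet> ?y = 1" using norm_boundary[OF c] I(1)[OF t] t0 by auto
      \<comment> \<open>For unit vectors the inner product is determined by the chord, which the
        Lipschitz bound \<open>lip\<close> controls.\<close>
      then have zz: "?z \<bullet> ?z = (R - 1)\<^sup>2 + R * (norm (?\<gamma> t - ?y))\<^sup>2"
        unfolding power2_norm_eq_inner
        by (simp add: inner_simps inner_commute power2_eq_square algebra_simps)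
      have "(norm (?\<gamma> t - ?y))\<^sup>2 \<le> ((v + \<epsilon>) * \<bar>t - t0\<bar>)\<^sup>2" by (intro power_mono lip t) simp
      then have le: "?z \<bullet> ?z \<le> (R - 1)\<^sup>2 + k\<^sup>2 * (t - t0)\<^sup>2"
        using R unfolding zz k(2) by (simp add: power_mult_distrib)
      have pos: "?z \<bullet> ?z > 0" unfolding zz using R by (intro add_pos_nonneg) auto
      have "?m * (1 / ((R - 1)\<^sup>2 + k\<^sup>2 * (t - t0)\<^sup>2)) \<le> ?m * (1 / (?z \<bullet> ?z))"
        by (intro mult_left_mono divide_left_mono mult_pos_pos le pos less_le_trans[OF pos le] m) simp
      also have "\<dots> = (R\<^sup>2 - 1) * inverse (?z \<bullet> ?z) * (v - \<epsilon>)" by (simp add: divide_inverse)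
      also have "\<dots> \<le> (R\<^sup>2 - 1) * inverse (?z \<bullet> ?z) * ?n t"
        using I(3)[OF t] R2 pos by (intro mult_left_mono mult_nonneg_nonneg) auto
      finally show ?thesis by (simp add: boundary_density_def local_rep_def w_def)
    qed
    have int: "((\<lambda>t. ?m * (1 / ((R - 1)\<^sup>2 + k\<^sup>2 * (t - t0)\<^sup>2))) has_integral
        ?m * (2 / ((R - 1) * k) * arctan (k * \<delta> / (R - 1)))) ?I"
      using R k \<delta> by (intro has_integral_mult_right arctan_integral) auto
    have "?m * (2 / ((R - 1) * k) * arctan (k * \<delta> / (R - 1))) \<le> integral (slice edge c Q) (boundary_density w c)"
      unfolding sQ
    proof (rule has_integral_le[OF int])
      show "(boundary_density w c has_integral integral ?I (boundary_density w c)) ?I"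
        using set_lebesgue_integral_eq_integral(1)[OF b.density_integrable[OF c Q BQ]] unfolding sQ by blast
    qed (rule low)
    also have "\<dots> \<le> boundary_integral w"
      unfolding boundary_integral_def
    proof (rule b.total_ge[OF _ c Q BQ])
      fix d t assume "d \<in> A" "t \<in> slice edge d (dom_of d)"
      then show "0 \<le> boundary_density w d t"
        using R2 by (simp add: boundary_density_def local_rep_def w_def)
    qed
    also have "\<dots> \<le> boundary_length M A f" by (rule pk(2))
    \<comment> \<open>The factor R - 1 of \<open>R\<^sup>2 - 1\<close> cancels against the one from
      the antiderivative, so the bound does not degenerate as R tends to 1.\<close>
    also have "?m * (2 / ((R - 1) * k) * arctan (k * \<delta> / (R - 1))) = 2 * (R + 1) * (v - \<epsilon>) / k * arctan (k * \<delta> / (R - 1))"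
      using R k(1) by (simp add: power2_eq_square field_simps)
    finally show ?thesis by (simp add: k_def)
  qed
  then show thesis using that \<delta>(1) by blast
qed

text \<open>As R decreases to 1 the arctangent tends to pi / 2 and the bound to
  \<open>2 * pi * (v - \<epsilon>) / (v + \<epsilon>)\<close>; then \<open>\<epsilon>\<close> tends
  to 0.\<close>

lemma boundary_length_ge:
  assumes "surface_boundary A \<noteq> {}"
  shows "2 * pi \<le> boundary_length M A f"
proof -
  let ?L = "boundary_length M A f"
  obtain c p where c: "c \<in> A" and p: "p \<in> dom_of c" "coord c p $ 2 = 0"
    using assms by (auto simp: surface_boundary_def)
  define t0 where "t0 = coord c p $ 1"
  have t0: "edge t0 \<in> cod_of c"
  proof -
    have "coord c p = edge t0" using p by (simp add: edge_eq_iff t0_def)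
    then show ?thesis using p(1) by (metis imageI)
  qed
  interpret c: immersed_patch "cod_of c" "local_rep c f" by (rule immersed[OF c])
  define v where "v = norm (c.F1 (edge t0))"
  have v: "v > 0" using c.F1_pos[OF t0] by (simp add: v_def)
  have eps: "2 * pi * (v - \<epsilon>) \<le> ?L * (v + \<epsilon>)" if \<epsilon>: "0 < \<epsilon>" "\<epsilon> < v" for \<epsilon>
  proof -
    obtain \<delta> where \<delta>: "\<delta> > 0" "\<And>R. R > 1 \<Longrightarrow>
      2 * (R + 1) * (v - \<epsilon>) / (sqrt R * (v + \<epsilon>)) * arctan (sqrt R * (v + \<epsilon>) * \<delta> / (R - 1)) \<le> ?L"
      by (rule boundary_length_ge_arctan[OF c t0 v_def \<epsilon>]) blast
    \<comment> \<open>Here s = R - 1. Writing the argument of the arctangent as a product with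
      \<open>inverse s\<close> reduces its divergence to that of \<open>inverse s\<close>.\<close>
    let ?g = "\<lambda>s. 2 * ((1 + s) + 1) * (v - \<epsilon>) / (sqrt (1 + s) * (v + \<epsilon>)) * arctan (sqrt (1 + s) * ((v + \<epsilon>) * \<delta>) * inverse s)"
    have sq: "((\<lambda>s. sqrt (1 + s)) \<longlongrightarrow> sqrt (1 + 0)) (at_right 0)" by (intro tendsto_intros)
    have "((\<lambda>s. sqrt (1 + s) * ((v + \<epsilon>) * \<delta>)) \<longlongrightarrow> sqrt (1 + 0) * ((v + \<epsilon>) * \<delta>)) (at_right 0)"
      by (intro tendsto_intros sq)
    then have "filterlim (\<lambda>s. sqrt (1 + s) * ((v + \<epsilon>) * \<delta>) * inverse s) at_top (at_right 0)"
      by (rule filterlim_tendsto_pos_mult_at_top[OF _ _ filterlim_inverse_at_top_right]) (use v \<epsilon> \<delta> in simp)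
    then have at: "((\<lambda>s. arctan (sqrt (1 + s) * ((v + \<epsilon>) * \<delta>) * inverse s)) \<longlongrightarrow> pi / 2) (at_right 0)"
      by (rule filterlim_compose[OF tendsto_arctan_at_top])
    have "(?g \<longlongrightarrow> 2 * ((1 + 0) + 1) * (v - \<epsilon>) / (sqrt (1 + 0) * (v + \<epsilon>)) * (pi / 2)) (at_right 0)"
      by (intro tendsto_intros sq at) (use v \<epsilon> in auto)
    moreover have "\<forall>\<^sub>F s in at_right 0. ?g s \<le> ?L"
    proof -
      have "?g s \<le> ?L" if "s > 0" for s
        using \<delta>(2)[of "1 + s"] that by (simp add: divide_inverse mult_ac)
      then show ?thesis by (auto simp: eventually_at_right_field intro!: exI[of _ 1])
    qed
    ultimately have "2 * ((1 + 0) + 1) * (v - \<epsilon>) / (sqrt (1 + 0) * (v + \<epsilon>)) * (pi / 2) \<le> ?L"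
      by (rule tendsto_upperbound) simp
    then show ?thesis using v \<epsilon> by (simp add: field_simps)
  qed
  \<comment> \<open>With the denominator cleared both sides are affine in \<open>\<epsilon>\<close>;
    at the end \<open>v\<close> is divided out, which is positive for an immersion.\<close>
  have "((\<lambda>\<epsilon>. 2 * pi * (v - \<epsilon>)) \<longlongrightarrow> 2 * pi * (v - 0)) (at_right 0)"
    "((\<lambda>\<epsilon>. ?L * (v + \<epsilon>)) \<longlongrightarrow> ?L * (v + 0)) (at_right 0)" by (intro tendsto_intros)+
  moreover have "\<forall>\<^sub>F \<epsilon> in at_right 0. 2 * pi * (v - \<epsilon>) \<le> ?L * (v + \<epsilon>)"
    using eps v by (auto simp: eventually_at_right_field intro!: exI[of _ v])
  ultimately have "2 * pi * (v - 0) \<le> ?L * (v + 0)"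
    using tendsto_le[of "at_right (0::real)"] trivial_limit_at_right_real by blast
  then show ?thesis using v by simp
qed

end

theorem theorem5p4:
  fixes M :: "'m::t2_space set"
    and A :: "'m chart set"
    and f :: "'m \<Rightarrow> real^'n"
  assumes "smooth_surface M A"
    and "compact M"
    and "minimal_immersion A f"
    and "f ` M \<subseteq> cball 0 1"
    and "surface_boundary A \<noteq> {}"
    and "f ` surface_boundary A \<subseteq> sphere 0 1"
    and "meets_unit_sphere_orthogonally A f"
  shows "2 * surface_area M A f = boundary_length M A f \<and> boundary_length M A f \<ge> 2 * pi"
proof -
  interpret free_boundary_surface M A f
    using assms by unfold_locales
  show ?thesis using area_length boundary_length_ge[OF assms(5)] by blast
qed

end
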